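(* Let $A\in\mathbb R^{d\times d}$ be invertible, $B\in\mathbb R^{d\times m}$, $Q=Q^\top\succ0$ in $\mathbb R^{d\times d}$, $R=R^\top\succ0$ in $\mathbb R^{m\times m}$, and let $(A,B)$ be stabilizable. Put $G=BR^{-1}B^\top$ and $$M=M(A,B,Q,R)=\begin{pmatrix} A+GA^{-\top}Q & GA^{-\top} \\ A^{-\top}Q & A^{-\top} \end{pmatrix}.$$ Then $M$ is hyperbolic. With the columns of $V_s=\binom{X_s}{P_s}$ and $V_u=\binom{X_u}{P_u}$ bases of the stable and unstable subspaces of $M$ (blocks of $d$ rows), $X_s$ is invertible, and for every $S=S^\top\preceq0$ the block $P_u-SX_u$ is invertible. The rows $$x_0=\xi,\qquad p_T-Sx_T=\pi$$ satisfy the uniform Green property for every $T\ge1$ (that is, with initial horizon $T_0=1$, for the interior equation $h_{t+1}=Mh_t+g_t$, $h_t=(x_t,p_t)$). The constants can be chosen uniformly on compact subsets of this data class $\{(A,B,Q,R,S)\}$.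
   Context: $(A,B)$ is stabilizable if $\operatorname{rank}[A-\mu I\ \ B]=d$ for every $\mu\in\mathbb C$ with $|\mu|\ge1$. The matrix $M$ is the one-step map $\binom{x_{t+1}}{p_{t+1}}=M\binom{x_t}{p_t}$ of the linear-quadratic state–costate equations $x_{t+1}=Ax_t+BR^{-1}B^\top p_{t+1}$, $p_t=A^\top p_{t+1}-Qx_t$; it is symplectic. Hyperbolic: no eigenvalue on the unit circle; stable/unstable subspaces correspond to eigenvalues of modulus $<1$ / $>1$ (each has dimension $d$ here). Uniform Green property. Fix norms on finite-dimensional spaces. For a linear $L:\mathbb R^n\times\mathbb R^n\to\mathbb R^n$ and $\mathsf B_0,\mathsf B_T\in\mathbb R^{n\times n}$, the triple $(L,\mathsf B_0,\mathsf B_T)$ has the uniform Green property with constants $C_G\ge1,\gamma>0,T_0\ge1$ if for every integer $T\ge T_0$ and all $f_0,\dots,f_{T-1},b\in\mathbb R^n$ the problem $L[h_t,h_{t+1}]=f_t$ $(0\le t<T)$, $\mathsf B_0h_0+\mathsf B_Th_T=b$ has a unique solution, satisfying for $0\le t\le T$ $$\|h_t\|\le C_G\Bigl[(e^{-\gamma t}+e^{-\gamma(T-t)})\|b\|+\sum_{s=0}^{T-1}\kappa_T(t,s)\|f_s\|\Bigr],\quad \kappa_T(t,s)=e^{-\gamma|t-s|}+e^{-\gamma(t+T-s)}+e^{-\gamma(T-t+s)}.$$ Here $n=2d$, $L[h,h^+]=h^+-Mh$, $\mathsf B_0=\begin{pmatrix} I & 0 \\ 0 & 0 \end{pmatrix}$,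 $\mathsf B_T=\begin{pmatrix} 0 & 0 \\ -S & I \end{pmatrix}$. *)

theory Defs
  imports "HOL-Analysis.Analysis"
begin

section \<open>Block matrices\<close>

text \<open>
  Blocks are indexed by sum types.  As a matrix is a vector of its rows, block_col stacks
  vectors as well as matrices.
\<close>

definition block_col :: "'a^'p \<Rightarrow> 'a^'q \<Rightarrow> 'a^('p + 'q)" where
  "block_col X Y = (\<chi> i. case i of Inl k \<Rightarrow> X $ k | Inr k \<Rightarrow> Y $ k)"

definition block_row :: "'a^'p^'n \<Rightarrow> 'a^'q^'n \<Rightarrow> 'a^('p + 'q)^'n" where
  "block_row X Y = (\<chi> i. block_col (X $ i) (Y $ i))"

definition block_matrix ::
  "'a^'p^'m \<Rightarrow> 'a^'q^'m \<Rightarrow> 'a^'p^'n \<Rightarrow> 'a^'q^'n \<Rightarrow> 'a^('p + 'q)^('m + 'n)" where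
  "block_matrix X Y Z W = block_col (block_row X Y) (block_row Z W)"

section \<open>Definiteness and stabilizability\<close>

definition pos_def :: "real^'n^'n \<Rightarrow> bool" where
  "pos_def Q \<longleftrightarrow> transpose Q = Q \<and> (\<forall>x. x \<noteq> 0 \<longrightarrow> x \<bullet> (Q *v x) > 0)"

definition neg_semidef :: "real^'n^'n \<Rightarrow> bool" where
  "neg_semidef S \<longleftrightarrow> transpose S = S \<and> (\<forall>x. x \<bullet> (S *v x) \<le> 0)"

abbreviation cmatrix :: "real^'n^'m \<Rightarrow> complex^'n^'m" where
  "cmatrix \<equiv> map_matrix complex_of_real"

definition cvector :: "real^'n \<Rightarrow> complex^'n" where
  "cvector v = (\<chi> i. complex_of_real (v $ i))"

definition stabilizable :: "real^'d^'d \<Rightarrow> real^'m^'d \<Rightarrow> bool" where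
  "stabilizable A B \<longleftrightarrow>
     (\<forall>\<mu>. cmod \<mu> \<ge> 1 \<longrightarrow> rank (block_row (cmatrix A - mat \<mu>) (cmatrix B)) = CARD('d))"

section \<open>Hyperbolicity, stable and unstable subspaces\<close>

definition eigenvalue :: "complex^'n^'n \<Rightarrow> complex \<Rightarrow> bool" where
  "eigenvalue M \<mu> \<longleftrightarrow> (\<exists>v. v \<noteq> 0 \<and> M *v v = \<mu> *s v)"

definition hyperbolic :: "real^'n^'n \<Rightarrow> bool" where
  "hyperbolic M \<longleftrightarrow> \<not> (\<exists>\<mu>. eigenvalue (cmatrix M) \<mu> \<and> cmod \<mu> = 1)"

text \<open>
  Iteration of the linear map is used because the power operator on type \<open>vec\<close> is
  componentwise.
\<close>

definition gen_eigenspace :: "complex^'n^'n \<Rightarrow> complex \<Rightarrow> (complex^'n) set" where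
  "gen_eigenspace M \<mu> = {v. \<exists>k. ((\<lambda>w. (M - mat \<mu>) *v w) ^^ k) v = 0}"

text \<open>
  The real subspace belonging to a conjugation-invariant set \<open>\<Lambda>\<close> of eigenvalues: the real
  vectors in the complex sum of the corresponding generalized eigenspaces.  Here \<open>vec.span\<close> is
  the span over the complex numbers.
\<close>

definition spectral_subspace :: "real^'n^'n \<Rightarrow> complex set \<Rightarrow> (real^'n) set" where
  "spectral_subspace M \<Lambda> =
     {v. cvector v \<in> vec.span (\<Union>\<mu>\<in>{\<mu>\<in>\<Lambda>. eigenvalue (cmatrix M) \<mu>}. gen_eigenspace (cmatrix M) \<mu>)}"

definition stable_subspace :: "real^'n^'n \<Rightarrow> (real^'n) set" where
  "stable_subspace M = spectral_subspace M {\<mu>. cmod \<mu> < 1}"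

definition unstable_subspace :: "real^'n^'n \<Rightarrow> (real^'n) set" where
  "unstable_subspace M = spectral_subspace M {\<mu>. cmod \<mu> > 1}"

text \<open>Injectivity is needed because \<open>columns V\<close> is a set, which forgets repeated columns.\<close>

definition columns_basis :: "real^'k^'n \<Rightarrow> (real^'n) set \<Rightarrow> bool" where
  "columns_basis V E \<longleftrightarrow>
     inj (\<lambda>j. column j V) \<and> independent (columns V) \<and> span (columns V) = E"

section \<open>The uniform Green property\<close>

definition is_norm :: "('a::real_vector \<Rightarrow> real) \<Rightarrow> bool" where
  "is_norm \<nu> \<longleftrightarrow>
     (\<forall>x. \<nu> x \<ge> 0) \<and> (\<forall>x. \<nu> x = 0 \<longleftrightarrow> x = 0) \<and>
     (\<forall>c x. \<nu> (c *\<^sub>R x) = \<bar>c\<bar> * \<nu> x) \<and> (\<forall>x y. \<nu> (x + y) \<le> \<nu> x + \<nu> y)"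

definition green_kernel :: "real \<Rightarrow> nat \<Rightarrow> nat \<Rightarrow> nat \<Rightarrow> real" where
  "green_kernel \<gamma> T t s =
     exp (- \<gamma> * \<bar>real t - real s\<bar>) + exp (- \<gamma> * (real t + real T - real s))
     + exp (- \<gamma> * (real T - real t + real s))"

definition bvp_solution ::
  "((real^'n) \<times> (real^'n) \<Rightarrow> real^'n) \<Rightarrow> real^'n^'n \<Rightarrow> real^'n^'n \<Rightarrow> nat
     \<Rightarrow> (nat \<Rightarrow> real^'n) \<Rightarrow> real^'n \<Rightarrow> (nat \<Rightarrow> real^'n) \<Rightarrow> bool" where
  "bvp_solution L B0 BT T f b h \<longleftrightarrow>
     (\<forall>t<T. L (h t, h (Suc t)) = f t) \<and> B0 *v h 0 + BT *v h T = b"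

text \<open>
  Finite sequences are represented by functions on \<open>nat\<close>: only \<open>f t\<close> for \<open>t < T\<close> and \<open>h t\<close>
  for \<open>t \<le> T\<close> matter, so solutions are unique up to agreement on \<open>{..T}\<close>.
\<close>

definition uniform_green ::
  "(real^'n \<Rightarrow> real) \<Rightarrow> ((real^'n) \<times> (real^'n) \<Rightarrow> real^'n) \<Rightarrow> real^'n^'n \<Rightarrow> real^'n^'n
     \<Rightarrow> real \<Rightarrow> real \<Rightarrow> nat \<Rightarrow> bool" where
  "uniform_green \<nu> L B0 BT C \<gamma> T0 \<longleftrightarrow>
     linear L \<and> C \<ge> 1 \<and> \<gamma> > 0 \<and> T0 \<ge> 1 \<and>
     (\<forall>T\<ge>T0. \<forall>f b. \<exists>h. bvp_solution L B0 BT T f b h \<and>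
        (\<forall>h'. bvp_solution L B0 BT T f b h' \<longrightarrow> (\<forall>t\<le>T. h' t = h t)) \<and>
        (\<forall>t\<le>T. \<nu> (h t) \<le>
           C * ((exp (- \<gamma> * real t) + exp (- \<gamma> * (real T - real t))) * \<nu> b
                + (\<Sum>s<T. green_kernel \<gamma> T t s * \<nu> (f s)))))"

section \<open>Linear-quadratic data\<close>

definition lq_matrix ::
  "real^'d^'d \<Rightarrow> real^'m^'d \<Rightarrow> real^'d^'d \<Rightarrow> real^'m^'m \<Rightarrow> real^('d + 'd)^('d + 'd)" where
  "lq_matrix A B Q R =
     (let G = B ** matrix_inv R ** transpose B; A' = transpose (matrix_inv A)
      in block_matrix (A + G ** A' ** Q) (G ** A') (A' ** Q) A')"

definition lq_data :: "real^'d^'d \<Rightarrow> real^'m^'d \<Rightarrow> real^'d^'d \<Rightarrow> real^'m^'m \<Rightarrow> bool" where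
  "lq_data A B Q R \<longleftrightarrow> invertible A \<and> pos_def Q \<and> pos_def R \<and> stabilizable A B"

definition data_class ::
  "((real^'d^'d) \<times> (real^'m^'d) \<times> (real^'d^'d) \<times> (real^'m^'m) \<times> (real^'d^'d)) set" where
  "data_class = {(A, B, Q, R, S). lq_data A B Q R \<and> neg_semidef S}"

text \<open>
  The interior equation \<open>h\<^sub>t\<^sub>+\<^sub>1 = M h\<^sub>t + g\<^sub>t\<close> for \<open>h = (x, p)\<close>, with the boundary rows
  \<open>x\<^sub>0 = \<xi>\<close>, \<open>p\<^sub>T - S x\<^sub>T = \<pi>\<close> and boundary datum \<open>b = (\<xi>, \<pi>)\<close>.
\<close>

definition lq_green ::
  "(real^('d + 'd) \<Rightarrow> real) \<Rightarrow> real^'d^'d \<Rightarrow> real^'m^'d \<Rightarrow> real^'d^'d \<Rightarrow> real^'m^'m \<Rightarrow> real^'d^'d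
     \<Rightarrow> real \<Rightarrow> real \<Rightarrow> nat \<Rightarrow> bool" where
  "lq_green \<nu> A B Q R S C \<gamma> T0 \<longleftrightarrow>
     uniform_green \<nu> (\<lambda>(h, h'). h' - lq_matrix A B Q R *v h)
       (block_matrix (mat 1) 0 0 0) (block_matrix 0 0 (- S) (mat 1)) C \<gamma> T0"

end

theory Submission
  imports Defs "HOL-Computational_Algebra.Fundamental_Theorem_Algebra"
begin

text \<open>
  Along a trajectory \<open>x \<bullet> p\<close> increases by the coercive amount \<open>x \<bullet> Q x + p' \<bullet> G p'\<close>, which controls \<open>x\<close> and
  the image of \<open>p'\<close> under the transpose of \<open>B\<close>.  Stabilizability supplies a form \<open>P \<ge> 0\<close> with
  \<open>A P A\<^sup>T - P \<le> k B B\<^sup>T - I\<close> (convex separation: otherwise the separating functional yields an eigenvector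
  violating the rank condition), and \<open>P\<close> controls the rest of \<open>p'\<close>.  Since \<open>S \<le> 0\<close> gives the boundary term at
  \<open>T\<close> the right sign, the squared \<open>l\<^sup>2\<close> norm of a trajectory is bounded by that of its data.  The
  bound survives a slowly varying exponential weight; centring the weight at the time of observation
  gives the Green estimate pointwise.  All constants depend only on bounds that are stable under
  perturbation of the data, hence uniform on compact sets.

  Hyperbolicity, the dimensions and the two transversality statements are read off from the Green
  estimate, because trajectories in the stable and unstable subspaces decay.
\<close>

section \<open>Energy estimates\<close>

text \<open>The obstacle is that \<open>G\<close> is only semidefinite: the energy balance sees
  \<open>p'\<close> through \<open>transpose B\<close> alone. A second functional,
  \<open>p \<bullet> (P *v p)\<close>, is therefore followed along the costate equation. It bounds
  \<open>p'\<close> by the energy, while the energy balance returns only a small multiple of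
  \<open>p'\<close>, so the two inequalities close up.

  All estimates use the implicit equations, with the later costate \<open>p'\<close> on the
  right-hand side. The inverse of \<open>A\<close> thus enters no constant and appears only in the
  translation from \<open>lq_matrix\<close>. No Riccati solution, spectral projection or Jordan form
  is constructed, hence none has to depend continuously on the data; near a datum even
  \<open>P\<close> is frozen. The powers of \<open>\<kappa>\<close> and the large numerical factors
  are products of crude inequalities and have no further meaning.\<close>

lemma inner_le_young:
  fixes x y :: "'a::real_inner"
  assumes "\<theta> > 0"
  shows "\<bar>x \<bullet> y\<bar> \<le> \<theta> * (norm x)\<^sup>2 + (norm y)\<^sup>2 / \<theta>"
proof -
  have "0 \<le> (sqrt \<theta> * norm x - norm y / sqrt \<theta>)\<^sup>2" by simp
  also have "\<dots> = \<theta> * (norm x)\<^sup>2 + (norm y)\<^sup>2 / \<theta> - 2 * (norm x * norm y)"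
    using assms by (simp add: power2_diff power_mult_distrib power_divide)
  finally have "2 * (norm x * norm y) \<le> \<theta> * (norm x)\<^sup>2 + (norm y)\<^sup>2 / \<theta>" by simp
  moreover have "\<bar>x \<bullet> y\<bar> \<le> norm x * norm y" by (rule Cauchy_Schwarz_ineq2)
  moreover have "0 \<le> norm x * norm y" by simp
  ultimately show ?thesis by linarith
qed

lemma norm_add_sq_le:
  fixes x y :: "'a::real_normed_vector"
  shows "(norm (x + y))\<^sup>2 \<le> 2 * ((norm x)\<^sup>2 + (norm y)\<^sup>2)"
proof -
  have "(norm (x + y))\<^sup>2 \<le> (norm x + norm y)\<^sup>2"
    by (simp add: norm_triangle_ineq power_mono)
  also have "\<dots> \<le> 2 * ((norm x)\<^sup>2 + (norm y)\<^sup>2)"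
    using sum_squares_bound[of "norm x" "norm y"] by (simp add: power2_sum)
  finally show ?thesis .
qed

lemma norm_add3_sq_le:
  fixes x y z :: "'a::real_normed_vector"
  shows "(norm (x + y + z))\<^sup>2 \<le> 3 * ((norm x)\<^sup>2 + (norm y)\<^sup>2 + (norm z)\<^sup>2)"
proof -
  have "(norm (x + y + z))\<^sup>2 \<le> (norm x + norm y + norm z)\<^sup>2"
    by (intro power_mono order_trans[OF norm_triangle_ineq] add_mono) auto
  also have "\<dots> \<le> 3 * ((norm x)\<^sup>2 + (norm y)\<^sup>2 + (norm z)\<^sup>2)"
    using sum_squares_bound[of "norm x" "norm y"] sum_squares_bound[of "norm x" "norm z"]
      sum_squares_bound[of "norm y" "norm z"]
    by (simp add: power2_eq_square algebra_simps)
  finally show ?thesis .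
qed

lemma inner_matrix_transpose:
  fixes A :: "real^'n^'m"
  shows "x \<bullet> (A *v y) = (transpose A *v x) \<bullet> y"
  by (metis dot_lmul_matrix transpose_matrix_vector)

lemma norm_sq_le_of_le:
  fixes a :: real
  assumes "norm x \<le> k * norm y"
  shows "(norm x)\<^sup>2 \<le> k\<^sup>2 * (norm y)\<^sup>2"
  using power_mono[OF assms norm_ge_zero, of 2] by (simp add: power_mult_distrib)

lemma absorb_energy:
  fixes X Y D \<kappa> :: real
  assumes k: "\<kappa> \<ge> 1" and nn: "X \<ge> 0" "Y \<ge> 0" "D \<ge> 0"
    and Y: "Y \<le> 28 * \<kappa>^6 * (X + D)"
    and X: "\<And>\<theta>. \<theta> > 0 \<Longrightarrow> X \<le> \<kappa> * (\<theta> * (7 * \<kappa>\<^sup>2 * (X + Y + D)) + D / \<theta>)"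
  shows "X + Y + D \<le> 24000 * \<kappa>^16 * D"
proof -
  have k6: "\<kappa>^6 \<ge> 1" and k10: "\<kappa>^10 \<ge> 1" using k by auto
  have XYD: "X + Y + D \<le> 29 * \<kappa>^6 * (X + D)"
  proof -
    have "1 * (X + D) \<le> \<kappa>^6 * (X + D)" by (rule mult_right_mono[OF k6]) (use nn in simp)
    moreover have "29 * \<kappa>^6 * (X + D) = 28 * \<kappa>^6 * (X + D) + \<kappa>^6 * (X + D)" by (simp add: algebra_simps)
    moreover have "X + Y + D = (X + D) + Y" by simp
    ultimately show ?thesis using Y by (metis add_mono add.commute mult_1)
  qed
  \<comment> \<open>After the substitution, \<open>X + D\<close> carries the factor
    \<open>7 * 29 * \<kappa>^9 * \<theta>\<close>; this choice makes it 1/2.\<close>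
  define \<theta> where "\<theta> = 1 / (406 * \<kappa>^9)"
  have t: "\<theta> > 0" using k by (simp add: \<theta>_def)
  have "X \<le> \<kappa> * (\<theta> * (7 * \<kappa>\<^sup>2 * (X + Y + D)) + D / \<theta>)" by (rule X[OF t])
  also have "\<dots> \<le> \<kappa> * (\<theta> * (7 * \<kappa>\<^sup>2 * (29 * \<kappa>^6 * (X + D))) + D / \<theta>)"
    using XYD t k by (intro mult_left_mono add_mono) auto
  also have "\<dots> = (X + D) / 2 + 406 * \<kappa>^10 * D"
    using k by (simp add: \<theta>_def field_simps eval_nat_numeral)
  finally have "X \<le> D + 812 * \<kappa>^10 * D" by (simp add: field_simps)
  moreover have "1 * D \<le> \<kappa>^10 * D" by (rule mult_right_mono[OF k10 nn(3)])
  ultimately have "X + D \<le> 814 * \<kappa>^10 * D" by linarith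
  then have "29 * \<kappa>^6 * (X + D) \<le> 29 * \<kappa>^6 * (814 * \<kappa>^10 * D)"
    using k by (intro mult_left_mono) auto
  also have "\<dots> = 23606 * (\<kappa>^16 * D)" by (simp add: eval_nat_numeral)
  also have "\<dots> \<le> 24000 * (\<kappa>^16 * D)"
    using nn k by (intro mult_right_mono) auto
  finally show ?thesis using XYD by simp
qed

text \<open>Each inequality involving \<open>\<kappa>\<close> weakens as \<open>\<kappa>\<close>
  grows, so finitely many local constants can be replaced by their maximum. \<open>G\<close> is
  compared with \<open>transpose B\<close> from above and from below because that is the part of the
  costate seen by the energy. \<open>P\<close> satisfies an inequality rather than an equation, so
  one \<open>P\<close> can serve a whole neighbourhood of data.\<close>

locale lq_bounds =
  fixes \<kappa> :: real and A :: "real^'d^'d" and B :: "real^'m^'d" and G Q S P :: "real^'d^'d"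
  assumes kappa: "\<kappa> \<ge> 1"
    and A_le: "norm (A *v x) \<le> \<kappa> * norm x"
    and At_le: "norm (transpose A *v x) \<le> \<kappa> * norm x"
    and Q_le: "norm (Q *v x) \<le> \<kappa> * norm x"
    and S_le: "norm (S *v x) \<le> \<kappa> * norm x"
    and P_le: "norm (P *v x) \<le> \<kappa> * norm x"
    and Bt_le: "norm (transpose B *v x) \<le> \<kappa> * norm x"
    and G_le: "norm (G *v x) \<le> \<kappa> * norm (transpose B *v x)"
    and Q_ge: "(norm x)\<^sup>2 \<le> \<kappa> * (x \<bullet> (Q *v x))"
    and G_ge: "(norm (transpose B *v x))\<^sup>2 \<le> \<kappa> * (x \<bullet> (G *v x))"
    and S_nonpos: "x \<bullet> (S *v x) \<le> 0"
    and P_sym: "transpose P = P"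
    and P_nonneg: "0 \<le> x \<bullet> (P *v x)"
    and P_lyap: "(transpose A *v x) \<bullet> (P *v (transpose A *v x))
                   \<le> x \<bullet> (P *v x) - (norm x)\<^sup>2 + \<kappa> * (norm (transpose B *v x))\<^sup>2"
begin

text \<open>\<open>P_lyap\<close> is a decay statement for \<open>transpose A\<close>, which carries
  the costate backwards from \<open>p'\<close> to \<open>p\<close>. The remainder
  \<open>b - Q *v x\<close> adds a cross term and a quadratic term; the cross term is paid with half
  of the gain in \<open>p'\<close>.\<close>

lemma lyapunov_step:
  assumes p: "p = transpose A *v p' - Q *v x + b"
  shows "(norm p')\<^sup>2 / 2 \<le> p' \<bullet> (P *v p') - p \<bullet> (P *v p)
           + 6 * \<kappa>^6 * ((norm x)\<^sup>2 + (norm (transpose B *v p'))\<^sup>2 + (norm b)\<^sup>2)"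
proof -
  define y where "y = transpose A *v p'"
  define e where "e = b - Q *v x"
  define q where "q = (norm x)\<^sup>2 + (norm b)\<^sup>2"
  have k: "\<kappa> \<ge> 1" by (rule kappa)
  have q0: "q \<ge> 0" by (simp add: q_def)
  have pe: "p = y + e" by (simp add: p y_def e_def)
  have sym: "e \<bullet> (P *v y) = y \<bullet> (P *v e)"
    by (metis inner_commute inner_matrix_transpose P_sym)
  have exp: "p \<bullet> (P *v p) = y \<bullet> (P *v y) + 2 * (y \<bullet> (P *v e)) + e \<bullet> (P *v e)"
    by (simp add: pe matrix_vector_right_distrib inner_add_left inner_add_right sym)
  have "(norm e)\<^sup>2 \<le> 2 * ((norm b)\<^sup>2 + (norm (Q *v x))\<^sup>2)"
    using norm_add_sq_le[of b "- (Q *v x)"] by (simp add: e_def)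
  also have "(norm (Q *v x))\<^sup>2 \<le> \<kappa>\<^sup>2 * (norm x)\<^sup>2" by (rule norm_sq_le_of_le[OF Q_le])
  also have "2 * ((norm b)\<^sup>2 + \<kappa>\<^sup>2 * (norm x)\<^sup>2) \<le> 2 * \<kappa>\<^sup>2 * q"
    using mult_right_mono[OF one_le_power[OF k, of 2], of "(norm b)\<^sup>2"]
    by (simp add: q_def algebra_simps)
  finally have e2: "(norm e)\<^sup>2 \<le> 2 * \<kappa>\<^sup>2 * q" by simp
  have "\<bar>e \<bullet> (P *v e)\<bar> \<le> norm e * norm (P *v e)" by (rule Cauchy_Schwarz_ineq2)
  also have "\<dots> \<le> norm e * (\<kappa> * norm e)" by (intro mult_left_mono P_le) auto
  finally have ePe: "e \<bullet> (P *v e) \<le> \<kappa> * (norm e)\<^sup>2" by (simp add: power2_eq_square mult_ac)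
  have y2: "(norm y)\<^sup>2 \<le> \<kappa>\<^sup>2 * (norm p')\<^sup>2"
    unfolding y_def by (rule norm_sq_le_of_le[OF At_le])
  have Pe2: "(norm (P *v e))\<^sup>2 \<le> \<kappa>\<^sup>2 * (norm e)\<^sup>2" by (rule norm_sq_le_of_le[OF P_le])
  have nz: "\<kappa> \<noteq> 0" using k by auto
  \<comment> \<open>The weights are set against \<open>norm y \<le> \<kappa> * norm p'\<close>: the
    first summand then costs exactly half of the squared norm of \<open>p'\<close>.\<close>
  have "2 * \<bar>y \<bullet> (P *v e)\<bar> \<le> (norm y)\<^sup>2 / (2 * \<kappa>\<^sup>2) + 2 * \<kappa>\<^sup>2 * (norm (P *v e))\<^sup>2"
  proof -
    have "0 \<le> (norm y / (2 * \<kappa>) - \<kappa> * norm (P *v e))\<^sup>2" by simp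
    also have "\<dots> = (norm y)\<^sup>2 / (4 * \<kappa>\<^sup>2) + \<kappa>\<^sup>2 * (norm (P *v e))\<^sup>2 - norm y * norm (P *v e)"
      using nz by (simp add: power2_diff power_mult_distrib power_divide)
    finally have "norm y * norm (P *v e) \<le> (norm y)\<^sup>2 / (4 * \<kappa>\<^sup>2) + \<kappa>\<^sup>2 * (norm (P *v e))\<^sup>2" by simp
    with Cauchy_Schwarz_ineq2[of y "P *v e"] show ?thesis by simp
  qed
  also have "\<dots> \<le> (\<kappa>\<^sup>2 * (norm p')\<^sup>2) / (2 * \<kappa>\<^sup>2) + 2 * \<kappa>\<^sup>2 * (\<kappa>\<^sup>2 * (norm e)\<^sup>2)"
    using y2 Pe2 by (intro add_mono divide_right_mono mult_left_mono) auto
  also have "\<dots> = (norm p')\<^sup>2 / 2 + 2 * \<kappa>^4 * (norm e)\<^sup>2"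
    using nz by (simp add: field_simps eval_nat_numeral)
  finally have yPe: "2 * (y \<bullet> (P *v e)) \<le> (norm p')\<^sup>2 / 2 + 2 * \<kappa>^4 * (norm e)\<^sup>2" by linarith
  have "(\<kappa> + 2 * \<kappa>^4) * (norm e)\<^sup>2 \<le> (3 * \<kappa>^4) * (2 * \<kappa>\<^sup>2 * q)"
  proof (rule mult_mono[OF _ e2])
    have "\<kappa> ^ 1 \<le> \<kappa>^4" using k by (intro power_increasing) auto
    then show "\<kappa> + 2 * \<kappa>^4 \<le> 3 * \<kappa>^4" by simp
  qed (use k in auto)
  also have "\<dots> = 6 * \<kappa>^6 * q" by (simp add: eval_nat_numeral)
  finally have ee: "\<kappa> * (norm e)\<^sup>2 + 2 * \<kappa>^4 * (norm e)\<^sup>2 \<le> 6 * \<kappa>^6 * q" by (simp add: algebra_simps)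
  have "\<kappa> ^ 1 \<le> \<kappa>^6" using k by (intro power_increasing) auto
  then have "\<kappa> \<le> 6 * \<kappa>^6" using k by simp
  then have bb: "\<kappa> * (norm (transpose B *v p'))\<^sup>2 \<le> 6 * \<kappa>^6 * (norm (transpose B *v p'))\<^sup>2"
    by (intro mult_right_mono) auto
  show ?thesis
    using P_lyap[of p'] exp ePe yPe ee bb unfolding y_def[symmetric] q_def
    by (simp add: algebra_simps)
qed

text \<open>This is the product rule for \<open>x \<bullet> p\<close>. The contributions of
  \<open>A\<close> and \<open>transpose A\<close> cancel because the two equations are adjoint to
  each other, and \<open>Q\<close> and \<open>G\<close> remain with the same sign.\<close>

lemma costate_identity:
  assumes x': "x' = A *v x + G *v p' + a" and p: "p = transpose A *v p' - Q *v x + b"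
  shows "x' \<bullet> p' - x \<bullet> p = x \<bullet> (Q *v x) + p' \<bullet> (G *v p') + p' \<bullet> a - x \<bullet> b"
proof -
  have "p' \<bullet> (A *v x) = x \<bullet> (transpose A *v p')"
    by (simp add: inner_matrix_transpose inner_commute)
  then show ?thesis
    by (simp add: x' p inner_add_left inner_add_right inner_diff_right inner_commute)
qed

text \<open>Two sums telescope, one of \<open>p \<bullet> (P *v p)\<close> and one of
  \<open>x \<bullet> p\<close>. Of the boundary terms, those of \<open>P\<close> at time
  \<open>0\<close> and of \<open>S\<close> at time \<open>T\<close> have a good sign; the others are
  recovered from the data and from one step of the equations.\<close>

theorem energy_estimate:
  fixes x p a b :: "nat \<Rightarrow> real^'d"
  assumes T: "T \<ge> 1"
    and x: "\<And>t. t < T \<Longrightarrow> x (Suc t) = A *v x t + G *v p (Suc t) + a t"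
    and p: "\<And>t. t < T \<Longrightarrow> p t = transpose A *v p (Suc t) - Q *v x t + b t"
  defines "D \<equiv> (norm (x 0))\<^sup>2 + (norm (p T - S *v x T))\<^sup>2 + (\<Sum>t<T. (norm (a t))\<^sup>2 + (norm (b t))\<^sup>2)"
  shows "(\<Sum>t<T. (norm (x t))\<^sup>2 + (norm (p (Suc t)))\<^sup>2) \<le> 24000 * \<kappa>^16 * D"
    and "\<And>t. t \<le> T \<Longrightarrow> (norm (x t))\<^sup>2 + (norm (p t))\<^sup>2 \<le> 240000 * \<kappa>^18 * D"
proof -
  define \<beta> where "\<beta> t = norm (transpose B *v p (Suc t))" for t
  define X where "X = (\<Sum>t<T. (norm (x t))\<^sup>2 + (\<beta> t)\<^sup>2)"
  define Y where "Y = (\<Sum>t<T. (norm (p (Suc t)))\<^sup>2)"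
  define F where "F = (\<Sum>t<T. (norm (a t))\<^sup>2 + (norm (b t))\<^sup>2)"
  define \<pi> where "\<pi> = p T - S *v x T"
  have k: "\<kappa> \<ge> 1" by (rule kappa)
  have k2: "\<kappa>\<^sup>2 \<ge> 1" using k by auto
  have nn: "X \<ge> 0" "Y \<ge> 0" "F \<ge> 0" by (auto simp: X_def Y_def F_def intro!: sum_nonneg)
  have D: "D = (norm (x 0))\<^sup>2 + (norm \<pi>)\<^sup>2 + F" by (simp add: D_def F_def \<pi>_def)
  have D0: "D \<ge> 0" and FD: "F \<le> D" and piD: "(norm \<pi>)\<^sup>2 \<le> D" and x0D: "(norm (x 0))\<^sup>2 \<le> D"
    using nn by (auto simp: D)
  have inX: "(norm (x t))\<^sup>2 + (\<beta> t)\<^sup>2 \<le> X" if "t < T" for t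
    unfolding X_def using that by (intro member_le_sum[of t "{..<T}" "\<lambda>t. (norm (x t))\<^sup>2 + (\<beta> t)\<^sup>2"]) auto
  have inY: "(norm (p (Suc t)))\<^sup>2 \<le> Y" if "t < T" for t
    unfolding Y_def using that by (intro member_le_sum[of t "{..<T}" "\<lambda>t. (norm (p (Suc t)))\<^sup>2"]) auto
  have inF: "(norm (a t))\<^sup>2 + (norm (b t))\<^sup>2 \<le> F" if "t < T" for t
    unfolding F_def using that
    by (intro member_le_sum[of t "{..<T}" "\<lambda>t. (norm (a t))\<^sup>2 + (norm (b t))\<^sup>2"]) auto
  \<comment> \<open>\<open>X\<close> stops at time \<open>T - 1\<close> and \<open>Y\<close> starts
    at time \<open>1\<close>, so \<open>x T\<close> and \<open>p 0\<close> occur in neither. One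
    step of the equations expresses them through terms that do occur; this is where
    \<open>T \<ge> 1\<close> enters.\<close>
  have xT: "(norm (x T))\<^sup>2 \<le> 3 * \<kappa>\<^sup>2 * (X + D)"
  proof -
    obtain s where s: "T = Suc s" "s < T" using T by (cases T) auto
    have "(norm (x T))\<^sup>2 \<le> 3 * ((norm (A *v x s))\<^sup>2 + (norm (G *v p T))\<^sup>2 + (norm (a s))\<^sup>2)"
      using x[OF s(2)] norm_add3_sq_le[of "A *v x s" "G *v p T" "a s"] s(1) by simp
    also have "\<dots> \<le> 3 * (\<kappa>\<^sup>2 * (norm (x s))\<^sup>2 + \<kappa>\<^sup>2 * (\<beta> s)\<^sup>2 + \<kappa>\<^sup>2 * (norm (a s))\<^sup>2)"
      using norm_sq_le_of_le[OF A_le[of "x s"]] norm_sq_le_of_le[OF G_le[of "p T"]]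
        mult_right_mono[OF k2, of "(norm (a s))\<^sup>2"]
      unfolding \<beta>_def s(1)[symmetric] by (intro mult_left_mono add_mono) auto
    also have "\<dots> = 3 * \<kappa>\<^sup>2 * ((norm (x s))\<^sup>2 + (\<beta> s)\<^sup>2 + (norm (a s))\<^sup>2)"
      by (simp add: algebra_simps)
    also have "\<dots> \<le> 3 * \<kappa>\<^sup>2 * (X + D)"
      using inX[OF s(2)] inF[OF s(2)] FD zero_le_power2[of "norm (b s)"] by (intro mult_left_mono) (linarith, simp)
    finally show ?thesis .
  qed
  have p0: "(norm (p 0))\<^sup>2 \<le> 3 * \<kappa>\<^sup>2 * (X + Y + D)"
  proof -
    have z: "0 < T" using T by simp
    have "(norm (p 0))\<^sup>2 \<le> 3 * ((norm (transpose A *v p (Suc 0)))\<^sup>2 + (norm (Q *v x 0))\<^sup>2 + (norm (b 0))\<^sup>2)"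
      using p[OF z] norm_add3_sq_le[of "transpose A *v p (Suc 0)" "- (Q *v x 0)" "b 0"] by simp
    also have "\<dots> \<le> 3 * (\<kappa>\<^sup>2 * (norm (p (Suc 0)))\<^sup>2 + \<kappa>\<^sup>2 * (norm (x 0))\<^sup>2 + \<kappa>\<^sup>2 * (norm (b 0))\<^sup>2)"
      using norm_sq_le_of_le[OF At_le] norm_sq_le_of_le[OF Q_le]
        mult_right_mono[OF k2, of "(norm (b 0))\<^sup>2"]
      by (intro mult_left_mono add_mono) auto
    also have "\<dots> = 3 * \<kappa>\<^sup>2 * ((norm (x 0))\<^sup>2 + (norm (p (Suc 0)))\<^sup>2 + (norm (b 0))\<^sup>2)"
      by (simp add: algebra_simps)
    also have "\<dots> \<le> 3 * \<kappa>\<^sup>2 * (X + Y + D)"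
      using inX[OF z] inY[OF z] inF[OF z] FD zero_le_power2[of "norm (a 0)"] zero_le_power2[of "\<beta> 0"]
      by (intro mult_left_mono) (linarith, simp)
    finally show ?thesis .
  qed
  have Y: "Y \<le> 28 * \<kappa>^6 * (X + D)"
  proof -
    have "Y / 2 = (\<Sum>t<T. (norm (p (Suc t)))\<^sup>2 / 2)" by (simp add: Y_def sum_divide_distrib)
    also have "\<dots> \<le> (\<Sum>t<T. (p (Suc t) \<bullet> (P *v p (Suc t)) - p t \<bullet> (P *v p t))
           + 6 * \<kappa>^6 * ((norm (x t))\<^sup>2 + (\<beta> t)\<^sup>2 + (norm (b t))\<^sup>2))"
      using lyapunov_step[OF p] by (intro sum_mono) (simp add: \<beta>_def)
    also have "\<dots> = (p T \<bullet> (P *v p T) - p 0 \<bullet> (P *v p 0)) + 6 * \<kappa>^6 * (X + (\<Sum>t<T. (norm (b t))\<^sup>2))"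
      by (simp add: sum.distrib sum_lessThan_telescope[of "\<lambda>t. p t \<bullet> (P *v p t)"] X_def
          sum_distrib_left[symmetric])
    also have "\<dots> \<le> p T \<bullet> (P *v p T) + 6 * \<kappa>^6 * (X + D)"
    proof -
      have "(\<Sum>t<T. (norm (b t))\<^sup>2) \<le> F" unfolding F_def by (intro sum_mono) auto
      then have "6 * \<kappa>^6 * (X + (\<Sum>t<T. (norm (b t))\<^sup>2)) \<le> 6 * \<kappa>^6 * (X + D)"
        using k FD by (intro mult_left_mono) auto
      then show ?thesis using P_nonneg[of "p 0"] by linarith
    qed
    \<comment> \<open>This boundary term has the unfavourable sign. The terminal row rewrites
      \<open>p T\<close> as \<open>\<pi> + S *v x T\<close>, so the bound involves \<open>X\<close>
      and \<open>D\<close> only; a multiple of \<open>Y\<close> here could not be absorbed.\<close>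
    also have "p T \<bullet> (P *v p T) \<le> 8 * \<kappa>^5 * (X + D)"
    proof -
      have "p T \<bullet> (P *v p T) \<le> norm (p T) * norm (P *v p T)" by (rule norm_cauchy_schwarz)
      also have "\<dots> \<le> norm (p T) * (\<kappa> * norm (p T))" by (intro mult_left_mono P_le) auto
      also have "\<dots> = \<kappa> * (norm (\<pi> + S *v x T))\<^sup>2" by (simp add: power2_eq_square \<pi>_def)
      also have "\<dots> \<le> \<kappa> * (2 * ((norm \<pi>)\<^sup>2 + (norm (S *v x T))\<^sup>2))"
        using k by (intro mult_left_mono norm_add_sq_le) auto
      also have "\<dots> \<le> \<kappa> * (2 * (D + \<kappa>\<^sup>2 * (3 * \<kappa>\<^sup>2 * (X + D))))"
      proof -
        have "(norm (S *v x T))\<^sup>2 \<le> \<kappa>\<^sup>2 * (norm (x T))\<^sup>2" by (rule norm_sq_le_of_le[OF S_le])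
        also have "\<dots> \<le> \<kappa>\<^sup>2 * (3 * \<kappa>\<^sup>2 * (X + D))" by (intro mult_left_mono xT) auto
        finally show ?thesis using k piD by (intro mult_left_mono add_mono) auto
      qed
      also have "\<dots> = 2 * \<kappa> * D + 6 * \<kappa>^5 * (X + D)" by (simp add: algebra_simps eval_nat_numeral)
      also have "\<dots> \<le> 8 * \<kappa>^5 * (X + D)"
      proof -
        have "\<kappa> ^ 1 \<le> \<kappa>^5" using k by (intro power_increasing) auto
        then have "\<kappa> * D \<le> \<kappa>^5 * (X + D)" using nn D0 k by (intro mult_mono) auto
        then show ?thesis by linarith
      qed
      finally show ?thesis .
    qed
    also have "8 * \<kappa>^5 * (X + D) \<le> 8 * \<kappa>^6 * (X + D)"
      using k nn D0 by (intro mult_right_mono mult_left_mono power_increasing) auto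
    finally show ?thesis by (simp add: mult_ac)
  qed
  have Xineq: "X \<le> \<kappa> * (\<theta> * (7 * \<kappa>\<^sup>2 * (X + Y + D)) + D / \<theta>)" if th: "\<theta> > 0" for \<theta>
  proof -
    have "X \<le> (\<Sum>t<T. \<kappa> * (x t \<bullet> (Q *v x t) + p (Suc t) \<bullet> (G *v p (Suc t))))"
      unfolding X_def \<beta>_def using Q_ge G_ge by (intro sum_mono) (simp add: distrib_left add_mono)
    also have "\<dots> = \<kappa> * (\<Sum>t<T. x t \<bullet> (Q *v x t) + p (Suc t) \<bullet> (G *v p (Suc t)))"
      by (simp add: sum_distrib_left)
    also have "(\<Sum>t<T. x t \<bullet> (Q *v x t) + p (Suc t) \<bullet> (G *v p (Suc t)))
       = (\<Sum>t<T. (x (Suc t) \<bullet> p (Suc t) - x t \<bullet> p t) - (p (Suc t) \<bullet> a t - x t \<bullet> b t))"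
      using costate_identity[OF x p] by (intro sum.cong) (auto simp: algebra_simps)
    also have "\<dots> = x T \<bullet> p T - x 0 \<bullet> p 0 - (\<Sum>t<T. p (Suc t) \<bullet> a t - x t \<bullet> b t)"
      by (subst sum_subtractf) (simp add: sum_lessThan_telescope[of "\<lambda>t. x t \<bullet> p t"])
    also have "\<dots> \<le> \<theta> * (7 * \<kappa>\<^sup>2 * (X + Y + D)) + D / \<theta>"
    proof -
      have "x T \<bullet> p T = x T \<bullet> (S *v x T) + x T \<bullet> \<pi>" by (simp add: \<pi>_def inner_diff_right)
      then have 1: "x T \<bullet> p T \<le> \<theta> * (norm (x T))\<^sup>2 + (norm \<pi>)\<^sup>2 / \<theta>"
        using S_nonpos[of "x T"] inner_le_young[OF th, of "x T" \<pi>] by linarith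
      have 2: "- (x 0 \<bullet> p 0) \<le> \<theta> * (norm (p 0))\<^sup>2 + (norm (x 0))\<^sup>2 / \<theta>"
        using inner_le_young[OF th, of "p 0" "x 0"] by (simp add: inner_commute)
      have "- (p (Suc t) \<bullet> a t - x t \<bullet> b t) \<le> \<theta> * ((norm (x t))\<^sup>2 + (norm (p (Suc t)))\<^sup>2)
              + ((norm (a t))\<^sup>2 + (norm (b t))\<^sup>2) / \<theta>" for t
        using inner_le_young[OF th, of "p (Suc t)" "a t"] inner_le_young[OF th, of "x t" "b t"]
        by (simp add: algebra_simps add_divide_distrib)
      then have "(\<Sum>t<T. - (p (Suc t) \<bullet> a t - x t \<bullet> b t)) \<le>
          (\<Sum>t<T. \<theta> * ((norm (x t))\<^sup>2 + (norm (p (Suc t)))\<^sup>2) + ((norm (a t))\<^sup>2 + (norm (b t))\<^sup>2) / \<theta>)"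
        by (intro sum_mono)
      also have "\<dots> = \<theta> * ((\<Sum>t<T. (norm (x t))\<^sup>2) + Y) + F / \<theta>"
        by (simp add: sum.distrib Y_def F_def sum_distrib_left[symmetric] sum_divide_distrib[symmetric])
      also have "\<dots> \<le> \<theta> * (X + Y) + F / \<theta>"
        using th by (intro add_mono mult_left_mono) (auto simp: X_def intro!: sum_mono)
      finally have 3: "- (\<Sum>t<T. p (Suc t) \<bullet> a t - x t \<bullet> b t) \<le> \<theta> * (X + Y) + F / \<theta>"
        by (simp only: sum_negf)
      have "x T \<bullet> p T - x 0 \<bullet> p 0 - (\<Sum>t<T. p (Suc t) \<bullet> a t - x t \<bullet> b t)
          \<le> \<theta> * ((norm (x T))\<^sup>2 + (norm (p 0))\<^sup>2 + (X + Y)) + D / \<theta>"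
        using 1 2 3 by (simp add: D algebra_simps add_divide_distrib)
      also have "\<dots> \<le> \<theta> * (7 * \<kappa>\<^sup>2 * (X + Y + D)) + D / \<theta>"
      proof -
        have "3 * \<kappa>\<^sup>2 * (X + D) \<le> 3 * \<kappa>\<^sup>2 * (X + Y + D)" using nn by (intro mult_left_mono) auto
        moreover have "1 * (X + Y) \<le> \<kappa>\<^sup>2 * (X + Y + D)" using nn D0 k2 by (intro mult_mono) auto
        ultimately have "(norm (x T))\<^sup>2 + (norm (p 0))\<^sup>2 + (X + Y) \<le> 7 * \<kappa>\<^sup>2 * (X + Y + D)"
          using xT p0 by (simp add: algebra_simps)
        then show ?thesis using th by (intro add_mono mult_left_mono) auto
      qed
      finally show ?thesis .
    qed
    finally show ?thesis using k by (simp add: mult_left_mono)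
  qed
  have XYD: "X + Y + D \<le> 24000 * \<kappa>^16 * D"
    by (rule absorb_energy[OF k nn(1,2) D0 Y Xineq])
  have "(\<Sum>t<T. (norm (x t))\<^sup>2 + (norm (p (Suc t)))\<^sup>2) \<le> X + Y"
    unfolding X_def Y_def sum.distrib by (simp add: sum_nonneg)
  then show "(\<Sum>t<T. (norm (x t))\<^sup>2 + (norm (p (Suc t)))\<^sup>2) \<le> 24000 * \<kappa>^16 * D"
    using XYD D0 by linarith
  fix t assume t: "t \<le> T"
  define Z where "Z = \<kappa>\<^sup>2 * (X + Y + D)"
  have "1 * (X + Y + D) \<le> Z" unfolding Z_def using nn D0 k2 by (intro mult_right_mono) auto
  then have mono: "X \<le> 3 * Z" "Y \<le> 3 * Z" "3 * Z = 3 * \<kappa>\<^sup>2 * (X + Y + D)"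
    using nn D0 by (simp_all add: Z_def)
  have xt: "(norm (x t))\<^sup>2 \<le> 3 * \<kappa>\<^sup>2 * (X + Y + D)"
  proof (cases "t = T")
    case True
    have "3 * \<kappa>\<^sup>2 * (X + D) \<le> 3 * \<kappa>\<^sup>2 * (X + Y + D)" using nn by (intro mult_left_mono) auto
    then show ?thesis using xT True by simp
  next
    case False
    then have "(norm (x t))\<^sup>2 \<le> X" using inX[of t] t zero_le_power2[of "\<beta> t"] by linarith
    then show ?thesis using mono by linarith
  qed
  have pt: "(norm (p t))\<^sup>2 \<le> 3 * \<kappa>\<^sup>2 * (X + Y + D)"
  proof (cases t)
    case (Suc s)
    then have "(norm (p t))\<^sup>2 \<le> Y" using inY[of s] t by simp
    then show ?thesis using mono by linarith
  qed (use p0 in simp)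
  have "(norm (x t))\<^sup>2 + (norm (p t))\<^sup>2 \<le> 10 * \<kappa>\<^sup>2 * (X + Y + D)"
    using xt pt mono nn D0 by (simp add: algebra_simps)
  also have "\<dots> \<le> 10 * \<kappa>\<^sup>2 * (24000 * \<kappa>^16 * D)" using XYD by (intro mult_left_mono) auto
  also have "\<dots> = 240000 * \<kappa>^18 * D" by (simp add: eval_nat_numeral)
  finally show "(norm (x t))\<^sup>2 + (norm (p t))\<^sup>2 \<le> 240000 * \<kappa>^18 * D" .
qed


section \<open>Exponential weights and pointwise decay\<close>

text \<open>The weighted trajectory solves the same system with additional sources, the commutators
  of the weight with the time step, whose relative size is \<open>\<delta>\<close>. The unweighted
  bound controls the sum of squares over all times, so these sources make up at most half of
  \<open>D\<close> and can be absorbed, \<open>D\<close> being a finite sum. The boundary rows are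
  just multiplied by \<open>w 0\<close> and \<open>w T\<close>.\<close>

theorem weighted_energy_estimate:
  fixes x p a b :: "nat \<Rightarrow> real^'d" and w :: "nat \<Rightarrow> real"
  assumes T: "T \<ge> 1"
    and x: "\<And>t. t < T \<Longrightarrow> x (Suc t) = A *v x t + G *v p (Suc t) + a t"
    and p: "\<And>t. t < T \<Longrightarrow> p t = transpose A *v p (Suc t) - Q *v x t + b t"
    and \<delta>: "0 < \<delta>" "\<delta> \<le> 1" "96000 * \<delta>\<^sup>2 * \<kappa>^18 \<le> 1"
    and w: "\<And>s. w s > 0" "\<And>s. \<bar>w (Suc s) - w s\<bar> \<le> \<delta> * w s" "\<And>s. \<bar>w (Suc s) - w s\<bar> \<le> \<delta> * w (Suc s)"
    and t: "t \<le> T"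
  shows "(w t)\<^sup>2 * ((norm (x t))\<^sup>2 + (norm (p t))\<^sup>2) \<le> 3840000 * \<kappa>^18 *
     ((w 0 * norm (x 0))\<^sup>2 + (w T * norm (p T - S *v x T))\<^sup>2
      + (\<Sum>s<T. (w s)\<^sup>2 * ((norm (a s))\<^sup>2 + (norm (b s))\<^sup>2)))"
proof -
  define y where "y s = w s *\<^sub>R x s" for s
  define q where "q s = w s *\<^sub>R p s" for s
  \<comment> \<open>The term with \<open>G\<close> produces no commutator, since
    \<open>p (Suc s)\<close> is weighted like \<open>x (Suc s)\<close>. In the costate equation the
    weight is that of time \<open>s\<close>, so there the commutator falls on
    \<open>transpose A\<close> and \<open>Q\<close> produces none.\<close>
  define a' where "a' s = (w (Suc s) - w s) *\<^sub>R (A *v x s) + w (Suc s) *\<^sub>R a s" for s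
  define b' where "b' s = (w s - w (Suc s)) *\<^sub>R (transpose A *v p (Suc s)) + w s *\<^sub>R b s" for s
  define \<Sigma> where "\<Sigma> = (\<Sum>s<T. (norm (y s))\<^sup>2 + (norm (q (Suc s)))\<^sup>2)"
  define D where "D = (norm (y 0))\<^sup>2 + (norm (q T - S *v y T))\<^sup>2 + (\<Sum>s<T. (norm (a' s))\<^sup>2 + (norm (b' s))\<^sup>2)"
  define E where "E = (w 0 * norm (x 0))\<^sup>2 + (w T * norm (p T - S *v x T))\<^sup>2
      + (\<Sum>s<T. (w s)\<^sup>2 * ((norm (a s))\<^sup>2 + (norm (b s))\<^sup>2))"
  have k: "\<kappa> \<ge> 1" by (rule kappa)
  have eqs: "y (Suc s) = A *v y s + G *v q (Suc s) + a' s" "q s = transpose A *v q (Suc s) - Q *v y s + b' s"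
    if "s < T" for s
  proof -
    show "y (Suc s) = A *v y s + G *v q (Suc s) + a' s"
      by (simp add: y_def q_def a'_def x[OF that] matrix_vector_mult_scaleR algebra_simps)
    have "q s = w s *\<^sub>R (transpose A *v p (Suc s) - Q *v x s + b s)"
      unfolding q_def p[OF that] ..
    then show "q s = transpose A *v q (Suc s) - Q *v y s + b' s"
      by (simp add: y_def q_def b'_def matrix_vector_mult_scaleR algebra_simps)
  qed
  have sum_le: "\<Sigma> \<le> 24000 * \<kappa>^16 * D" and pt_le: "(norm (y t))\<^sup>2 + (norm (q t))\<^sup>2 \<le> 240000 * \<kappa>^18 * D"
    using energy_estimate[OF T, of y q a' b'] eqs t unfolding \<Sigma>_def D_def by auto
  have E0: "E \<ge> 0" unfolding E_def by (intro add_nonneg_nonneg sum_nonneg) auto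
  have bound: "(norm (a' s))\<^sup>2 + (norm (b' s))\<^sup>2 \<le> 2 * \<delta>\<^sup>2 * \<kappa>\<^sup>2 * ((norm (y s))\<^sup>2 + (norm (q (Suc s)))\<^sup>2)
      + 8 * ((w s)\<^sup>2 * ((norm (a s))\<^sup>2 + (norm (b s))\<^sup>2))" for s
  proof -
    have w0: "w s \<ge> 0" "w (Suc s) \<ge> 0" using w(1) less_imp_le by blast+
    have "w (Suc s) \<le> w s + \<delta> * w s" using w(2)[of s] by linarith
    also have "\<dots> \<le> w s + 1 * w s" using \<delta>(2) w0 by (intro add_left_mono mult_right_mono) auto
    finally have "w (Suc s) \<le> 2 * w s" by simp
    then have w2: "(w (Suc s))\<^sup>2 \<le> 4 * (w s)\<^sup>2"
      using power_mono[OF _ w0(2), of "2 * w s" 2] by (simp add: power_mult_distrib)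
    have "norm ((w (Suc s) - w s) *\<^sub>R (A *v x s)) \<le> (\<delta> * w s) * (\<kappa> * norm (x s))"
      using w(2)[of s] A_le[of "x s"] \<delta> w0 by (auto intro!: mult_mono)
    also have "\<dots> = (\<delta> * \<kappa>) * norm (y s)" using w0 by (simp add: y_def)
    finally have 1: "(norm ((w (Suc s) - w s) *\<^sub>R (A *v x s)))\<^sup>2 \<le> (\<delta> * \<kappa>)\<^sup>2 * (norm (y s))\<^sup>2"
      by (rule norm_sq_le_of_le)
    have "norm ((w s - w (Suc s)) *\<^sub>R (transpose A *v p (Suc s))) \<le> (\<delta> * w (Suc s)) * (\<kappa> * norm (p (Suc s)))"
      using w(3)[of s] At_le[of "p (Suc s)"] \<delta> w0 by (auto intro!: mult_mono simp: abs_minus_commute)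
    also have "\<dots> = (\<delta> * \<kappa>) * norm (q (Suc s))" using w0 by (simp add: q_def)
    finally have 2: "(norm ((w s - w (Suc s)) *\<^sub>R (transpose A *v p (Suc s))))\<^sup>2 \<le> (\<delta> * \<kappa>)\<^sup>2 * (norm (q (Suc s)))\<^sup>2"
      by (rule norm_sq_le_of_le)
    have 3: "(norm (w (Suc s) *\<^sub>R a s))\<^sup>2 \<le> 4 * (w s)\<^sup>2 * (norm (a s))\<^sup>2"
      using mult_right_mono[OF w2, of "(norm (a s))\<^sup>2"] by (simp add: power_mult_distrib)
    have 4: "(norm (w s *\<^sub>R b s))\<^sup>2 \<le> 4 * (w s)\<^sup>2 * (norm (b s))\<^sup>2"
      by (simp add: power_mult_distrib mult_right_mono)
    have 5: "(norm (a' s))\<^sup>2 \<le> 2 * ((\<delta> * \<kappa>)\<^sup>2 * (norm (y s))\<^sup>2 + 4 * (w s)\<^sup>2 * (norm (a s))\<^sup>2)"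
      unfolding a'_def by (rule order_trans[OF norm_add_sq_le]) (intro mult_left_mono add_mono 1 3, simp)
    have 6: "(norm (b' s))\<^sup>2 \<le> 2 * ((\<delta> * \<kappa>)\<^sup>2 * (norm (q (Suc s)))\<^sup>2 + 4 * (w s)\<^sup>2 * (norm (b s))\<^sup>2)"
      unfolding b'_def by (rule order_trans[OF norm_add_sq_le]) (intro mult_left_mono add_mono 2 4, simp)
    show ?thesis using 5 6 by (simp add: algebra_simps power_mult_distrib)
  qed
  have "(norm (y 0))\<^sup>2 = (w 0 * norm (x 0))\<^sup>2" using w(1)[of 0] by (simp add: y_def)
  moreover have "(norm (q T - S *v y T))\<^sup>2 = (w T * norm (p T - S *v x T))\<^sup>2"
  proof -
    have "q T - S *v y T = w T *\<^sub>R (p T - S *v x T)"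
      by (simp add: q_def y_def matrix_vector_mult_scaleR scaleR_diff_right)
    then show ?thesis using w(1)[of T] by simp
  qed
  moreover have "(\<Sum>s<T. (norm (a' s))\<^sup>2 + (norm (b' s))\<^sup>2) \<le> 2 * \<delta>\<^sup>2 * \<kappa>\<^sup>2 * \<Sigma>
      + 8 * (\<Sum>s<T. (w s)\<^sup>2 * ((norm (a s))\<^sup>2 + (norm (b s))\<^sup>2))"
    unfolding \<Sigma>_def sum_distrib_left sum.distrib[symmetric] by (intro sum_mono bound)
  ultimately have "D \<le> 8 * E + 2 * \<delta>\<^sup>2 * \<kappa>\<^sup>2 * \<Sigma>"
    unfolding D_def E_def distrib_left by (smt (verit) zero_le_power2)
  also have "2 * \<delta>\<^sup>2 * \<kappa>\<^sup>2 * \<Sigma> \<le> 2 * \<delta>\<^sup>2 * \<kappa>\<^sup>2 * (24000 * \<kappa>^16 * D)"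
    by (intro mult_left_mono sum_le) auto
  \<comment> \<open>The factor \<open>2 * 24000\<close> is half of 96000, so the smallness condition
    on \<open>\<delta>\<close> leaves \<open>D / 2\<close>.\<close>
  also have "\<dots> = (96000 * \<delta>\<^sup>2 * \<kappa>^18) * (D / 2)" by (simp add: eval_nat_numeral)
  also have "\<dots> \<le> 1 * (D / 2)"
  proof (rule mult_right_mono[OF \<delta>(3)])
    show "0 \<le> D / 2" unfolding D_def by (intro divide_nonneg_pos add_nonneg_nonneg sum_nonneg) auto
  qed
  finally have "D \<le> 16 * E" by simp
  then have "240000 * \<kappa>^18 * D \<le> 240000 * \<kappa>^18 * (16 * E)" using k by (intro mult_left_mono) auto
  also have "\<dots> = 3840000 * \<kappa>^18 * E" by simp
  finally have "240000 * \<kappa>^18 * D \<le> 3840000 * \<kappa>^18 * E" .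
  moreover have "(norm (y t))\<^sup>2 + (norm (q t))\<^sup>2 = (w t)\<^sup>2 * ((norm (x t))\<^sup>2 + (norm (p t))\<^sup>2)"
    by (simp add: y_def q_def power_mult_distrib distrib_left)
  ultimately show ?thesis using pt_le unfolding E_def by linarith
qed

text \<open>The smallness parameter is \<open>exp \<gamma> - 1\<close>, which bounds the relative
  change of the weight in one step, measured against either neighbour. The weight is 1 at the
  observed time. The weighted sum of squares becomes the square of a weighted sum because the
  Euclidean norm is at most the sum norm, and 3840000 is rounded up to the square of 2000.\<close>

theorem green_estimate:
  fixes x p a b :: "nat \<Rightarrow> real^'d"
  assumes T: "T \<ge> 1"
    and x: "\<And>t. t < T \<Longrightarrow> x (Suc t) = A *v x t + G *v p (Suc t) + a t"
    and p: "\<And>t. t < T \<Longrightarrow> p t = transpose A *v p (Suc t) - Q *v x t + b t"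
    and \<gamma>: "0 < \<gamma>" "exp \<gamma> \<le> 2" "96000 * (exp \<gamma> - 1)\<^sup>2 * \<kappa>^18 \<le> 1"
    and t: "t \<le> T"
  shows "sqrt ((norm (x t))\<^sup>2 + (norm (p t))\<^sup>2) \<le> 2000 * \<kappa>^9 *
     (exp (- \<gamma> * real t) * norm (x 0) + exp (- \<gamma> * (real T - real t)) * norm (p T - S *v x T)
      + (\<Sum>s<T. exp (- \<gamma> * \<bar>real t - real s\<bar>) * (norm (a s) + norm (b s))))"
proof -
  define w where "w s = exp (- \<gamma> * \<bar>real t - real s\<bar>)" for s
  have k: "\<kappa> \<ge> 1" by (rule kappa)
  have w0: "w s > 0" for s by (simp add: w_def)
  have ratio: "w s' \<le> exp \<gamma> * w s" if "\<bar>real s - real s'\<bar> \<le> 1" for s s'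
  proof -
    have "\<bar>real t - real s\<bar> \<le> 1 + \<bar>real t - real s'\<bar>" using that by linarith
    then have "\<gamma> * \<bar>real t - real s\<bar> \<le> \<gamma> * (1 + \<bar>real t - real s'\<bar>)"
      using \<gamma>(1) by (intro mult_left_mono) auto
    then have "- \<gamma> * \<bar>real t - real s'\<bar> \<le> \<gamma> + - \<gamma> * \<bar>real t - real s\<bar>"
      by (simp add: distrib_left)
    then show ?thesis by (simp add: w_def flip: exp_add)
  qed
  have up: "w (Suc s) \<le> exp \<gamma> * w s" and down: "w s \<le> exp \<gamma> * w (Suc s)" for s
    by (rule ratio; simp)+
  have e1: "exp \<gamma> \<ge> 1" using \<gamma> by simp
  have dec: "w s - w (Suc s) \<le> (exp \<gamma> - 1) * w s" "w (Suc s) - w s \<le> (exp \<gamma> - 1) * w (Suc s)" for s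
  proof -
    have "w z - w z' \<le> (exp \<gamma> - 1) * w z" if "w z \<le> exp \<gamma> * w z'" for z z'
    proof (cases "w z' \<le> w z")
      case True
      have "w z - w z' \<le> (exp \<gamma> - 1) * w z'" using that by (simp add: algebra_simps)
      also have "\<dots> \<le> (exp \<gamma> - 1) * w z" using True e1 by (intro mult_left_mono) auto
      finally show ?thesis .
    next
      case False
      have "0 \<le> (exp \<gamma> - 1) * w z" using e1 w0[of z] by simp
      then show ?thesis using False by linarith
    qed
    then show "w s - w (Suc s) \<le> (exp \<gamma> - 1) * w s" "w (Suc s) - w s \<le> (exp \<gamma> - 1) * w (Suc s)"
      using up down by blast+
  qed
  have ww: "\<bar>w (Suc s) - w s\<bar> \<le> (exp \<gamma> - 1) * w s" "\<bar>w (Suc s) - w s\<bar> \<le> (exp \<gamma> - 1) * w (Suc s)" for s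
    using up[of s] down[of s] dec[of s] by (simp_all add: abs_le_iff left_diff_distrib)
  define z where "z s = w s * (norm (a s) + norm (b s))" for s
  have z0: "z s \<ge> 0" for s using w0[of s] by (simp add: z_def)
  define \<alpha> where "\<alpha> = w 0 * norm (x 0)"
  define \<beta> where "\<beta> = w T * norm (p T - S *v x T)"
  have ab0: "\<alpha> \<ge> 0" "\<beta> \<ge> 0" using w0[of 0] w0[of T] by (simp_all add: \<alpha>_def \<beta>_def)
  have "(norm (x t))\<^sup>2 + (norm (p t))\<^sup>2 \<le> 3840000 * \<kappa>^18 *
     (\<alpha>\<^sup>2 + \<beta>\<^sup>2 + (\<Sum>s<T. (w s)\<^sup>2 * ((norm (a s))\<^sup>2 + (norm (b s))\<^sup>2)))"
    using weighted_energy_estimate[where x=x and p=p and a=a and b=b and w=w, OF T x p _ _ \<gamma>(3) w0 ww t] \<gamma>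
    by (simp add: w_def \<alpha>_def \<beta>_def)
  also have "\<dots> \<le> (2000 * \<kappa>^9)\<^sup>2 * (\<alpha> + \<beta> + (\<Sum>s<T. z s))\<^sup>2"
  proof (rule mult_mono)
    show "3840000 * \<kappa>^18 \<le> (2000 * \<kappa>^9)\<^sup>2" using k by (simp add: power_mult_distrib flip: power_mult)
    have "(w s)\<^sup>2 * ((norm (a s))\<^sup>2 + (norm (b s))\<^sup>2) \<le> (z s)\<^sup>2" for s
      unfolding z_def power_mult_distrib by (intro mult_left_mono) (auto simp: power2_sum)
    then have "(\<Sum>s<T. (w s)\<^sup>2 * ((norm (a s))\<^sup>2 + (norm (b s))\<^sup>2)) \<le> (\<Sum>s<T. (z s)\<^sup>2)"
      by (intro sum_mono)
    also have "\<dots> = (L2_set z {..<T})\<^sup>2" by (simp add: L2_set_def sum_nonneg)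
    also have "\<dots> \<le> (\<Sum>s<T. z s)\<^sup>2" by (intro power_mono L2_set_le_sum L2_set_nonneg z0)
    finally have "\<alpha>\<^sup>2 + \<beta>\<^sup>2 + (\<Sum>s<T. (w s)\<^sup>2 * ((norm (a s))\<^sup>2 + (norm (b s))\<^sup>2)) \<le> \<alpha>\<^sup>2 + \<beta>\<^sup>2 + (\<Sum>s<T. z s)\<^sup>2"
      by simp
    also have "\<dots> \<le> (\<alpha> + \<beta> + (\<Sum>s<T. z s))\<^sup>2"
      using ab0 sum_nonneg[of "{..<T}" z] z0 by (simp add: power2_sum)
    finally show "\<alpha>\<^sup>2 + \<beta>\<^sup>2 + (\<Sum>s<T. (w s)\<^sup>2 * ((norm (a s))\<^sup>2 + (norm (b s))\<^sup>2)) \<le> (\<alpha> + \<beta> + (\<Sum>s<T. z s))\<^sup>2" .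
  qed (use k in \<open>auto intro!: add_nonneg_nonneg sum_nonneg\<close>)
  also have "\<dots> = (2000 * \<kappa>^9 * (\<alpha> + \<beta> + (\<Sum>s<T. z s)))\<^sup>2" by (simp add: power_mult_distrib)
  finally have "sqrt ((norm (x t))\<^sup>2 + (norm (p t))\<^sup>2) \<le> 2000 * \<kappa>^9 * (\<alpha> + \<beta> + (\<Sum>s<T. z s))"
    using k ab0 z0 by (intro real_le_lsqrt) (auto intro!: mult_nonneg_nonneg add_nonneg_nonneg sum_nonneg)
  then show ?thesis using t by (simp add: \<alpha>_def \<beta>_def z_def w_def)
qed

end

section \<open>Generalized eigenspaces\<close>

definition poly_apply :: "complex^'n^'n \<Rightarrow> complex poly \<Rightarrow> complex^'n \<Rightarrow> complex^'n" where
  "poly_apply M p v = (\<Sum>i\<le>degree p. coeff p i *s (((*v) M ^^ i) v))"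

lemma poly_apply_upto:
  assumes "degree p \<le> N"
  shows "poly_apply M p v = (\<Sum>i\<le>N. coeff p i *s (((*v) M ^^ i) v))"
  unfolding poly_apply_def using assms
  by (intro sum.mono_neutral_left) (auto simp: coeff_eq_0)

lemma funpow_matrix_linear:
  fixes M :: "'a::field^'n^'n"
  shows "((*v) M ^^ i) (u + v) = ((*v) M ^^ i) u + ((*v) M ^^ i) v"
    and "((*v) M ^^ i) (u - v) = ((*v) M ^^ i) u - ((*v) M ^^ i) v"
    and "((*v) M ^^ i) (c *s v) = c *s ((*v) M ^^ i) v"
    and "((*v) M ^^ i) 0 = 0"
  by (induction i)
    (simp_all add: matrix_vector_right_distrib matrix_vector_mult_diff_distrib vector_scalar_commute)

text \<open>As q(M) commutes with M - \<mu>, the linear factor may act on the vector first. Removing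
  a root from the polynomial thus amounts to replacing \<open>v\<close> by its image under M -
  \<mu>.\<close>

lemma poly_apply_linear_factor:
  "poly_apply M ([:-\<mu>, 1:] * q) v = poly_apply M q (M *v v - \<mu> *s v)"
proof -
  define N where "N = degree q"
  have coeff: "coeff ([:-\<mu>, 1:] * q) i = coeff (pCons 0 q) i - \<mu> * coeff q i" for i by simp
  have "degree ([:-\<mu>, 1:] * q) \<le> Suc N"
    using degree_mult_le[of "[:-\<mu>, 1:]" q] unfolding N_def by simp
  then have "poly_apply M ([:-\<mu>, 1:] * q) v =
      (\<Sum>i\<le>Suc N. coeff ([:-\<mu>, 1:] * q) i *s (((*v) M ^^ i) v))"
    by (rule poly_apply_upto)
  also have "\<dots> = (\<Sum>i\<le>Suc N. coeff (pCons 0 q) i *s (((*v) M ^^ i) v))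
        - (\<Sum>i\<le>Suc N. (\<mu> * coeff q i) *s (((*v) M ^^ i) v))"
    unfolding coeff vector_sub_rdistrib sum_subtractf ..
  also have "(\<Sum>i\<le>Suc N. coeff (pCons 0 q) i *s (((*v) M ^^ i) v)) = (\<Sum>i\<le>N. coeff q i *s (((*v) M ^^ Suc i) v))"
    by (subst sum.atMost_Suc_shift) simp
  also have "(\<Sum>i\<le>Suc N. (\<mu> * coeff q i) *s (((*v) M ^^ i) v)) = (\<Sum>i\<le>N. (\<mu> * coeff q i) *s (((*v) M ^^ i) v))"
    by (simp add: N_def coeff_eq_0)
  also have "(\<Sum>i\<le>N. coeff q i *s (((*v) M ^^ Suc i) v)) - \<dots>
      = (\<Sum>i\<le>N. coeff q i *s (((*v) M ^^ i) (M *v v - \<mu> *s v)))"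
    unfolding sum_subtractf[symmetric] funpow_matrix_linear funpow_Suc_right
    by (intro sum.cong) (simp_all add: vec_eq_iff algebra_simps)
  finally show ?thesis by (simp add: poly_apply_def N_def)
qed

text \<open>The first \<open>CARD('n) + 1\<close> iterates of \<open>v\<close> cannot be
  independent. Dependence is a property of sets, which forget repetitions, so two coinciding
  iterates are treated separately, with a difference of two monomials.\<close>

lemma exists_annihilating_poly:
  fixes M :: "complex^'n^'n"
  shows "\<exists>p. p \<noteq> 0 \<and> poly_apply M p v = 0"
proof (cases "inj_on (\<lambda>i. ((*v) M ^^ i) v) {..CARD('n)}")
  case False
  then obtain i j where ij: "i < j" "((*v) M ^^ i) v = ((*v) M ^^ j) v"
    unfolding inj_on_def by (metis linorder_neqE_nat)
  define p :: "complex poly" where "p = monom 1 j - monom 1 i"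
  have "coeff p j = 1" using ij by (simp add: p_def)
  then have p0: "p \<noteq> 0" by auto
  have "degree p \<le> j" unfolding p_def using ij by (intro degree_diff_le) (auto simp: degree_monom_eq)
  then have "poly_apply M p v = (\<Sum>k\<le>j. coeff p k *s (((*v) M ^^ k) v))" by (rule poly_apply_upto)
  also have "\<dots> = (\<Sum>k\<le>j. if k = j then ((*v) M ^^ j) v else 0) - (\<Sum>k\<le>j. if k = i then ((*v) M ^^ i) v else 0)"
    unfolding sum_subtractf[symmetric] using ij(1) by (intro sum.cong) (auto simp: p_def)
  also have "\<dots> = 0" using ij by simp
  finally show ?thesis using p0 by blast
next
  case True
  define S where "S = (\<lambda>i. ((*v) M ^^ i) v) ` {..CARD('n)}"
  have "card S = Suc CARD('n)" by (simp add: S_def card_image[OF True])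
  moreover have "vec.dim S \<le> CARD('n)" by (rule dim_subset_UNIV_cart_gen)
  ultimately have "vec.dependent S"
    by (intro vec.dependent_biggerset_general) auto
  moreover have fin: "finite S" by (simp add: S_def)
  ultimately obtain u w where u: "w \<in> S" "u w \<noteq> 0" "(\<Sum>x\<in>S. u x *s x) = 0"
    by (auto simp: vec.dependent_finite)
  define p where "p = (\<Sum>i\<le>CARD('n). monom (u (((*v) M ^^ i) v)) i)"
  have c: "coeff p k = (if k \<le> CARD('n) then u (((*v) M ^^ k) v) else 0)" for k
    by (auto simp: p_def coeff_sum)
  obtain i where "i \<le> CARD('n)" "w = ((*v) M ^^ i) v" using u(1) by (auto simp: S_def)
  then have "p \<noteq> 0" using c[of i] u(2) by auto
  moreover have "poly_apply M p v = (\<Sum>i\<le>CARD('n). coeff p i *s (((*v) M ^^ i) v))"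
    by (rule poly_apply_upto) (auto intro!: degree_le simp: c)
  moreover have "\<dots> = (\<Sum>x\<in>S. u x *s x)"
    unfolding S_def by (subst sum.reindex[OF True]) (auto simp: c)
  ultimately show ?thesis using u(3) by auto
qed

text \<open>Peeling linear factors off an annihilating polynomial replaces the Jordan normal form.\<close>

lemma annihilator_induct:
  fixes M :: "complex^'n^'n"
  assumes zero: "P 0" and step: "\<And>\<mu> v. P (M *v v - \<mu> *s v) \<Longrightarrow> P v"
  shows "P v"
proof -
  have "P v" if "p \<noteq> 0" "poly_apply M p v = 0" for p v
    using that
  proof (induction "degree p" arbitrary: p v)
    case 0
    then have "v = 0" by (auto simp: poly_apply_def vec_eq_iff elim: degree_eq_zeroE)
    then show ?case using zero by simp
  next
    case (Suc n)
    then obtain \<mu> where "poly p \<mu> = 0"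
      using fundamental_theorem_of_algebra[of p] constant_degree[of p] by auto
    then obtain q where q: "p = [:-\<mu>, 1:] * q" by (auto simp: poly_eq_0_iff_dvd)
    then have "q \<noteq> 0" using Suc.prems(1) by auto
    moreover from this have "degree q = n" using Suc.hyps(2)
      by (simp add: q degree_mult_eq del: mult_pCons_left)
    moreover have "poly_apply M q (M *v v - \<mu> *s v) = 0"
      using Suc.prems(2) unfolding q poly_apply_linear_factor .
    ultimately show ?case using Suc.hyps(1) step by blast
  qed
  then show ?thesis using exists_annihilating_poly by blast
qed

text \<open>Peeling off linear factors one by one ends in 0; the last nonzero vector before that is
  an eigenvector, and invariance keeps all of them in \<open>U\<close>.\<close>

lemma invariant_subspace_eigenvector:
  fixes M :: "complex^'n^'n"
  assumes U: "vec.subspace U" and inv: "\<And>v. v \<in> U \<Longrightarrow> M *v v \<in> U" and v: "v \<in> U" "v \<noteq> 0"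
  shows "\<exists>\<mu> w. w \<in> U \<and> w \<noteq> 0 \<and> M *v w = \<mu> *s w"
proof -
  have "v \<in> U \<and> v \<noteq> 0 \<longrightarrow> (\<exists>\<mu> w. w \<in> U \<and> w \<noteq> 0 \<and> M *v w = \<mu> *s w)"
  proof (induction v rule: annihilator_induct[of _ M])
    case (2 \<mu> v)
    then show ?case
      by (cases "M *v v - \<mu> *s v = 0") (auto intro!: vec.subspace_diff[OF U] vec.subspace_scale[OF U] inv)
  qed simp
  then show ?thesis using v by blast
qed

abbreviation shifted :: "complex^'n^'n \<Rightarrow> complex \<Rightarrow> complex^'n \<Rightarrow> complex^'n" where
  "shifted M \<mu> v \<equiv> (M - mat \<mu>) *v v"

lemma mat_mult_vec: "mat c *v v = c *s (v :: 'a::comm_semiring_1^'n)"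
  by (simp add: vec_eq_iff matrix_vector_mult_def mat_def if_distrib[of "\<lambda>x. x * _"] cong: if_cong)

lemma shifted_eq: "shifted M \<mu> v = M *v v - \<mu> *s v"
  by (simp add: matrix_vector_mult_diff_rdistrib mat_mult_vec)

lemma gen_eigenspace_shifted:
  "shifted M \<mu> v \<in> gen_eigenspace M \<mu> \<Longrightarrow> v \<in> gen_eigenspace M \<mu>"
proof -
  assume "shifted M \<mu> v \<in> gen_eigenspace M \<mu>"
  then obtain k where "((\<lambda>w. (M - mat \<mu>) *v w) ^^ Suc k) v = 0"
    by (auto simp: gen_eigenspace_def funpow_swap1)
  then show ?thesis unfolding gen_eigenspace_def by blast
qed

text \<open>Induction along the chain of images of \<open>v\<close> under M - \<mu>, which ends in
  0. Later proofs treat one link of the chain at a time and never see the exponent.\<close>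

lemma gen_eigenspace_induct [consumes 1, case_names zero step]:
  assumes "v \<in> gen_eigenspace M \<mu>" and zero: "P 0"
    and step: "\<And>v. v \<in> gen_eigenspace M \<mu> \<Longrightarrow> P (shifted M \<mu> v) \<Longrightarrow> P v"
  shows "P v"
proof -
  have "((\<lambda>w. (M - mat \<mu>) *v w) ^^ k) v = 0 \<Longrightarrow> P v" for k v
  proof (induction k arbitrary: v)
    case (Suc k)
    have "v \<in> gen_eigenspace M \<mu>" unfolding gen_eigenspace_def using Suc.prems by blast
    then show ?case using Suc.IH[of "shifted M \<mu> v"] Suc.prems step by (simp add: funpow_swap1)
  qed (use zero in simp)
  then show ?thesis using assms(1) by (auto simp: gen_eigenspace_def)
qed

lemma funpow_shifted_zero_mono:
  fixes N :: "complex^'n^'n"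
  assumes "((*v) N ^^ k) v = 0" "k \<le> m"
  shows "((*v) N ^^ m) v = 0"
  using assms funpow_add[of "m - k" k "(*v) N"] by (simp add: funpow_matrix_linear)

lemma subspace_gen_eigenspace: "vec.subspace (gen_eigenspace M \<mu>)"
  unfolding vec.subspace_def
proof (intro conjI allI ballI)
  show "0 \<in> gen_eigenspace M \<mu>" unfolding gen_eigenspace_def by (auto intro!: exI[of _ 0])
  fix u assume "u \<in> gen_eigenspace M \<mu>"
  then obtain k where k: "((*v) (M - mat \<mu>) ^^ k) u = 0" by (auto simp: gen_eigenspace_def)
  show "c *s u \<in> gen_eigenspace M \<mu>" for c
    unfolding gen_eigenspace_def using k funpow_matrix_linear(3)[of k "M - mat \<mu>" c u] by auto
  fix v assume "v \<in> gen_eigenspace M \<mu>"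
  then obtain l where l: "((*v) (M - mat \<mu>) ^^ l) v = 0" by (auto simp: gen_eigenspace_def)
  have "((*v) (M - mat \<mu>) ^^ (k + l)) (u + v) = 0"
    unfolding funpow_matrix_linear
    using funpow_shifted_zero_mono[OF k, of "k + l"] funpow_shifted_zero_mono[OF l, of "k + l"] by simp
  then show "u + v \<in> gen_eigenspace M \<mu>" unfolding gen_eigenspace_def by blast
qed

lemma gen_eigenspace_nontrivial:
  assumes "v \<in> gen_eigenspace M \<mu>" "v \<noteq> 0"
  shows "eigenvalue M \<mu>"
  using assms
proof (induction rule: gen_eigenspace_induct)
  case (step v)
  then show ?case by (cases "shifted M \<mu> v = 0") (auto simp: eigenvalue_def shifted_eq)
qed simp

text \<open>On this space M - \<mu> is the nonzero scalar \<nu> - \<mu> plus a nilpotent map, hence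
  onto. The chain induction replaces the Neumann series: if \<open>v\<close> solves the equation for
  the image of \<open>w\<close> under M - \<nu>, then (w - v) / (\<nu> - \<mu>) solves it for
  \<open>w\<close>.\<close>

lemma shifted_solvable_gen_eigenspace:
  assumes "\<nu> \<noteq> \<mu>" "w \<in> gen_eigenspace M \<nu>"
  shows "\<exists>v \<in> gen_eigenspace M \<nu>. M *v v - \<mu> *s v = w"
  using assms(2)
proof (induction rule: gen_eigenspace_induct)
  case zero
  show ?case using vec.subspace_0[OF subspace_gen_eigenspace] by force
next
  case (step w)
  then obtain v where v: "v \<in> gen_eigenspace M \<nu>" "M *v v - \<mu> *s v = M *v w - \<nu> *s w"
    by (auto simp: shifted_eq)
  define c where "c = 1 / (\<nu> - \<mu>)"
  have cc: "c * \<nu> = 1 + c * \<mu>" using assms(1) by (simp add: c_def field_simps)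
  have "c *s (w - v) \<in> gen_eigenspace M \<nu>"
    using step v by (intro vec.subspace_scale vec.subspace_diff subspace_gen_eigenspace)
  moreover have "M *v (c *s (w - v)) - \<mu> *s (c *s (w - v)) = c *s ((M *v w - \<mu> *s w) - (M *v v - \<mu> *s v))"
    by (simp add: vector_scalar_commute matrix_vector_mult_diff_distrib vec_eq_iff algebra_simps)
  moreover have "\<dots> = w"
    unfolding v(2) using cc by (simp add: vec_eq_iff)
  ultimately show ?case by metis
qed

theorem span_gen_eigenspaces:
  fixes M :: "complex^'n^'n"
  shows "vec.span (\<Union>\<mu>. gen_eigenspace M \<mu>) = UNIV"
proof -
  let ?U = "\<Union>\<mu>. gen_eigenspace M \<mu>"
  have "v \<in> vec.span ?U" for v
  proof (induction v rule: annihilator_induct[of _ M])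
    case (2 \<mu> v)
    \<comment> \<open>Within the span, the equation for M - \<mu> is solvable up to an error in the
      generalized eigenspace of \<mu>, since components for any other \<nu> are solved exactly.
      Applied to the image of \<open>v\<close> under M - \<mu>, this places \<open>v - v'\<close> in
      that generalized eigenspace.\<close>
    have "\<exists>v' \<in> vec.span ?U. w - (M *v v' - \<mu> *s v') \<in> gen_eigenspace M \<mu>" if "w \<in> vec.span ?U" for w
      using that
    proof (induction rule: vec.span_induct_alt)
      case base
      then show ?case using vec.subspace_0[OF subspace_gen_eigenspace[of M \<mu>]]
        by (intro bexI[of _ 0] vec.span_zero) simp
    next
      case (step c x y)
      then obtain v' \<nu> where v': "v' \<in> vec.span ?U" "y - (M *v v' - \<mu> *s v') \<in> gen_eigenspace M \<mu>"
        and x: "x \<in> gen_eigenspace M \<nu>" by auto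
      show ?case
      proof (cases "\<nu> = \<mu>")
        case True
        then have "c *s x + (y - (M *v v' - \<mu> *s v')) \<in> gen_eigenspace M \<mu>"
          using x v' by (intro vec.subspace_add vec.subspace_scale subspace_gen_eigenspace) auto
        then show ?thesis using v' by (auto simp: add_diff_eq)
      next
        case False
        then obtain u where u: "u \<in> gen_eigenspace M \<nu>" "M *v u - \<mu> *s u = x"
          using shifted_solvable_gen_eigenspace x by blast
        have "c *s u + v' \<in> vec.span ?U"
          using u v' by (intro vec.span_add vec.span_scale) (auto intro: vec.span_base)
        moreover have "c *s x + y - (M *v (c *s u + v') - \<mu> *s (c *s u + v')) = y - (M *v v' - \<mu> *s v')"
          unfolding u(2)[symmetric]
          by (simp add: vector_scalar_commute matrix_vector_right_distrib vec_eq_iff algebra_simps)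
        ultimately show ?thesis using v' by metis
      qed
    qed
    from this[OF 2] obtain v' where v': "v' \<in> vec.span ?U" "(M *v v - \<mu> *s v) - (M *v v' - \<mu> *s v') \<in> gen_eigenspace M \<mu>"
      by auto
    moreover have "shifted M \<mu> (v - v') = (M *v v - \<mu> *s v) - (M *v v' - \<mu> *s v')"
      unfolding shifted_eq by (simp add: matrix_vector_mult_diff_distrib vec_eq_iff algebra_simps)
    ultimately have "shifted M \<mu> (v - v') \<in> gen_eigenspace M \<mu>" by simp
    then have "v - v' \<in> gen_eigenspace M \<mu>" by (rule gen_eigenspace_shifted)
    then have "v - v' \<in> vec.span ?U" by (auto intro: vec.span_base)
    from vec.span_add[OF this v'(1)] show ?case by simp
  qed (simp add: vec.span_zero)
  then show ?thesis by auto
qed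

section \<open>Stable and unstable subspaces\<close>

lemma norm_vector_smult: "norm (c *s (v :: complex^'n)) = norm c * norm v"
  unfolding norm_vec_def by (simp add: norm_mult L2_set_right_distrib)

text \<open>Summing the recursion bounds \<open>1 - r\<close> times every partial sum. Summability
  is used in place of a decay rate because it passes along a chain of generalized eigenvectors
  unchanged, whereas a rate would pick up polynomial factors.\<close>

lemma summable_of_contraction:
  fixes y :: "nat \<Rightarrow> 'a::real_normed_vector"
  assumes step: "\<And>k. norm (y (Suc k)) \<le> r * norm (y k) + e k" and r: "0 \<le> r" "r < 1"
    and e: "summable e" "\<And>k. 0 \<le> e k"
  shows "summable (\<lambda>k. norm (y k))"
proof (rule summableI_nonneg_bounded)
  fix n
  have "(\<Sum>k<n. norm (y k)) \<le> (\<Sum>k<Suc n. norm (y k))" by simp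
  also have "\<dots> = norm (y 0) + (\<Sum>k<n. norm (y (Suc k)))" by (rule sum.lessThan_Suc_shift)
  also have "\<dots> \<le> norm (y 0) + (\<Sum>k<n. r * norm (y k) + e k)" by (intro add_left_mono sum_mono step)
  also have "\<dots> = norm (y 0) + r * (\<Sum>k<n. norm (y k)) + (\<Sum>k<n. e k)"
    by (simp add: sum.distrib sum_distrib_left)
  also have "(\<Sum>k<n. e k) \<le> suminf e" by (rule sum_le_suminf) (use e in auto)
  finally have "(1 - r) * (\<Sum>k<n. norm (y k)) \<le> norm (y 0) + suminf e" by (simp add: algebra_simps)
  then show "(\<Sum>k<n. norm (y k)) \<le> (norm (y 0) + suminf e) / (1 - r)"
    using r by (simp add: field_simps)
qed simp

lemma subspace_summable_orbits:
  fixes M :: "complex^'n^'n"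
  shows "vec.subspace {v. summable (\<lambda>k. norm (((*v) M ^^ k) v))}"
proof (rule vec.subspaceI)
  show "0 \<in> {v. summable (\<lambda>k. norm (((*v) M ^^ k) v))}" by (simp add: funpow_matrix_linear)
  fix u assume u: "u \<in> {v. summable (\<lambda>k. norm (((*v) M ^^ k) v))}"
  then show "c *s u \<in> {v. summable (\<lambda>k. norm (((*v) M ^^ k) v))}" for c
    by (simp add: funpow_matrix_linear norm_vector_smult summable_mult)
  fix v assume "v \<in> {v. summable (\<lambda>k. norm (((*v) M ^^ k) v))}"
  with u have "summable (\<lambda>k. norm (((*v) M ^^ k) u) + norm (((*v) M ^^ k) v))"
    by (intro summable_add) auto
  then have "summable (\<lambda>k. norm (((*v) M ^^ k) (u + v)))"
    by (rule summable_comparison_test') (simp add: funpow_matrix_linear norm_triangle_ineq)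
  then show "u + v \<in> {v. summable (\<lambda>k. norm (((*v) M ^^ k) v))}" by simp
qed

text \<open>The orbit of \<open>v\<close> contracts by the factor \<open>cmod \<mu>\<close> up to an
  error, which is the orbit of the next vector of the chain and hence summable by induction.\<close>

lemma gen_eigenspace_summable_forward:
  assumes "v \<in> gen_eigenspace M \<mu>" "cmod \<mu> < 1"
  shows "summable (\<lambda>k. norm (((*v) M ^^ k) v))"
  using assms(1)
proof (induction rule: gen_eigenspace_induct)
  case (step v)
  show ?case
  proof (rule summable_of_contraction[OF _ _ assms(2) step(2)])
    fix k
    have "M *v v = \<mu> *s v + shifted M \<mu> v" by (simp add: shifted_eq)
    then have "((*v) M ^^ Suc k) v = \<mu> *s ((*v) M ^^ k) v + ((*v) M ^^ k) (shifted M \<mu> v)"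
      unfolding funpow_Suc_right o_def by (simp only: funpow_matrix_linear)
    then show "norm (((*v) M ^^ Suc k) v) \<le> cmod \<mu> * norm (((*v) M ^^ k) v) + norm (((*v) M ^^ k) (shifted M \<mu> v))"
      by (metis norm_triangle_ineq norm_vector_smult)
  qed auto
qed (simp add: funpow_matrix_linear)

text \<open>The inverse contracts by the factor \<open>1 / cmod \<mu>\<close>. Here the error is the
  orbit of the next chain vector one step ahead, whence the \<open>Suc\<close> in the summable
  series.\<close>

lemma gen_eigenspace_summable_backward:
  assumes "v \<in> gen_eigenspace M \<mu>" "cmod \<mu> > 1" and inv: "N ** M = mat 1"
  shows "summable (\<lambda>k. norm (((*v) N ^^ k) v))"
  using assms(1)
proof (induction rule: gen_eigenspace_induct)
  case (step v)
  let ?u = "shifted M \<mu> v"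
  have m0: "\<mu> \<noteq> 0" using assms(2) by auto
  have sm: "summable (\<lambda>k. (1 / cmod \<mu>) * norm (((*v) N ^^ Suc k) ?u))"
    using step(2) summable_Suc_iff[of "\<lambda>k. norm (((*v) N ^^ k) ?u)"] by (intro summable_mult) simp
  show ?case
  proof (rule summable_of_contraction[OF _ _ _ sm])
    fix k
    have "N *v ?u = v - \<mu> *s (N *v v)"
      by (simp add: shifted_eq matrix_vector_mult_diff_distrib matrix_vector_mul_assoc inv
          vector_scalar_commute)
    then have "\<mu> *s (N *v v) = v - N *v ?u" by simp
    then have "N *v v = (1 / \<mu>) *s (v - N *v ?u)" using m0 by (metis vector_smult_assoc vector_smult_lid
          nonzero_eq_divide_eq times_divide_eq_left mult.left_neutral divide_self)
    then have "((*v) N ^^ Suc k) v = (1 / \<mu>) *s (((*v) N ^^ k) v - ((*v) N ^^ Suc k) ?u)"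
      unfolding funpow_Suc_right o_def by (simp only: funpow_matrix_linear)
    then have "norm (((*v) N ^^ Suc k) v) = (1 / cmod \<mu>) * norm (((*v) N ^^ k) v - ((*v) N ^^ Suc k) ?u)"
      by (simp only: norm_vector_smult norm_divide norm_one)
    also have "\<dots> \<le> (1 / cmod \<mu>) * (norm (((*v) N ^^ k) v) + norm (((*v) N ^^ Suc k) ?u))"
      by (intro mult_left_mono norm_triangle_ineq4) simp
    finally show "norm (((*v) N ^^ Suc k) v) \<le>
        (1 / cmod \<mu>) * norm (((*v) N ^^ k) v) + (1 / cmod \<mu>) * norm (((*v) N ^^ Suc k) ?u)"
      by (simp only: distrib_left)
  qed (use assms(2) in \<open>auto simp: divide_simps\<close>)
qed (simp add: funpow_matrix_linear)

lemma norm_cvector: "norm (cvector v) = norm v"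
  by (simp add: norm_vec_def cvector_def)

lemma cmatrix_mult_cvector: "cmatrix M *v cvector v = cvector (M *v v)"
  by (simp add: vec_eq_iff cvector_def matrix_vector_mult_def)

lemma funpow_cmatrix_cvector:
  fixes M :: "real^'n^'n"
  shows "((*v) (cmatrix M) ^^ k) (cvector v) = cvector (((*v) M ^^ k) v)"
proof (induction k)
  case (Suc k)
  show ?case unfolding funpow.simps o_def Suc cmatrix_mult_cvector ..
qed simp

lemma cmatrix_mult: "cmatrix (M ** N) = cmatrix M ** cmatrix N"
  by (simp add: vec_eq_iff matrix_matrix_mult_def)

lemma cmatrix_mat_1: "cmatrix (mat 1) = mat 1"
  by (simp add: vec_eq_iff mat_def)

lemma stable_subspace_tendsto_0:
  assumes "v \<in> stable_subspace M"
  shows "(\<lambda>k. ((*v) M ^^ k) v) \<longlonglongrightarrow> 0"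
proof -
  have "vec.span (\<Union>\<mu>\<in>{\<mu> \<in> {\<mu>. cmod \<mu> < 1}. eigenvalue (cmatrix M) \<mu>}. gen_eigenspace (cmatrix M) \<mu>)
      \<subseteq> {v. summable (\<lambda>k. norm (((*v) (cmatrix M) ^^ k) v))}"
    by (intro vec.span_minimal subspace_summable_orbits) (auto intro: gen_eigenspace_summable_forward)
  then have "summable (\<lambda>k. norm (((*v) M ^^ k) v))"
    using assms by (auto simp: stable_subspace_def spectral_subspace_def funpow_cmatrix_cvector norm_cvector)
  then show ?thesis by (rule tendsto_norm_zero_cancel[OF summable_LIMSEQ_zero])
qed

lemma unstable_subspace_tendsto_0:
  assumes "v \<in> unstable_subspace M" and "N ** M = mat 1"
  shows "(\<lambda>k. ((*v) N ^^ k) v) \<longlonglongrightarrow> 0"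
proof -
  have inv: "cmatrix N ** cmatrix M = mat 1" by (metis assms(2) cmatrix_mult cmatrix_mat_1)
  have "vec.span (\<Union>\<mu>\<in>{\<mu> \<in> {\<mu>. cmod \<mu> > 1}. eigenvalue (cmatrix M) \<mu>}. gen_eigenspace (cmatrix M) \<mu>)
      \<subseteq> {v. summable (\<lambda>k. norm (((*v) (cmatrix N) ^^ k) v))}"
    by (intro vec.span_minimal subspace_summable_orbits) (auto intro: gen_eigenspace_summable_backward inv)
  then have "summable (\<lambda>k. norm (((*v) N ^^ k) v))"
    using assms by (auto simp: unstable_subspace_def spectral_subspace_def funpow_cmatrix_cvector norm_cvector)
  then show ?thesis by (rule tendsto_norm_zero_cancel[OF summable_LIMSEQ_zero])
qed

section \<open>Conjugation and the real form of the spectral splitting\<close>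

lemma cvector_linear: "cvector 0 = 0" "cvector (u + v) = cvector u + cvector v"
    "cvector (c *\<^sub>R v) = complex_of_real c *s cvector v"
  by (simp_all add: vec_eq_iff cvector_def)

lemma subspace_spectral_subspace: "subspace (spectral_subspace M \<Lambda>)"
  by (intro subspaceI)
    (simp_all add: cvector_linear spectral_subspace_def vec.span_zero vec.span_add vec.span_scale)

definition vcnj :: "complex^'n \<Rightarrow> complex^'n" where "vcnj v = (\<chi> i. cnj (v $ i))"

lemma vcnj_linear: "vcnj 0 = 0" "vcnj (u + v) = vcnj u + vcnj v" "vcnj (c *s v) = cnj c *s vcnj v"
    "vcnj (u - v) = vcnj u - vcnj v"
  by (simp_all add: vec_eq_iff vcnj_def)

lemma vcnj_cmatrix: "vcnj (cmatrix M *v v) = cmatrix M *v vcnj v"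
  by (simp add: vec_eq_iff vcnj_def matrix_vector_mult_def)

lemma vcnj_gen_eigenspace:
  assumes "v \<in> gen_eigenspace (cmatrix M) \<mu>"
  shows "vcnj v \<in> gen_eigenspace (cmatrix M) (cnj \<mu>)"
  using assms
proof (induction rule: gen_eigenspace_induct)
  case zero
  then show ?case by (simp add: vcnj_linear vec.subspace_0[OF subspace_gen_eigenspace])
next
  case (step v)
  have "shifted (cmatrix M) (cnj \<mu>) (vcnj v) = vcnj (shifted (cmatrix M) \<mu> v)"
    by (simp add: shifted_eq vcnj_linear vcnj_cmatrix)
  with step show ?case 
    using gen_eigenspace_shifted[of "cmatrix M" "cnj \<mu>" "vcnj v"] by simp
qed

lemma vcnj_eigenvalue: "eigenvalue (cmatrix M) \<mu> \<Longrightarrow> eigenvalue (cmatrix M) (cnj \<mu>)"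
proof -
  assume "eigenvalue (cmatrix M) \<mu>"
  then obtain v where v: "v \<noteq> 0" "cmatrix M *v v = \<mu> *s v" by (auto simp: eigenvalue_def)
  then have "vcnj v \<noteq> 0" by (simp add: vec_eq_iff vcnj_def)
  moreover have "cmatrix M *v vcnj v = cnj \<mu> *s vcnj v" by (metis v(2) vcnj_cmatrix vcnj_linear(3))
  ultimately show ?thesis unfolding eigenvalue_def by blast
qed

text \<open>With \<Lambda> closed under conjugation, the span contains the conjugate of
  \<open>v\<close>, hence also the average of both, which is the real part.\<close>

lemma real_part_in_spectral_subspace:
  assumes sym: "\<And>\<mu>. \<mu> \<in> \<Lambda> \<Longrightarrow> cnj \<mu> \<in> \<Lambda>"
    and v: "v \<in> vec.span (\<Union>\<mu>\<in>{\<mu>\<in>\<Lambda>. eigenvalue (cmatrix M) \<mu>}. gen_eigenspace (cmatrix M) \<mu>)" (is "_ \<in> vec.span ?U")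
  shows "(\<chi> i. Re (v $ i)) \<in> spectral_subspace M \<Lambda>"
proof -
  have "vcnj v \<in> vec.span ?U"
    using v
  proof (induction rule: vec.span_induct_alt)
    case (step c x y)
    from step(1) obtain \<mu> where "\<mu> \<in> \<Lambda>" "eigenvalue (cmatrix M) \<mu>" "x \<in> gen_eigenspace (cmatrix M) \<mu>"
      by (elim UN_E CollectE conjE)
    then have "cnj \<mu> \<in> {\<mu>\<in>\<Lambda>. eigenvalue (cmatrix M) \<mu>}" "vcnj x \<in> gen_eigenspace (cmatrix M) (cnj \<mu>)"
      using sym vcnj_eigenvalue vcnj_gen_eigenspace by simp_all
    then have "vcnj x \<in> vec.span ?U" by (intro vec.span_base UN_I)
    then show ?case unfolding vcnj_linear by (intro vec.span_add vec.span_scale step.IH)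
  qed (simp only: vcnj_linear vec.span_zero)
  then have "(1 / 2) *s (v + vcnj v) \<in> vec.span ?U" by (rule vec.span_scale[OF vec.span_add[OF v]])
  moreover have "(1 / 2) *s (v + vcnj v) = cvector (\<chi> i. Re (v $ i))"
    by (simp add: vec_eq_iff vcnj_def cvector_def complex_eq_iff)
  ultimately show ?thesis by (simp add: spectral_subspace_def)
qed

theorem hyperbolic_splitting:
  assumes "hyperbolic M"
  shows "\<exists>s \<in> stable_subspace M. \<exists>u \<in> unstable_subspace M. v = s + u"
proof -
  let ?g = "gen_eigenspace (cmatrix M)"
  let ?S = "\<Union>\<mu>\<in>{\<mu> \<in> {\<mu>. cmod \<mu> < 1}. eigenvalue (cmatrix M) \<mu>}. ?g \<mu>"
  let ?U = "\<Union>\<mu>\<in>{\<mu> \<in> {\<mu>. cmod \<mu> > 1}. eigenvalue (cmatrix M) \<mu>}. ?g \<mu>"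
  \<comment> \<open>The generalized eigenspace of a number that is not an eigenvalue is {0}, and 0
    is inserted to cover these; hyperbolicity excludes eigenvalues of modulus 1.\<close>
  have "x \<in> insert 0 (?S \<union> ?U)" if x: "x \<in> ?g \<mu>" for x \<mu>
  proof (cases "x = 0")
    case False
    then have e: "eigenvalue (cmatrix M) \<mu>" using x gen_eigenspace_nontrivial by blast
    then have "cmod \<mu> < 1 \<or> cmod \<mu> > 1" using assms unfolding hyperbolic_def by (meson linorder_neqE)
    then show ?thesis using e x by blast
  qed simp
  then have "(\<Union>\<mu>. ?g \<mu>) \<subseteq> insert 0 (?S \<union> ?U)" by blast
  then have "UNIV \<subseteq> vec.span (insert 0 (?S \<union> ?U))" 
    unfolding span_gen_eigenspaces[of "cmatrix M", symmetric] by (rule vec.span_mono)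
  then have "cvector v \<in> vec.span (?S \<union> ?U)" unfolding vec.span_insert_0 by blast
  then obtain s u where su: "s \<in> vec.span ?S" "u \<in> vec.span ?U" "cvector v = s + u"
    unfolding vec.span_Un by blast
  have "(\<chi> i. Re (s $ i)) \<in> stable_subspace M"
    unfolding stable_subspace_def by (rule real_part_in_spectral_subspace[OF _ su(1)]) simp
  moreover have "(\<chi> i. Re (u $ i)) \<in> unstable_subspace M"
    unfolding unstable_subspace_def by (rule real_part_in_spectral_subspace[OF _ su(2)]) simp
  moreover have "v = (\<chi> i. Re (s $ i)) + (\<chi> i. Re (u $ i))"
  proof (rule vec_eq_iff[THEN iffD2], intro allI)
    fix i
    have "complex_of_real (v $ i) = s $ i + u $ i"
      using arg_cong[OF su(3), of "\<lambda>v. v $ i"] by (simp add: cvector_def)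
    from arg_cong[OF this, of Re]
    show "v $ i = ((\<chi> i. Re (s $ i)) + (\<chi> i. Re (u $ i))) $ i" by simp
  qed
  ultimately show ?thesis by blast
qed

section \<open>The Lyapunov inequality from stabilizability\<close>

text \<open>A nonzero coefficient \<open>v $ j\<close> expresses row \<open>j\<close> through the
  other rows, so these already span the row space.\<close>

lemma rank_less_of_left_kernel:
  fixes M :: "'a::field^'n^'m"
  assumes v: "v \<noteq> 0" and zero: "(\<Sum>i\<in>UNIV. v $ i *s M $ i) = 0"
  shows "rank M < CARD('m)"
proof -
  obtain j where j: "v $ j \<noteq> 0" using v by (auto simp: vec_eq_iff)
  let ?R = "(\<lambda>i. M $ i) ` (UNIV - {j})"
  have "(\<Sum>i\<in>UNIV. v $ i *s M $ i) = v $ j *s M $ j + (\<Sum>i\<in>UNIV - {j}. v $ i *s M $ i)"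
    by (rule sum.remove) auto
  then have a: "v $ j *s M $ j = - (\<Sum>i\<in>UNIV - {j}. v $ i *s M $ i)"
    unfolding zero by (metis eq_neg_iff_add_eq_0)
  have "M $ j = (1 / v $ j) *s (v $ j *s M $ j)"
    using j unfolding vector_smult_assoc by simp
  also note a
  also have "(1 / v $ j) *s - (\<Sum>i\<in>UNIV - {j}. v $ i *s M $ i) \<in> vec.span ?R"
    by (intro vec.span_scale vec.span_neg vec.span_sum vec.span_base) simp
  finally have jR: "M $ j \<in> vec.span ?R" .
  have "x \<in> vec.span ?R" if x: "x \<in> rows M" for x
  proof -
    obtain i where "x = M $ i" using x by (auto simp: rows_def row_def)
    then show ?thesis using jR by (cases "i = j") (simp_all add: vec.span_base)
  qed
  then have "rank M \<le> vec.dim ?R"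
    unfolding row_rank_def_gen by (intro vec.dim_mono) blast
  also have "\<dots> \<le> card ?R" by (rule vec.dim_le_card') simp
  also have "\<dots> \<le> card (UNIV - {j})" by (rule card_image_le) simp
  also have "\<dots> < CARD('m)" by (rule psubset_card_mono) auto
  finally show ?thesis .
qed

text \<open>This is the dual form of the rank (Hautus) test: \<open>v\<close>, taken without
  conjugation, is a left null vector of the block row [A - \<mu> I, B].\<close>

lemma stabilizable_left_eigenvalue:
  fixes A :: "real^'d^'d" and B :: "real^'m^'d"
  assumes stab: "stabilizable A B" and v: "v \<noteq> 0"
    and A: "cmatrix (transpose A) *v v = \<mu> *s v" and B: "cmatrix (transpose B) *v v = 0"
  shows "cmod \<mu> < 1"
proof (rule ccontr)
  let ?M = "block_row (cmatrix A - mat \<mu>) (cmatrix B)"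
  assume "\<not> cmod \<mu> < 1"
  then have "rank ?M = CARD('d)" using stab by (simp add: stabilizable_def)
  moreover have "(\<Sum>i\<in>UNIV. v $ i *s ?M $ i) = 0"
  proof (rule vec_eq_iff[THEN iffD2], intro allI)
    fix k
    show "(\<Sum>i\<in>UNIV. v $ i *s ?M $ i) $ k = 0 $ k"
    proof (cases k)
      case (Inl j)
      have "(v $ i *s ?M $ i) $ k = complex_of_real (A $ i $ j) * v $ i - v $ i * mat \<mu> $ i $ j" for i
        by (simp add: Inl block_row_def block_col_def algebra_simps)
      then have "(\<Sum>i\<in>UNIV. v $ i *s ?M $ i) $ k = (\<Sum>i\<in>UNIV. complex_of_real (A $ i $ j) * v $ i) - (\<Sum>i\<in>UNIV. v $ i * mat \<mu> $ i $ j)"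
        by (simp only: sum_component sum_subtractf)
      also have "(\<Sum>i\<in>UNIV. complex_of_real (A $ i $ j) * v $ i) = (cmatrix (transpose A) *v v) $ j"
        by (simp add: matrix_vector_mult_def transpose_def)
      also have "(\<Sum>i\<in>UNIV. v $ i * mat \<mu> $ i $ j) = (\<Sum>i\<in>UNIV. if i = j then \<mu> * v $ j else 0)"
        by (intro sum.cong) (auto simp: mat_def)
      also have "\<dots> = \<mu> * v $ j" by simp
      finally show ?thesis by (simp add: A)
    next
      case (Inr j)
      have "(\<Sum>i\<in>UNIV. v $ i *s ?M $ i) $ k = (cmatrix (transpose B) *v v) $ j"
        by (simp add: Inr block_row_def block_col_def matrix_vector_mult_def transpose_def mult.commute[of "v $ _"])
      then show ?thesis by (simp add: B)
    qed
  qed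
  ultimately show False using rank_less_of_left_kernel[OF v, of ?M] by simp
qed

section \<open>Rank-one matrices and nonnegative forms\<close>

definition outer :: "real^'n \<Rightarrow> real^'m \<Rightarrow> real^'m^'n" where
  "outer x y = (\<chi> i j. x $ i * y $ j)"

text \<open>The inner product of matrices is the entrywise one. A linear functional on matrices is
  therefore tested on rank-one matrices by evaluating the bilinear form of the matrix that
  represents it.\<close>

lemma inner_outer: "a \<bullet> outer x y = x \<bullet> (a *v y)"
  by (simp add: inner_vec_def outer_def matrix_vector_mult_def sum_distrib_left mult_ac)

lemma outer_mult_vec: "outer x y *v z = (y \<bullet> z) *\<^sub>R x"
  by (simp add: vec_eq_iff outer_def matrix_vector_mult_def inner_vec_def sum_distrib_left sum_distrib_right mult_ac)

lemma congruence_outer: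
  fixes A :: "real^'n^'m"
  shows "A ** outer x y ** transpose A = outer (A *v x) (A *v y)"
  by (rule matrix_eq[THEN iffD2])
    (simp add: matrix_vector_mul_assoc[symmetric] outer_mult_vec matrix_vector_mult_scaleR
      inner_matrix_transpose inner_commute)

text \<open>This cone contains every skew matrix together with its negative. A functional that is
  nonnegative on the cone vanishes on skew matrices, so the matrix representing it is
  symmetric.\<close>

definition nonneg_form :: "real^'n^'n \<Rightarrow> bool" where
  "nonneg_form D \<longleftrightarrow> (\<forall>x. 0 \<le> x \<bullet> (D *v x))"

lemma nonneg_form_outer: "nonneg_form (outer x x)"
  by (simp add: nonneg_form_def outer_mult_vec inner_commute)

lemma nonneg_form_0: "nonneg_form 0"
  by (simp add: nonneg_form_def)

lemma nonneg_form_combination: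
  assumes "nonneg_form D" "nonneg_form E" "0 \<le> u" "0 \<le> v"
  shows "nonneg_form (u *\<^sub>R D + v *\<^sub>R E)"
  using assms
  by (simp add: nonneg_form_def matrix_vector_mult_add_rdistrib scaleR_matrix_vector_assoc[symmetric] inner_add_right)

lemma psd_kernel:
  fixes a :: "real^'n^'n"
  assumes sym: "\<And>x y. x \<bullet> (a *v y) = y \<bullet> (a *v x)" and psd: "nonneg_form a" and x: "x \<bullet> (a *v x) = 0"
  shows "a *v x = 0"
proof -
  define y where "y = a *v x"
  define \<alpha> where "\<alpha> = y \<bullet> y"
  define \<beta> where "\<beta> = y \<bullet> (a *v y)"
  have b0: "\<beta> \<ge> 0" using psd by (simp add: \<beta>_def nonneg_form_def)
  \<comment> \<open>Up to the added 1 this minimizes the form along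
    \<open>x + t *\<^sub>R y\<close>; the 1 keeps the denominator positive when
    \<open>\<beta> = 0\<close>.\<close>
  define t where "t = - \<alpha> / (\<beta> + 1)"
  have xy: "x \<bullet> (a *v y) = \<alpha>" using sym[of x y] by (simp add: \<alpha>_def y_def)
  have yx: "y \<bullet> (a *v x) = \<alpha>" by (simp add: \<alpha>_def y_def)
  have "0 \<le> (x + t *\<^sub>R y) \<bullet> (a *v (x + t *\<^sub>R y))" using psd by (simp add: nonneg_form_def)
  also have "\<dots> = 2 * t * \<alpha> + t\<^sup>2 * \<beta>"
    using x xy yx
    by (simp add: matrix_vector_right_distrib matrix_vector_mult_scaleR inner_add_left inner_add_right
        \<beta>_def power2_eq_square algebra_simps)
  finally have "0 \<le> (\<beta> + 1)\<^sup>2 * (2 * t * \<alpha> + t\<^sup>2 * \<beta>)" by simp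
  also have "\<dots> = 2 * (t * (\<beta> + 1)) * \<alpha> * (\<beta> + 1) + (t * (\<beta> + 1))\<^sup>2 * \<beta>"
    by (simp add: power2_eq_square algebra_simps)
  also have "t * (\<beta> + 1) = - \<alpha>" using b0 by (simp add: t_def)
  also have "2 * - \<alpha> * \<alpha> * (\<beta> + 1) + (- \<alpha>)\<^sup>2 * \<beta> = - (\<alpha>\<^sup>2 * (\<beta> + 2))"
    by (simp add: power2_eq_square algebra_simps)
  finally have "\<alpha>\<^sup>2 * (\<beta> + 2) \<le> 0" by simp
  then have "\<alpha> = 0" using b0 by (simp add: mult_le_0_iff)
  then show ?thesis by (simp add: \<alpha>_def y_def)
qed

text \<open>The range of a symmetric matrix is the orthogonal complement of its kernel: the
  component of \<open>y\<close> orthogonal to the range lies in the kernel, so it is orthogonal to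
  \<open>y\<close> and vanishes.\<close>

lemma symmetric_range:
  fixes a :: "real^'n^'n"
  assumes sym: "\<And>x y. x \<bullet> (a *v y) = y \<bullet> (a *v x)" and y: "\<And>z. a *v z = 0 \<Longrightarrow> z \<bullet> y = 0"
  shows "\<exists>w. y = a *v w"
proof -
  obtain r z where r: "r \<in> span (range ((*v) a))" and z: "\<And>w. w \<in> span (range ((*v) a)) \<Longrightarrow> orthogonal z w" and yrz: "y = r + z"
    using orthogonal_subspace_decomp_exists[of "range ((*v) a)" y] by metis
  have "w \<bullet> (a *v z) = 0" for w
    using z[of "a *v w"] sym[of w z] by (simp add: orthogonal_def span_base)
  then have az: "a *v z = 0" using inner_eq_zero_iff by blast
  have "z \<bullet> r = 0" using z[OF r] by (simp add: orthogonal_def)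
  then have "z \<bullet> z = 0" using y[OF az] by (simp add: yrz inner_add_right)
  then have "y = r" using yrz by simp
  moreover have "span (range ((*v) a)) = range ((*v) a)"
    by (subst span_eq_iff) (simp add: linear_subspace_image)
  ultimately show ?thesis using r by (metis rangeE)
qed

text \<open>In complex notation, with w = w1 + i w2, the vector a w is an eigenvector of
  \<open>transpose A\<close> for \<mu> = \<alpha> + i \<beta>, and y = y1 + i y2 is the preimage of
  w under \<open>A\<close>. Moving \<open>A\<close> across the Hermitian form of \<open>a\<close>
  gives q(w, w) as \<mu> times a mixed term in y and w. Cauchy-Schwarz and q(y, y) \<le> q(w, w)
  then force the modulus of \<mu> to be at least 1.\<close>

lemma inner_eigen_expansion:
  fixes a A :: "real^'n^'n"
  assumes sym: "\<And>x y. x \<bullet> (a *v y) = y \<bullet> (a *v x)" and psd: "nonneg_form a"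
    and expand: "\<And>y. y \<bullet> (a *v y) \<le> (A *v y) \<bullet> (a *v (A *v y))"
    and Ay: "A *v y1 = w1" "A *v y2 = w2"
    and e1: "transpose A *v (a *v w1) = \<alpha> *\<^sub>R (a *v w1) - \<beta> *\<^sub>R (a *v w2)"
    and e2: "transpose A *v (a *v w2) = \<beta> *\<^sub>R (a *v w1) + \<alpha> *\<^sub>R (a *v w2)"
    and nz: "a *v w1 \<noteq> 0 \<or> a *v w2 \<noteq> 0"
  shows "\<alpha>\<^sup>2 + \<beta>\<^sup>2 \<ge> 1"
proof -
  define q where "q x y = x \<bullet> (a *v y)" for x y
  define N where "N = q w1 w1 + q w2 w2"
  define N' where "N' = q y1 y1 + q y2 y2"
  have qs: "q x y = q y x" for x y using sym by (simp add: q_def)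
  have qadd: "q (x + y) z = q x z + q y z" "q z (x + y) = q z x + q z y"
      "q (x - y) z = q x z - q y z" "q z (x - y) = q z x - q z y"
      "q (c *\<^sub>R x) z = c * q x z" "q z (c *\<^sub>R x) = c * q z x" for x y z c
    by (simp_all add: q_def inner_add_left inner_add_right inner_diff_left inner_diff_right
        matrix_vector_right_distrib matrix_vector_mult_diff_distrib matrix_vector_mult_scaleR)
  have q0: "q x x \<ge> 0" for x using psd by (simp add: q_def nonneg_form_def)
  have "N > 0"
  proof -
    have "q w1 w1 \<noteq> 0 \<or> q w2 w2 \<noteq> 0" using nz psd_kernel[OF sym psd] unfolding q_def by blast
    then show ?thesis using q0[of w1] q0[of w2] by (auto simp: N_def)
  qed
  have N'N: "N' \<le> N" using expand[of y1] expand[of y2] by (simp add: N_def N'_def q_def Ay)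
  have 1: "q w1 w1 = \<alpha> * q y1 w1 - \<beta> * q y1 w2"
  proof -
    have "q w1 w1 = (a *v w1) \<bullet> (A *v y1)" unfolding q_def Ay by (rule inner_commute)
    also have "\<dots> = (transpose A *v (a *v w1)) \<bullet> y1" by (rule inner_matrix_transpose)
    finally show ?thesis unfolding e1 by (simp add: q_def inner_diff_left inner_diff_right inner_commute[of _ y1])
  qed
  have 2: "q w2 w2 = \<beta> * q y2 w1 + \<alpha> * q y2 w2"
  proof -
    have "q w2 w2 = (a *v w2) \<bullet> (A *v y2)" unfolding q_def Ay by (rule inner_commute)
    also have "\<dots> = (transpose A *v (a *v w2)) \<bullet> y2" by (rule inner_matrix_transpose)
    finally show ?thesis unfolding e2 by (simp add: q_def inner_add_left inner_add_right inner_commute[of _ y2])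
  qed
  \<comment> \<open>\<open>z1\<close> and \<open>z2\<close> are the real and imaginary parts of the
    conjugate of \<mu> times y. Expanding the form at z - w is the Cauchy-Schwarz argument in real
    terms.\<close>
  define z1 where "z1 = \<alpha> *\<^sub>R y1 + \<beta> *\<^sub>R y2"
  define z2 where "z2 = \<alpha> *\<^sub>R y2 - \<beta> *\<^sub>R y1"
  have zw: "q z1 w1 + q z2 w2 = N" by (simp add: N_def 1 2 z1_def z2_def qadd)
  have zz: "q z1 z1 + q z2 z2 = (\<alpha>\<^sup>2 + \<beta>\<^sup>2) * N'"
    by (simp add: N'_def z1_def z2_def qadd qs[of y2 y1] power2_eq_square algebra_simps)
  have "0 \<le> q (z1 - w1) (z1 - w1) + q (z2 - w2) (z2 - w2)" using q0 by simp
  also have "\<dots> = (q z1 z1 + q z2 z2) - 2 * (q z1 w1 + q z2 w2) + N"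
    by (simp add: qadd N_def qs[of w1 z1] qs[of w2 z2])
  also have "\<dots> = (\<alpha>\<^sup>2 + \<beta>\<^sup>2) * N' - N" by (simp add: zw zz)
  also have "\<dots> \<le> (\<alpha>\<^sup>2 + \<beta>\<^sup>2) * N - 1 * N" using N'N by (simp add: mult_left_mono)
  finally have "0 \<le> (\<alpha>\<^sup>2 + \<beta>\<^sup>2 - 1) * N" by (simp add: left_diff_distrib)
  then show ?thesis using \<open>N > 0\<close> by (simp add: zero_le_mult_iff)
qed

lemma complex_vector_split: "v = cvector (\<chi> i. Re (v $ i)) + \<i> *s cvector (\<chi> i. Im (v $ i))"
  by (simp add: vec_eq_iff cvector_def complex_eq_iff)

lemma cmatrix_mult_split:
  "cmatrix M *v (cvector x + \<i> *s cvector y) = cvector (M *v x) + \<i> *s cvector (M *v y)"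
  by (simp add: matrix_vector_right_distrib vector_scalar_commute cmatrix_mult_cvector)

lemma cmatrix_mult_complex:
  "cmatrix M *v z = cvector (M *v (\<chi> i. Re (z $ i))) + \<i> *s cvector (M *v (\<chi> i. Im (z $ i)))"
  by (subst complex_vector_split[of z]) (rule cmatrix_mult_split)

lemma cvector_split_eq:
  "cvector x + \<i> *s cvector y = cvector x' + \<i> *s cvector y' \<longleftrightarrow> x = x' \<and> y = y'"
  by (auto simp: vec_eq_iff cvector_def complex_eq_iff)

text \<open>
  The matrix \<open>a\<close> arises as a separating functional.  Its range is invariant under the transpose
  of \<open>A\<close> and annihilated by the transpose of \<open>B\<close>, so it contains an eigenvector that violates
  stabilizability.
\<close>

lemma no_expanding_form:
  fixes A :: "real^'d^'d" and B :: "real^'m^'d"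
  assumes inv: "invertible A" and stab: "stabilizable A B"
    and sym: "\<And>x y. x \<bullet> (a *v y) = y \<bullet> (a *v x)" and psd: "nonneg_form a"
    and expand: "\<And>y. y \<bullet> (a *v y) \<le> (A *v y) \<bullet> (a *v (A *v y))"
    and B: "\<And>z. (B *v z) \<bullet> (a *v (B *v z)) \<le> 0"
  shows "a = 0"
proof (rule ccontr)
  assume "a \<noteq> 0"
  then obtain w0 where w0: "a *v w0 \<noteq> 0" by (metis matrix_eq matrix_vector_mult_0)
  obtain Ai where Ai: "A ** Ai = mat 1" "Ai ** A = mat 1" using inv by (auto simp: invertible_def)
  have AAi: "A *v (Ai *v x) = x" "Ai *v (A *v x) = x" for x
    by (simp_all add: matrix_vector_mul_assoc Ai)
  define K where "K = {x. a *v x = 0}"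
  have K: "subspace K" by (simp add: K_def subspace_def matrix_vector_right_distrib matrix_vector_mult_scaleR)
  \<comment> \<open>The hypothesis \<open>expand\<close> bounds the form at a preimage, so it shows
    the kernel invariant under the inverse of \<open>A\<close> only. Injectivity and equality of
    dimensions turn this inclusion into an equality, which yields invariance under \<open>A\<close>
    itself.\<close>
  have "Ai *v x \<in> K" if "x \<in> K" for x
  proof -
    have "(Ai *v x) \<bullet> (a *v (Ai *v x)) \<le> 0" using expand[of "Ai *v x"] that by (simp add: AAi K_def)
    then have "(Ai *v x) \<bullet> (a *v (Ai *v x)) = 0" using psd by (simp add: nonneg_form_def order_antisym)
    then show ?thesis unfolding K_def using psd_kernel[OF sym psd] by blast
  qed
  then have sub: "(*v) Ai ` K \<subseteq> K" by auto
  have "inj ((*v) Ai)" by (metis AAi(1) injI)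
  then have "dim ((*v) Ai ` K) = dim K"
    by (intro dim_image_eq matrix_vector_mul_linear) (rule inj_on_subset[OF _ subset_UNIV])
  then have img: "(*v) Ai ` K = K"
    by (intro subspace_dim_equal[OF linear_subspace_image[OF matrix_vector_mul_linear K] K sub]) simp
  have AK: "A *v x \<in> K" if "x \<in> K" for x
  proof -
    have "x \<in> (*v) Ai ` K" using that by (simp only: img)
    then obtain x' where "x' \<in> K" "x = Ai *v x'" by (elim imageE)
    then show ?thesis by (simp add: AAi)
  qed
  have rng: "\<exists>w'. transpose A *v (a *v w) = a *v w'" for w
  proof (rule symmetric_range[OF sym])
    fix z assume "a *v z = 0"
    then have "a *v (A *v z) = 0" using AK[of z] by (simp add: K_def)
    then have "(A *v z) \<bullet> (a *v w) = 0" by (simp add: sym[of _ w])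
    then show "z \<bullet> (transpose A *v (a *v w)) = 0" by (metis inner_commute inner_matrix_transpose)
  qed
  have aB: "a *v (B *v z) = 0" for z
    by (rule psd_kernel[OF sym psd]) (use B[of z] psd in \<open>auto simp: nonneg_form_def intro: order_antisym\<close>)
  have Ba: "transpose B *v (a *v x) = 0" for x
  proof -
    have "(transpose B *v (a *v x)) \<bullet> z = 0" for z
      using sym[of "B *v z" x] by (metis aB inner_matrix_transpose inner_commute inner_zero_right)
    then show ?thesis using inner_eq_zero_iff by blast
  qed
  define U where "U = range ((*v) (cmatrix a))"
  have Uform: "\<exists>x y. v = cvector (a *v x) + \<i> *s cvector (a *v y)" if "v \<in> U" for v
    using that cmatrix_mult_complex[of a] unfolding U_def by blast
  have "vec.subspace U"
    unfolding U_def
  proof (rule vec.subspaceI)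
    show "0 \<in> range ((*v) (cmatrix a))" by (rule range_eqI[of _ _ 0]) simp
    fix u assume "u \<in> range ((*v) (cmatrix a))"
    then obtain u' where u: "u = cmatrix a *v u'" by (elim rangeE)
    show "c *s u \<in> range ((*v) (cmatrix a))" for c
      by (rule range_eqI[of _ _ "c *s u'"]) (simp add: u vector_scalar_commute)
    fix v assume "v \<in> range ((*v) (cmatrix a))"
    then obtain v' where v: "v = cmatrix a *v v'" by (elim rangeE)
    show "u + v \<in> range ((*v) (cmatrix a))"
      by (rule range_eqI[of _ _ "u' + v'"]) (simp add: u v matrix_vector_right_distrib)
  qed
  moreover have "cmatrix (transpose A) *v v \<in> U" if vU: "v \<in> U" for v
  proof -
    obtain x y where v: "v = cvector (a *v x) + \<i> *s cvector (a *v y)" using Uform[OF vU] by blast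
    obtain x' y' where "transpose A *v (a *v x) = a *v x'" "transpose A *v (a *v y) = a *v y'"
      using rng by metis
    then have "cmatrix (transpose A) *v v = cmatrix a *v (cvector x' + \<i> *s cvector y')"
      by (simp add: v cmatrix_mult_split)
    then show ?thesis by (simp add: U_def)
  qed
  moreover have "cvector (a *v w0) \<in> U" unfolding U_def by (metis cmatrix_mult_cvector rangeI)
  moreover have "cvector (a *v w0) \<noteq> 0" using w0 by (metis norm_cvector norm_eq_zero)
  ultimately obtain \<mu> v where v: "v \<in> U" "v \<noteq> 0" "cmatrix (transpose A) *v v = \<mu> *s v"
    using invariant_subspace_eigenvector by metis
  obtain w1 w2 where vw: "v = cvector (a *v w1) + \<i> *s cvector (a *v w2)" using Uform[OF v(1)] by blast
  have "cmatrix (transpose B) *v v = 0"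
    unfolding vw cmatrix_mult_split Ba by (simp add: cvector_linear)
  then have "cmod \<mu> < 1" using stabilizable_left_eigenvalue[OF stab v(2,3)] by blast
  have "\<mu> *s v = cvector (Re \<mu> *\<^sub>R (a *v w1) - Im \<mu> *\<^sub>R (a *v w2)) + \<i> *s cvector (Im \<mu> *\<^sub>R (a *v w1) + Re \<mu> *\<^sub>R (a *v w2))"
    by (simp add: vw vec_eq_iff cvector_def complex_eq_iff)
  with v(3) have e: "transpose A *v (a *v w1) = Re \<mu> *\<^sub>R (a *v w1) - Im \<mu> *\<^sub>R (a *v w2)"
      "transpose A *v (a *v w2) = Im \<mu> *\<^sub>R (a *v w1) + Re \<mu> *\<^sub>R (a *v w2)"
    unfolding vw cmatrix_mult_split by (simp_all only: cvector_split_eq)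
  have "a *v w1 \<noteq> 0 \<or> a *v w2 \<noteq> 0" using v(2) by (auto simp: vw cvector_linear)
  with inner_eigen_expansion[OF sym psd expand AAi(1) AAi(1) e]
  have "1 \<le> (Re \<mu>)\<^sup>2 + (Im \<mu>)\<^sup>2" by blast
  then have "1 \<le> (cmod \<mu>)\<^sup>2" by (simp add: cmod_power2)
  with \<open>cmod \<mu> < 1\<close> show False using power_less_one_iff[of "cmod \<mu>" 2] by simp
qed

lemma norm_matrix_vector_mult_le:
  fixes M :: "real^'n^'m"
  shows "norm (M *v x) \<le> norm M * norm x"
proof -
  have "norm (M *v x) = L2_set (\<lambda>i. norm (M $ i \<bullet> x)) UNIV"
    by (simp add: norm_vec_def matrix_vector_mul_component)
  also have "\<dots> \<le> L2_set (\<lambda>i. norm (M $ i) * norm x) UNIV"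
    by (intro L2_set_mono) (auto simp: Cauchy_Schwarz_ineq2)
  also have "\<dots> = norm M * norm x"
    by (simp add: norm_vec_def L2_set_left_distrib)
  finally show ?thesis .
qed

text \<open>The inequality is made an equation for the identity matrix: \<open>D\<close> is the
  slack, and \<open>E\<close> takes the place of the scalar \<open>k\<close>, which is recovered at
  the end as \<open>norm E\<close>. Letting \<open>P\<close>, \<open>E\<close> and \<open>D\<close>
  range independently over nonnegative forms makes the attainable matrices a convex cone, and each
  of the three can be tested on rank-one matrices alone.\<close>

theorem stabilizable_lyapunov:
  fixes A :: "real^'d^'d" and B :: "real^'m^'d"
  assumes inv: "invertible A" and stab: "stabilizable A B"
  obtains P k where "transpose P = P" "nonneg_form P" "0 \<le> k"
    "\<And>x. (transpose A *v x) \<bullet> (P *v (transpose A *v x))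
        \<le> x \<bullet> (P *v x) - (norm x)\<^sup>2 + k * (norm (transpose B *v x))\<^sup>2"
proof -
  define f :: "real^'d^'d \<Rightarrow> real^'m^'m \<Rightarrow> real^'d^'d \<Rightarrow> real^'d^'d"
    where "f P E D = P - A ** P ** transpose A + B ** E ** transpose B - D" for P E D
  define C where "C = {f P E D | P E D. nonneg_form P \<and> nonneg_form E \<and> nonneg_form D}"
  have CI: "f P E D \<in> C" if "nonneg_form P" "nonneg_form E" "nonneg_form D" for P E D
    unfolding C_def using that by blast
  have mlin: "X ** (u *\<^sub>R Y + v *\<^sub>R Z) ** W = u *\<^sub>R (X ** Y ** W) + v *\<^sub>R (X ** Z ** W)"
    for X :: "real^'a^'d" and Y Z :: "real^'a^'a" and W :: "real^'d^'a" and u v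
    by (rule matrix_eq[THEN iffD2]) (simp add: matrix_vector_mul_assoc[symmetric] matrix_vector_mult_add_rdistrib
        scaleR_matrix_vector_assoc[symmetric] matrix_vector_right_distrib matrix_vector_mult_scaleR)
  have flin: "f (u *\<^sub>R P + v *\<^sub>R P') (u *\<^sub>R E + v *\<^sub>R E') (u *\<^sub>R D + v *\<^sub>R D') = u *\<^sub>R f P E D + v *\<^sub>R f P' E' D'"
    for u v P P' E E' D D'
    unfolding f_def mlin by (simp add: algebra_simps)
  have cone: "u *\<^sub>R x + v *\<^sub>R y \<in> C" if xy: "x \<in> C" "y \<in> C" and uv: "0 \<le> u" "0 \<le> v" for x y u v
  proof -
    obtain P E D P' E' D' where
      "x = f P E D" "nonneg_form P" "nonneg_form E" "nonneg_form D"
      "y = f P' E' D'" "nonneg_form P'" "nonneg_form E'" "nonneg_form D'"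
      using xy unfolding C_def by blast
    then show ?thesis
      using uv by (simp only: flin[symmetric]) (intro CI nonneg_form_combination)
  qed
  have "mat 1 \<in> C"
  proof (rule ccontr)
    assume notin: "mat 1 \<notin> C"
    have "convex C" unfolding convex_def using cone by blast
    moreover have "f 0 0 0 \<in> C" by (intro CI nonneg_form_0)
    ultimately obtain a b where a: "a \<noteq> 0" and ab: "\<And>x. x \<in> C \<Longrightarrow> a \<bullet> x \<le> b"
      \<comment> \<open>Weak separation of disjoint nonempty convex sets holds in finite dimension
        whether or not they are closed, and its conclusion \<open>a \<noteq> 0\<close> is what gets
        contradicted.\<close>
      using separating_hyperplane_sets[of C "{mat 1}"] notin by auto
    have le0: "a \<bullet> x \<le> 0" if x: "x \<in> C" for x
    proof (rule ccontr)
      assume "\<not> a \<bullet> x \<le> 0"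
      then have pos: "a \<bullet> x > 0" by simp
      define s where "s = (\<bar>b\<bar> + 1) / (a \<bullet> x)"
      have "s *\<^sub>R x + 0 *\<^sub>R x \<in> C" using pos by (intro cone x) (auto simp: s_def)
      then have "a \<bullet> (s *\<^sub>R x) \<le> b" by (intro ab) simp
      moreover have "a \<bullet> (s *\<^sub>R x) = \<bar>b\<bar> + 1" using pos by (simp add: s_def)
      ultimately show False by linarith
    qed
    have aD: "a \<bullet> D \<ge> 0" if "nonneg_form D" for D
    proof -
      have "f 0 0 D \<in> C" by (intro CI nonneg_form_0 that)
      then show ?thesis using le0[of "f 0 0 D"] by (simp add: f_def)
    qed
    have sym: "x \<bullet> (a *v y) = y \<bullet> (a *v x)" for x y
    proof -
      have "nonneg_form (outer x y - outer y x)" "nonneg_form (outer y x - outer x y)"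
        by (simp_all add: nonneg_form_def matrix_vector_mult_diff_rdistrib outer_mult_vec inner_diff_right inner_commute)
      from aD[OF this(1)] aD[OF this(2)] show ?thesis by (simp add: inner_diff_right inner_outer)
    qed
    have psd: "nonneg_form a"
      using aD[OF nonneg_form_outer] by (simp add: nonneg_form_def inner_outer)
    have expand: "y \<bullet> (a *v y) \<le> (A *v y) \<bullet> (a *v (A *v y))" for y
    proof -
      have "f (outer y y) 0 0 \<in> C" by (intro CI nonneg_form_0 nonneg_form_outer)
      then show ?thesis using le0[of "f (outer y y) 0 0"]
        by (simp add: f_def congruence_outer inner_diff_right inner_outer)
    qed
    have B: "(B *v z) \<bullet> (a *v (B *v z)) \<le> 0" for z
    proof -
      have "f 0 (outer z z) 0 \<in> C" by (intro CI nonneg_form_0 nonneg_form_outer)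
      then show ?thesis using le0[of "f 0 (outer z z) 0"]
        by (simp add: f_def congruence_outer inner_outer)
    qed
    show False using no_expanding_form[OF inv stab sym psd expand B] a by blast
  qed
  then obtain P E D where PED: "mat 1 = f P E D" "nonneg_form P" "nonneg_form E" "nonneg_form D"
    by (auto simp: C_def)
  \<comment> \<open>The matrix \<open>P\<close> taken from the cone may have a skew part;
    symmetrizing removes it and keeps the quadratic form.\<close>
  define P' where "P' = (1/2) *\<^sub>R (P + transpose P)"
  have P'P: "x \<bullet> (P' *v x) = x \<bullet> (P *v x)" for x
  proof -
    have "x \<bullet> (transpose P *v x) = x \<bullet> (P *v x)"
      by (metis inner_commute inner_matrix_transpose)
    then show ?thesis
      by (simp add: P'_def scaleR_matrix_vector_assoc[symmetric] matrix_vector_mult_add_rdistrib inner_add_right)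
  qed
  show thesis
  proof (rule that[of P' "norm E"])
    show "transpose P' = P'" by (simp add: P'_def transpose_def vec_eq_iff)
    show "nonneg_form P'" using PED(2) by (simp add: nonneg_form_def P'P)
    show "0 \<le> norm E" by simp
    fix x
    have "x \<bullet> (mat 1 *v x) = x \<bullet> (f P E D *v x)" by (simp only: PED(1))
    also have "\<dots> = x \<bullet> (P *v x) - (transpose A *v x) \<bullet> (P *v (transpose A *v x))
        + (transpose B *v x) \<bullet> (E *v (transpose B *v x)) - x \<bullet> (D *v x)"
      by (simp add: f_def matrix_vector_mult_diff_rdistrib matrix_vector_mult_add_rdistrib
          matrix_vector_mul_assoc[symmetric] inner_diff_right inner_add_right inner_matrix_transpose)
    finally have "(norm x)\<^sup>2 = x \<bullet> (P *v x) - (transpose A *v x) \<bullet> (P *v (transpose A *v x))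
        + (transpose B *v x) \<bullet> (E *v (transpose B *v x)) - x \<bullet> (D *v x)"
      by (simp add: power2_norm_eq_inner)
    moreover have "(transpose B *v x) \<bullet> (E *v (transpose B *v x)) \<le> norm E * (norm (transpose B *v x))\<^sup>2"
    proof -
      have "(transpose B *v x) \<bullet> (E *v (transpose B *v x)) \<le> norm (transpose B *v x) * (norm E * norm (transpose B *v x))"
        by (intro order_trans[OF norm_cauchy_schwarz] mult_left_mono norm_matrix_vector_mult_le) auto
      then show ?thesis by (simp add: power2_eq_square mult_ac)
    qed
    moreover have "0 \<le> x \<bullet> (D *v x)" using PED(4) by (simp add: nonneg_form_def)
    ultimately show "(transpose A *v x) \<bullet> (P' *v (transpose A *v x))
        \<le> x \<bullet> (P' *v x) - (norm x)\<^sup>2 + norm E * (norm (transpose B *v x))\<^sup>2"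
      unfolding P'P by linarith
  qed
qed

section \<open>Uniform bounds near a datum and on compact sets\<close>

lemma norm_transpose_mult_le:
  fixes M :: "real^'n^'m"
  shows "norm (transpose M *v x) \<le> norm M * norm x"
proof -
  let ?y = "transpose M *v x"
  have "(norm ?y)\<^sup>2 = x \<bullet> (M *v ?y)" by (simp only: power2_norm_eq_inner inner_matrix_transpose[of x M ?y])
  also have "\<dots> \<le> norm x * (norm M * norm ?y)"
    by (intro order_trans[OF norm_cauchy_schwarz] mult_left_mono norm_matrix_vector_mult_le) simp
  finally have "norm ?y * norm ?y \<le> (norm M * norm x) * norm ?y" by (simp only: power2_eq_square mult_ac)
  then show ?thesis by (cases "norm ?y = 0") (simp_all add: mult_le_cancel_right)
qed

lemma tendsto_matrix_mult:
  fixes f :: "'a \<Rightarrow> real^'n^'m" and g :: "'a \<Rightarrow> real^'k^'n"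
  assumes "(f \<longlongrightarrow> a) F" "(g \<longlongrightarrow> b) F"
  shows "((\<lambda>x. f x ** g x) \<longlongrightarrow> a ** b) F"
  unfolding matrix_matrix_mult_def
  by (intro tendsto_vec_lambda tendsto_sum tendsto_mult tendsto_vec_nth assms)

lemma tendsto_transpose:
  fixes f :: "'a \<Rightarrow> real^'n^'m"
  assumes "(f \<longlongrightarrow> a) F"
  shows "((\<lambda>x. transpose (f x)) \<longlongrightarrow> transpose a) F"
  unfolding transpose_def by (intro tendsto_vec_lambda tendsto_vec_nth assms)

lemma pos_def_coercive:
  fixes Q :: "real^'n^'n"
  assumes "pos_def Q"
  shows "\<exists>c>0. \<forall>x. c * (norm x)\<^sup>2 \<le> x \<bullet> (Q *v x)"
proof -
  have ne: "sphere 0 1 \<noteq> ({} :: (real^'n) set)"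
  proof -
    obtain v :: "real^'n" where "norm v = 1" using vector_choose_size[of 1] by auto
    then show ?thesis by auto
  qed
  have cont: "continuous_on (sphere 0 1) (\<lambda>x. x \<bullet> (Q *v x))"
    by (intro continuous_intros linear_continuous_on matrix_vector_mul_bounded_linear)
  obtain v where v: "norm v = 1" "\<And>y. norm y = 1 \<Longrightarrow> v \<bullet> (Q *v v) \<le> y \<bullet> (Q *v y)"
    using continuous_attains_inf[OF compact_sphere ne cont] by auto
  have "(v \<bullet> (Q *v v)) * (norm x)\<^sup>2 \<le> x \<bullet> (Q *v x)" for x
  proof (cases "x = 0")
    case False
    have "v \<bullet> (Q *v v) \<le> (x /\<^sub>R norm x) \<bullet> (Q *v (x /\<^sub>R norm x))" using False by (intro v) simp
    also have "\<dots> = (x \<bullet> (Q *v x)) / (norm x)\<^sup>2"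
      by (simp add: matrix_vector_mult_scaleR power2_eq_square divide_inverse)
    finally show ?thesis using False by (simp add: field_simps)
  qed simp
  moreover have "v \<bullet> (Q *v v) > 0" using assms v(1) unfolding pos_def_def by (metis norm_zero zero_neq_one)
  ultimately show ?thesis by blast
qed

lemma quadratic_form_perturbation:
  fixes Q Q0 :: "real^'n^'n"
  assumes "c * (norm x)\<^sup>2 \<le> x \<bullet> (Q0 *v x)" and "norm (Q - Q0) \<le> d"
  shows "(c - d) * (norm x)\<^sup>2 \<le> x \<bullet> (Q *v x)"
proof -
  have "\<bar>x \<bullet> ((Q - Q0) *v x)\<bar> \<le> norm x * (d * norm x)"
    by (intro order_trans[OF Cauchy_Schwarz_ineq2] mult_left_mono
        order_trans[OF norm_matrix_vector_mult_le mult_right_mono[OF assms(2)]]) simp_all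
  then have "- (d * (norm x)\<^sup>2) \<le> x \<bullet> (Q *v x) - x \<bullet> (Q0 *v x)"
    by (simp add: matrix_vector_mult_diff_rdistrib inner_diff_right power2_eq_square mult_ac abs_le_iff)
  then show ?thesis using assms(1) by (simp add: left_diff_distrib)
qed

lemma lq_bounds_mono:
  assumes "lq_bounds \<kappa> A B G Q S P" "\<kappa> \<le> \<kappa>'"
  shows "lq_bounds \<kappa>' A B G Q S P"
proof -
  interpret lq_bounds \<kappa> A B G Q S P by fact
  have k: "0 < \<kappa>" using kappa by simp
  have n: "\<kappa> * norm y \<le> \<kappa>' * norm y" for y :: "real^'e"
    using assms(2) by (intro mult_right_mono) auto
  have q: "\<kappa> * r \<le> \<kappa>' * r" if "0 \<le> \<kappa> * r" for r
    using assms(2) that k by (intro mult_right_mono) (auto simp: zero_le_mult_iff)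
  show ?thesis
  proof
    show "1 \<le> \<kappa>'" using kappa assms(2) by simp
    fix x
    show "norm (A *v x) \<le> \<kappa>' * norm x" by (rule order_trans[OF A_le n])
    show "norm (transpose A *v x) \<le> \<kappa>' * norm x" by (rule order_trans[OF At_le n])
    show "norm (Q *v x) \<le> \<kappa>' * norm x" by (rule order_trans[OF Q_le n])
    show "norm (S *v x) \<le> \<kappa>' * norm x" by (rule order_trans[OF S_le n])
    show "norm (P *v x) \<le> \<kappa>' * norm x" by (rule order_trans[OF P_le n])
    show "norm (transpose B *v x) \<le> \<kappa>' * norm x" by (rule order_trans[OF Bt_le n])
    show "norm (G *v x) \<le> \<kappa>' * norm (transpose B *v x)" by (rule order_trans[OF G_le n])
    show "(norm x)\<^sup>2 \<le> \<kappa>' * (x \<bullet> (Q *v x))"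
      by (rule order_trans[OF Q_ge q]) (rule order_trans[OF zero_le_power2 Q_ge])
    show "(norm (transpose B *v x))\<^sup>2 \<le> \<kappa>' * (x \<bullet> (G *v x))"
      by (rule order_trans[OF G_ge q]) (rule order_trans[OF zero_le_power2 G_ge])
    show "(transpose A *v x) \<bullet> (P *v (transpose A *v x))
        \<le> x \<bullet> (P *v x) - (norm x)\<^sup>2 + \<kappa>' * (norm (transpose B *v x))\<^sup>2"
      by (rule order_trans[OF P_lyap]) (use assms(2) in \<open>auto intro: mult_right_mono\<close>)
  qed (rule S_nonpos P_sym P_nonneg)+
qed

text \<open>The factor \<open>b\<^sup>2 / c\<close> comes from the lower bound for \<open>G\<close>.
  If \<open>u\<close> is the image of \<open>transpose B *v x\<close> under the inverse of
  \<open>R\<close>, the form of \<open>G\<close> at \<open>x\<close> equals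
  \<open>u \<bullet> (R *v u)\<close>. Coercivity of \<open>R\<close> bounds \<open>u\<close> by
  \<open>R *v u\<close>, so the inverse of \<open>R\<close> is controlled by \<open>c\<close>
  alone.\<close>

lemma lq_bounds_of_norms:
  fixes A Q S P :: "real^'d^'d" and B :: "real^'m^'d" and R :: "real^'m^'m"
  assumes b: "b \<ge> 1" and c: "0 < c" "c \<le> 1"
    and le: "norm A \<le> b" "norm B \<le> b" "norm Q \<le> b" "norm R \<le> b" "norm S \<le> b" "norm P \<le> b"
    and Q: "\<And>x. c * (norm x)\<^sup>2 \<le> x \<bullet> (Q *v x)" and R: "\<And>x. c * (norm x)\<^sup>2 \<le> x \<bullet> (R *v x)"
    and S: "neg_semidef S" and P: "transpose P = P" "nonneg_form P"
    and lyap: "\<And>x. (transpose A *v x) \<bullet> (P *v (transpose A *v x))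
        \<le> x \<bullet> (P *v x) - (norm x)\<^sup>2 + b * (norm (transpose B *v x))\<^sup>2"
  shows "lq_bounds (b\<^sup>2 / c) A B (B ** matrix_inv R ** transpose B) Q S P"
proof -
  let ?G = "B ** matrix_inv R ** transpose B"
  have b2: "b \<le> b\<^sup>2" using b by (simp add: power2_eq_square)
  have bb: "b \<le> b\<^sup>2 / c" "1 / c \<le> b\<^sup>2 / c" "b / c \<le> b\<^sup>2 / c"
  proof -
    have "b * c \<le> b * 1" using b c by (intro mult_left_mono) auto
    then have "b * c \<le> b\<^sup>2" using b2 by simp
    then show "b \<le> b\<^sup>2 / c" using c by (simp add: field_simps)
    show "1 / c \<le> b\<^sup>2 / c" "b / c \<le> b\<^sup>2 / c" using b b2 c by (auto intro!: divide_right_mono)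
  qed
  have n: "b * norm y \<le> (b\<^sup>2 / c) * norm y" for y :: "real^'e"
    using bb by (intro mult_right_mono) auto
  have nm: "norm (M *v y) \<le> (b\<^sup>2 / c) * norm y" if "norm M \<le> b" for M :: "real^'e^'f" and y
    by (rule order_trans[OF norm_matrix_vector_mult_le order_trans[OF _ n]])
      (use that in \<open>auto intro: mult_right_mono\<close>)
  have nt: "norm (transpose M *v y) \<le> (b\<^sup>2 / c) * norm y" if "norm M \<le> b" for M :: "real^'e^'f" and y
    by (rule order_trans[OF norm_transpose_mult_le order_trans[OF _ n]])
      (use that in \<open>auto intro: mult_right_mono\<close>)
  have "inj ((*v) R)"
  proof (rule injI)
    fix x y assume "R *v x = R *v y"
    then have "c * (norm (x - y))\<^sup>2 \<le> 0" using R[of "x - y"] by (simp add: matrix_vector_mult_diff_distrib)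
    then show "x = y" using c by (simp add: mult_le_0_iff)
  qed
  then have "invertible R" by (simp add: invertible_left_inverse matrix_left_invertible_injective)
  then have RR: "R ** matrix_inv R = mat 1"
    unfolding invertible_def matrix_inv_def by (rule someI2_ex) blast
  have G: "norm (?G *v x) \<le> (b\<^sup>2 / c) * norm (transpose B *v x)"
      "(norm (transpose B *v x))\<^sup>2 \<le> (b\<^sup>2 / c) * (x \<bullet> (?G *v x))" for x
  proof -
    define y where "y = transpose B *v x"
    define u where "u = matrix_inv R *v y"
    have Ru: "R *v u = y" by (simp add: u_def matrix_vector_mul_assoc RR)
    have Gx: "?G *v x = B *v u" unfolding u_def y_def by (simp only: matrix_vector_mul_assoc matrix_mul_assoc)
    have xG: "x \<bullet> (?G *v x) = u \<bullet> (R *v u)"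
      unfolding Gx inner_matrix_transpose[of x B] y_def[symmetric] Ru by (rule inner_commute)
    have "c * (norm u * norm u) \<le> u \<bullet> y" using R[of u] by (simp add: Ru power2_eq_square)
    also have "\<dots> \<le> norm u * norm y" by (rule norm_cauchy_schwarz)
    finally have "norm u * (c * norm u) \<le> norm u * norm y" by (simp add: mult_ac)
    then have cu: "c * norm u \<le> norm y" by (cases "u = 0") auto
    have "norm (B *v u) \<le> b * norm u"
      by (rule order_trans[OF norm_matrix_vector_mult_le mult_right_mono[OF le(2)]]) simp
    also have "\<dots> \<le> b * (norm y / c)" using b c cu by (intro mult_left_mono) (auto simp: field_simps)
    also have "\<dots> = (b / c) * norm y" by simp
    also have "\<dots> \<le> (b\<^sup>2 / c) * norm y" using bb by (intro mult_right_mono) auto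
    finally show "norm (?G *v x) \<le> (b\<^sup>2 / c) * norm (transpose B *v x)" by (simp only: Gx y_def)
    have "norm y \<le> b * norm u"
      unfolding Ru[symmetric] by (rule order_trans[OF norm_matrix_vector_mult_le mult_right_mono[OF le(4)]]) simp
    then have "(norm y)\<^sup>2 \<le> b\<^sup>2 * (norm u)\<^sup>2" by (rule norm_sq_le_of_le)
    also have "\<dots> = (b\<^sup>2 / c) * (c * (norm u)\<^sup>2)" using c by simp
    also have "\<dots> \<le> (b\<^sup>2 / c) * (u \<bullet> (R *v u))" using c by (intro mult_left_mono R) auto
    finally show "(norm (transpose B *v x))\<^sup>2 \<le> (b\<^sup>2 / c) * (x \<bullet> (?G *v x))" by (simp only: xG y_def)
  qed
  show ?thesis
  proof
    show "1 \<le> b\<^sup>2 / c" using b bb(1) by linarith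
    fix x
    show "(norm x)\<^sup>2 \<le> (b\<^sup>2 / c) * (x \<bullet> (Q *v x))"
    proof -
      have "(norm x)\<^sup>2 = (1 / c) * (c * (norm x)\<^sup>2)" using c by simp
      also have "\<dots> \<le> (b\<^sup>2 / c) * (x \<bullet> (Q *v x))"
        using bb(2) c by (intro mult_mono Q) auto
      finally show ?thesis .
    qed
    show "(transpose A *v x) \<bullet> (P *v (transpose A *v x))
        \<le> x \<bullet> (P *v x) - (norm x)\<^sup>2 + b\<^sup>2 / c * (norm (transpose B *v x))\<^sup>2"
      by (intro order_trans[OF lyap] add_left_mono mult_right_mono bb(1)) simp
    show "x \<bullet> (S *v x) \<le> 0" using S by (simp add: neg_semidef_def)
    show "0 \<le> x \<bullet> (P *v x)" using P by (simp add: nonneg_form_def)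
  qed (rule nm nt le G P)+
qed

lemma eventually_norm_diff_le:
  fixes f :: "'a \<Rightarrow> 'b::real_normed_vector"
  assumes "(f \<longlongrightarrow> l) F" "0 < d"
  shows "eventually (\<lambda>x. norm (f x - l) \<le> d) F"
  using tendstoD[OF assms] by (rule eventually_mono) (simp add: dist_norm)

text \<open>The form \<open>P0\<close> found at the base datum is kept for all nearby data. The form
  of \<open>N A B\<close> dominates the squared norm at the base datum, and by continuity half of it
  nearby; doubling \<open>P0\<close> and \<open>k\<close> restores the factor 1. The coercivity
  constants of \<open>Q0\<close> and \<open>R0\<close> are halved likewise. Semidefiniteness of
  \<open>S\<close> is not an open condition, so it remains a premise.\<close>

lemma lq_bounds_nearby:
  fixes A0 :: "real^'d^'d" and B0 :: "real^'m^'d" and R0 :: "real^'m^'m"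
  assumes data: "lq_data A0 B0 Q0 R0"
  obtains \<kappa> P where "eventually (\<lambda>(A, B, Q, R, S). neg_semidef S \<longrightarrow>
      lq_bounds \<kappa> A B (B ** matrix_inv R ** transpose B) Q S P) (nhds (A0, B0, Q0, R0, S0))"
proof -
  from data have d: "invertible A0" "stabilizable A0 B0" "pos_def Q0" "pos_def R0" by (auto simp: lq_data_def)
  obtain P0 k where P0: "transpose P0 = P0" "nonneg_form P0" "0 \<le> k"
    "\<And>x. (transpose A0 *v x) \<bullet> (P0 *v (transpose A0 *v x))
        \<le> x \<bullet> (P0 *v x) - (norm x)\<^sup>2 + k * (norm (transpose B0 *v x))\<^sup>2"
    using stabilizable_lyapunov[OF d(1,2)] by metis
  obtain q where q: "q > 0" "\<And>x. q * (norm x)\<^sup>2 \<le> x \<bullet> (Q0 *v x)" using pos_def_coercive[OF d(3)] by blast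
  obtain r where r: "r > 0" "\<And>x. r * (norm x)\<^sup>2 \<le> x \<bullet> (R0 *v x)" using pos_def_coercive[OF d(4)] by blast
  define c where "c = min (min (q / 2) (r / 2)) 1"
  define P where "P = 2 *\<^sub>R P0"
  define b where "b = norm A0 + norm B0 + norm Q0 + norm R0 + norm S0 + norm P + 2 * k + 1"
  define N where "N A B = P0 - A ** P0 ** transpose A + k *\<^sub>R (B ** transpose B)"
    for A :: "real^'d^'d" and B :: "real^'m^'d"
  have N: "x \<bullet> (N A B *v x) = x \<bullet> (P0 *v x) - (transpose A *v x) \<bullet> (P0 *v (transpose A *v x))
      + k * (norm (transpose B *v x))\<^sup>2" for A B x
    by (simp add: N_def matrix_vector_mult_diff_rdistrib matrix_vector_mult_add_rdistrib power2_norm_eq_inner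
        matrix_vector_mul_assoc[symmetric] scaleR_matrix_vector_assoc[symmetric] inner_diff_right inner_add_right inner_matrix_transpose)
  let ?F = "nhds (A0, B0, Q0, R0, S0)"
  let ?A = "\<lambda>z. fst z" and ?B = "\<lambda>z. fst (snd z)" and ?Q = "\<lambda>z. fst (snd (snd z))"
    and ?R = "\<lambda>z. fst (snd (snd (snd z)))" and ?S = "\<lambda>z. snd (snd (snd (snd z)))"
  have id: "((\<lambda>z. z) \<longlongrightarrow> (A0, B0, Q0, R0, S0)) ?F" by (rule filterlim_ident)
  have tA: "(?A \<longlongrightarrow> A0) ?F" and tB: "(?B \<longlongrightarrow> B0) ?F" and tQ: "(?Q \<longlongrightarrow> Q0) ?F"
    and tR: "(?R \<longlongrightarrow> R0) ?F" and tS: "(?S \<longlongrightarrow> S0) ?F"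
    using tendsto_fst[OF id] tendsto_fst[OF tendsto_snd[OF id]] tendsto_fst[OF tendsto_snd[OF tendsto_snd[OF id]]]
      tendsto_fst[OF tendsto_snd[OF tendsto_snd[OF tendsto_snd[OF id]]]]
      tendsto_snd[OF tendsto_snd[OF tendsto_snd[OF tendsto_snd[OF id]]]]
    by simp_all
  have tN: "((\<lambda>z. N (?A z) (?B z)) \<longlongrightarrow> N A0 B0) ?F"
    unfolding N_def by (intro tendsto_intros tendsto_matrix_mult tendsto_transpose tA tB)
  have b1: "b \<ge> 1" unfolding b_def using P0(3) by (simp add: add_nonneg_nonneg)
  have kb: "2 * k \<le> b" unfolding b_def by (simp add: add_nonneg_nonneg)
  have c: "0 < c" "c \<le> 1" "c \<le> q / 2" "c \<le> r / 2" using q r by (auto simp: c_def)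
  have "eventually (\<lambda>z. norm (?A z - A0) \<le> 1 \<and> norm (?B z - B0) \<le> 1 \<and> norm (?Q z - Q0) \<le> min 1 (q/2)
     \<and> norm (?R z - R0) \<le> min 1 (r/2) \<and> norm (?S z - S0) \<le> 1 \<and> norm (N (?A z) (?B z) - N A0 B0) \<le> 1/2) ?F"
    using q r by (intro eventually_conj eventually_norm_diff_le tA tB tQ tR tS tN) auto
  then have "eventually (\<lambda>z. neg_semidef (?S z) \<longrightarrow>
      lq_bounds (b\<^sup>2 / c) (?A z) (?B z) (?B z ** matrix_inv (?R z) ** transpose (?B z)) (?Q z) (?S z) P) ?F"
  proof (rule eventually_mono, intro impI)
    fix z
    assume z: "norm (?A z - A0) \<le> 1 \<and> norm (?B z - B0) \<le> 1 \<and> norm (?Q z - Q0) \<le> min 1 (q/2)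
     \<and> norm (?R z - R0) \<le> min 1 (r/2) \<and> norm (?S z - S0) \<le> 1 \<and> norm (N (?A z) (?B z) - N A0 B0) \<le> 1/2"
      and S: "neg_semidef (?S z)"
    have tri: "norm u \<le> norm u0 + 1" if "norm (u - u0) \<le> 1" for u u0 :: "real^'e^'f"
      using norm_triangle_ineq[of u0 "u - u0"] that by simp
    have nn: "0 \<le> norm A0" "0 \<le> norm B0" "0 \<le> norm Q0" "0 \<le> norm R0" "0 \<le> norm S0" "0 \<le> norm P" by simp_all
    show "lq_bounds (b\<^sup>2 / c) (?A z) (?B z) (?B z ** matrix_inv (?R z) ** transpose (?B z)) (?Q z) (?S z) P"
    proof (rule lq_bounds_of_norms[OF b1 c(1,2)])
      show "norm (?A z) \<le> b" using tri[of "?A z" A0] z nn P0(3) unfolding b_def by linarith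
      show "norm (?B z) \<le> b" using tri[of "?B z" B0] z nn P0(3) unfolding b_def by linarith
      show "norm (?Q z) \<le> b" using tri[of "?Q z" Q0] z nn P0(3) unfolding b_def by linarith
      show "norm (?R z) \<le> b" using tri[of "?R z" R0] z nn P0(3) unfolding b_def by linarith
      show "norm (?S z) \<le> b" using tri[of "?S z" S0] z nn P0(3) unfolding b_def by linarith
      show "norm P \<le> b" using nn P0(3) unfolding b_def by linarith
      show "c * (norm x)\<^sup>2 \<le> x \<bullet> (?Q z *v x)" for x
      proof -
        have "(q - q / 2) * (norm x)\<^sup>2 \<le> x \<bullet> (?Q z *v x)"
          by (rule quadratic_form_perturbation[OF q(2)]) (use z in simp)
        moreover have "c * (norm x)\<^sup>2 \<le> (q - q / 2) * (norm x)\<^sup>2" using c by (intro mult_right_mono) auto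
        ultimately show ?thesis by linarith
      qed
      show "c * (norm x)\<^sup>2 \<le> x \<bullet> (?R z *v x)" for x
      proof -
        have "(r - r / 2) * (norm x)\<^sup>2 \<le> x \<bullet> (?R z *v x)"
          by (rule quadratic_form_perturbation[OF r(2)]) (use z in simp)
        moreover have "c * (norm x)\<^sup>2 \<le> (r - r / 2) * (norm x)\<^sup>2" using c by (intro mult_right_mono) auto
        ultimately show ?thesis by linarith
      qed
      show "neg_semidef (?S z)" by fact
      show "transpose P = P" using P0(1) by (simp add: P_def transpose_def vec_eq_iff)
      have P: "y \<bullet> (P *v y) = 2 * (y \<bullet> (P0 *v y))" for y by (simp add: P_def scaleR_matrix_vector_assoc[symmetric])
      show "nonneg_form P" using P0(2) by (simp add: nonneg_form_def P)
      fix x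
      have N0: "1 * (norm x)\<^sup>2 \<le> x \<bullet> (N A0 B0 *v x)" using P0(4)[of x] unfolding N by linarith
      have "(1 - 1/2) * (norm x)\<^sup>2 \<le> x \<bullet> (N (?A z) (?B z) *v x)"
        by (rule quadratic_form_perturbation[OF N0]) (use z in simp)
      then have "(transpose (?A z) *v x) \<bullet> (P *v (transpose (?A z) *v x))
        \<le> x \<bullet> (P *v x) - (norm x)\<^sup>2 + (2 * k) * (norm (transpose (?B z) *v x))\<^sup>2"
        unfolding N P by simp
      also have "\<dots> \<le> x \<bullet> (P *v x) - (norm x)\<^sup>2 + b * (norm (transpose (?B z) *v x))\<^sup>2"
        using kb by (intro add_left_mono mult_right_mono) auto
      finally show "(transpose (?A z) *v x) \<bullet> (P *v (transpose (?A z) *v x))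
        \<le> x \<bullet> (P *v x) - (norm x)\<^sup>2 + b * (norm (transpose (?B z) *v x))\<^sup>2" .
    qed
  qed
  then show thesis using that by (simp add: case_prod_unfold)
qed

theorem lq_bounds_compact:
  fixes K :: "((real^'d^'d) \<times> (real^'m^'d) \<times> (real^'d^'d) \<times> (real^'m^'m) \<times> (real^'d^'d)) set"
  assumes K: "compact K" "K \<subseteq> data_class"
  obtains \<kappa> where "\<kappa> \<ge> 1" "\<And>A B Q R S. (A, B, Q, R, S) \<in> K \<Longrightarrow>
      \<exists>P. lq_bounds \<kappa> A B (B ** matrix_inv R ** transpose B) Q S P"
proof -
  define g where "g \<kappa> z \<longleftrightarrow> (case z of (A, B, Q, R, S) \<Rightarrow>
      \<exists>P. lq_bounds \<kappa> A B (B ** matrix_inv R ** transpose B) Q S P)"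
    for \<kappa> and z :: "(real^'d^'d) \<times> (real^'m^'d) \<times> (real^'d^'d) \<times> (real^'m^'m) \<times> (real^'d^'d)"
  have "\<exists>U \<kappa>. open U \<and> z \<in> U \<and> (\<forall>y\<in>U \<inter> K. g \<kappa> y)" if z: "z \<in> K" for z
  proof -
    obtain A0 B0 Q0 R0 S0 where z0: "z = (A0, B0, Q0, R0, S0)" by (cases z) auto
    then have "lq_data A0 B0 Q0 R0" using z K(2) by (auto simp: data_class_def)
    then obtain \<kappa> P where "eventually (\<lambda>(A, B, Q, R, S). neg_semidef S \<longrightarrow>
      lq_bounds \<kappa> A B (B ** matrix_inv R ** transpose B) Q S P) (nhds (A0, B0, Q0, R0, S0))"
      using lq_bounds_nearby by blast
    then obtain U where "open U" "z \<in> U" and U: "\<forall>y\<in>U. (case y of (A, B, Q, R, S) \<Rightarrow>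
       neg_semidef S \<longrightarrow> lq_bounds \<kappa> A B (B ** matrix_inv R ** transpose B) Q S P)"
      unfolding eventually_nhds z0 by (elim exE conjE)
    moreover have "g \<kappa> y" if y: "y \<in> U" "y \<in> K" for y
    proof -
      have "y \<in> data_class" using y(2) K(2) by (rule subsetD[rotated])
      then show ?thesis using bspec[OF U y(1)] by (auto simp: g_def data_class_def)
    qed
    ultimately show ?thesis by (intro exI[of _ U] exI[of _ \<kappa>]) simp
  qed
  then have "\<forall>z\<in>K. \<exists>p. open (fst p) \<and> z \<in> fst p \<and> (\<forall>y\<in>fst p \<inter> K. g (snd p) y)" by simp
  from bchoice[OF this] obtain p where Uk: "\<And>z. z \<in> K \<Longrightarrow> open (fst (p z))" "\<And>z. z \<in> K \<Longrightarrow> z \<in> fst (p z)"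
      "\<And>z y. z \<in> K \<Longrightarrow> y \<in> fst (p z) \<Longrightarrow> y \<in> K \<Longrightarrow> g (snd (p z)) y"
    by auto
  define U where "U z = fst (p z)" for z
  define k where "k z = snd (p z)" for z
  note Uk = Uk[folded U_def k_def]
  obtain C where C: "C \<subseteq> K" "finite C" "K \<subseteq> (\<Union>z\<in>C. U z)"
    by (rule compactE_image[OF K(1), of K U]) (use Uk in auto)
  \<comment> \<open>The inserted 1 keeps the maximum defined for an empty cover and gives
    \<open>\<kappa> \<ge> 1\<close>. Only \<open>\<kappa>\<close> becomes common to all data;
    \<open>P\<close> may still vary.\<close>
  define \<kappa> where "\<kappa> = Max (insert 1 (k ` C))"
  have "g \<kappa> y" if y: "y \<in> K" for y
  proof -
    obtain z where z: "z \<in> C" "y \<in> U z" using C(3) y by blast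
    then have "g (k z) y" using C(1) by (intro Uk(3) y) auto
    moreover have "k z \<le> \<kappa>" unfolding \<kappa>_def using C(2) z by (intro Max_ge) auto
    ultimately show ?thesis unfolding g_def by (auto intro: lq_bounds_mono)
  qed
  moreover have "\<kappa> \<ge> 1" unfolding \<kappa>_def using C(2) by (intro Max_ge) auto
  ultimately show thesis by (intro that) (auto simp: g_def)
qed

section \<open>The Green property\<close>

definition upper :: "'a^('p::finite + 'q::finite) \<Rightarrow> 'a^'p" where "upper h = (\<chi> k. h $ Inl k)"
definition lower :: "'a^('p::finite + 'q::finite) \<Rightarrow> 'a^'q" where "lower h = (\<chi> k. h $ Inr k)"

lemma upper_lower_block_col [simp]: "upper (block_col x y) = x" "lower (block_col x y) = y"
  by (simp_all add: vec_eq_iff upper_def lower_def block_col_def)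

lemma block_col_eq_iff: "block_col x y = h \<longleftrightarrow> x = upper h \<and> y = lower h"
  by (auto simp: vec_eq_iff upper_def lower_def block_col_def split: sum.split)

lemma upper_lower_linear:
  fixes u v :: "real^('p::finite + 'q::finite)"
  shows "upper (u + v) = upper u + upper v" "upper (u - v) = upper u - upper v" "upper (c *\<^sub>R u) = c *\<^sub>R upper u"
    "lower (u + v) = lower u + lower v" "lower (u - v) = lower u - lower v" "lower (c *\<^sub>R u) = c *\<^sub>R lower u"
    "upper 0 = (0 :: real^'p)" "lower 0 = (0 :: real^'q)"
  by (simp_all add: vec_eq_iff upper_def lower_def)

lemma sum_UNIV_Plus:
  fixes g :: "'p::finite + 'q::finite \<Rightarrow> 'b::comm_monoid_add"
  shows "sum g UNIV = (\<Sum>k\<in>UNIV. g (Inl k)) + (\<Sum>k\<in>UNIV. g (Inr k))"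
  unfolding UNIV_Plus_UNIV[symmetric] by (subst sum.Plus) auto

lemma norm_upper_lower: "(norm h)\<^sup>2 = (norm (upper h))\<^sup>2 + (norm (lower h))\<^sup>2"
  for h :: "real^('p::finite + 'q::finite)"
  by (simp add: power2_norm_eq_inner inner_vec_def sum_UNIV_Plus upper_def lower_def)

lemma norm_upper_le: "norm (upper h) \<le> norm h" and norm_lower_le: "norm (lower h) \<le> norm h"
  for h :: "real^('p::finite + 'q::finite)"
  using norm_upper_lower[of h] by (simp_all add: power2_le_imp_le)

lemma block_col_mult_vec: "block_col X Y *v z = block_col (X *v z) (Y *v z)"
  for X :: "real^'n^'p" and Y :: "real^'n^'q"
  by (simp add: vec_eq_iff block_col_def matrix_vector_mult_def split: sum.split)

lemma block_row_mult_vec: "block_row X Y *v h = X *v upper h + Y *v lower h"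
  for X :: "real^'p^'n" and Y :: "real^'q^'n"
  by (simp add: vec_eq_iff block_row_def block_col_def matrix_vector_mult_def sum_UNIV_Plus upper_def lower_def)

lemma block_matrix_mult_vec:
  fixes X :: "real^'p^'m" and Y :: "real^'q^'m" and Z :: "real^'p^'n" and W :: "real^'q^'n"
  shows "block_matrix X Y Z W *v h = block_col (X *v upper h + Y *v lower h) (Z *v upper h + W *v lower h)"
  by (simp add: block_matrix_def block_col_mult_vec block_row_mult_vec)

text \<open>The inverse transpose of \<open>A\<close> acts on one expression,
  \<open>Q *v upper h + lower h\<close>, shared by both rows. The lower row is solved for
  \<open>lower h\<close>, and in the upper row the expression is replaced through
  \<open>lower h' - lower f\<close>; hence the correction \<open>- G *v lower f\<close> in the
  source.\<close>

lemma lq_step: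
  fixes A :: "real^'d^'d" and B :: "real^'m^'d"
  assumes inv: "invertible A" and h': "h' = lq_matrix A B Q R *v h + f"
  defines "G \<equiv> B ** matrix_inv R ** transpose B"
  shows "upper h' = A *v upper h + G *v lower h' + (upper f - G *v lower f)"
    and "lower h = transpose A *v lower h' - Q *v upper h + - (transpose A *v lower f)"
proof -
  define A' where "A' = transpose (matrix_inv A)"
  have "A ** matrix_inv A = mat 1 \<and> matrix_inv A ** A = mat 1"
    using inv unfolding invertible_def matrix_inv_def by (rule someI_ex)
  then have AA': "transpose A ** A' = mat 1"
    unfolding A'_def by (metis matrix_transpose_mul transpose_mat)
  have M: "lq_matrix A B Q R *v h = block_col (A *v upper h + G *v (A' *v (Q *v upper h + lower h)))
      (A' *v (Q *v upper h + lower h))"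
    unfolding lq_matrix_def Let_def block_matrix_mult_vec A'_def[symmetric] G_def[symmetric]
    by (simp add: matrix_vector_mult_add_rdistrib matrix_vector_right_distrib matrix_vector_mul_assoc matrix_mul_assoc add_ac)
  have low: "lower h' = A' *v (Q *v upper h + lower h) + lower f"
    unfolding h' M by (simp add: upper_lower_linear)
  show "upper h' = A *v upper h + G *v lower h' + (upper f - G *v lower f)"
    unfolding low unfolding h' M by (simp add: upper_lower_linear matrix_vector_right_distrib)
  have "transpose A *v lower h' = (transpose A ** A') *v (Q *v upper h + lower h) + transpose A *v lower f"
    unfolding low by (simp only: matrix_vector_right_distrib matrix_vector_mul_assoc matrix_mul_assoc)
  then show "lower h = transpose A *v lower h' - Q *v upper h + - (transpose A *v lower f)"
    unfolding AA' matrix_vector_mul_lid by simp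
qed

text \<open>With \<open>h' = 0\<close> the implicit equations reduce to
  \<open>A *v upper h = 0\<close> and \<open>lower h = - (Q *v upper h)\<close>, so the kernel is
  trivial.\<close>

lemma lq_matrix_invertible:
  fixes A :: "real^'d^'d" and B :: "real^'m^'d"
  assumes "invertible A"
  shows "\<exists>N. N ** lq_matrix A B Q R = mat 1 \<and> lq_matrix A B Q R ** N = mat 1"
proof -
  let ?M = "lq_matrix A B Q R"
  have "h = 0" if "?M *v h = 0" for h
  proof -
    have s: "0 = ?M *v h + 0" using that by simp
    have l: "lower h = - (Q *v upper h)" using lq_step(2)[OF assms s] by (simp add: upper_lower_linear)
    have "A *v upper h = 0" using lq_step(1)[OF assms s] by (simp add: upper_lower_linear)
    then have "upper h = 0" using assms by (metis invertible_eq_bij bij_is_inj matrix_vector_mult_0_right injD)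
    with l have "(norm h)\<^sup>2 = 0" unfolding norm_upper_lower by simp
    then show ?thesis by simp
  qed
  then obtain N where "N ** ?M = mat 1" using matrix_left_invertible_ker[of ?M] by blast
  then show ?thesis using matrix_left_right_inverse by blast
qed

text \<open>Chosen so that \<open>exp \<gamma> - 1 = 1 / (400 * \<kappa>^9)\<close>. The square of
  this times \<open>\<kappa>^18\<close> is 1/160000, below the admissible 1/96000.\<close>

definition green_rate :: "real \<Rightarrow> real" where "green_rate \<kappa> = ln (1 + 1 / (400 * \<kappa>^9))"

lemma green_rate:
  assumes "\<kappa> \<ge> 1"
  shows "0 < green_rate \<kappa>" "exp (green_rate \<kappa>) \<le> 2" "96000 * (exp (green_rate \<kappa>) - 1)\<^sup>2 * \<kappa>^18 \<le> 1"
proof -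
  have k: "\<kappa>^9 \<ge> 1" using assms by simp
  have pos: "0 < 1 + 1 / (400 * \<kappa>^9)" using assms by (simp add: add_pos_pos)
  have e: "exp (green_rate \<kappa>) = 1 + 1 / (400 * \<kappa>^9)" unfolding green_rate_def by (rule exp_ln[OF pos])
  show "0 < green_rate \<kappa>" unfolding green_rate_def using assms by (intro ln_gt_zero) simp
  have "1 \<le> 400 * \<kappa>^9" using k by linarith
  then have "1 / (400 * \<kappa>^9) \<le> 1" using assms by simp
  then show "exp (green_rate \<kappa>) \<le> 2" unfolding e by simp
  have "(exp (green_rate \<kappa>) - 1)\<^sup>2 * \<kappa>^18 = 1 / 160000"
    using assms by (simp add: e power_divide power_mult_distrib flip: power_mult)
  then show "96000 * (exp (green_rate \<kappa>) - 1)\<^sup>2 * \<kappa>^18 \<le> 1" by (simp only: mult.assoc)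
qed

text \<open>In implicit form a source \<open>f\<close> becomes a pair of total size at most
  \<open>3 * \<kappa>\<^sup>2 * norm (f s)\<close>, where \<open>G *v lower f\<close> costs one
  factor \<open>\<kappa>\<close> for \<open>G_le\<close> and one for \<open>Bt_le\<close>. This
  turns \<open>2000 * \<kappa>^9\<close> into \<open>6000 * \<kappa>^11\<close>.\<close>

lemma lq_green_euclidean:
  fixes A :: "real^'d^'d" and B :: "real^'m^'d"
  assumes inv: "invertible A" and bounds: "lq_bounds \<kappa> A B (B ** matrix_inv R ** transpose B) Q S P"
    and T: "T \<ge> 1" and h: "\<And>t. t < T \<Longrightarrow> h (Suc t) = lq_matrix A B Q R *v h t + f t" and t: "t \<le> T"
  defines "\<gamma> \<equiv> green_rate \<kappa>"
  shows "norm (h t) \<le> 6000 * \<kappa>^11 * (exp (- \<gamma> * real t) * norm (upper (h 0))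
     + exp (- \<gamma> * (real T - real t)) * norm (lower (h T) - S *v upper (h T))
     + (\<Sum>s<T. exp (- \<gamma> * \<bar>real t - real s\<bar>) * norm (f s)))"
proof -
  let ?G = "B ** matrix_inv R ** transpose B"
  interpret lq_bounds \<kappa> A B ?G Q S P by fact
  define a where "a s = upper (f s) - ?G *v lower (f s)" for s
  define b where "b s = - (transpose A *v lower (f s))" for s
  let ?\<alpha> = "exp (- \<gamma> * real t) * norm (upper (h 0))"
  let ?\<beta> = "exp (- \<gamma> * (real T - real t)) * norm (lower (h T) - S *v upper (h T))"
  let ?w = "\<lambda>s. exp (- \<gamma> * \<bar>real t - real s\<bar>)"
  have k2: "\<kappa>\<^sup>2 \<ge> 1" "\<kappa> \<le> \<kappa>\<^sup>2" using kappa one_le_power[OF kappa, of 2] by (simp, simp add: power2_eq_square)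
  have ab: "norm (a s) + norm (b s) \<le> 3 * \<kappa>\<^sup>2 * norm (f s)" for s
  proof -
    have "norm (?G *v lower (f s)) \<le> \<kappa> * (\<kappa> * norm (lower (f s)))"
      using kappa by (intro order_trans[OF G_le] mult_left_mono Bt_le) simp
    also have "\<dots> \<le> \<kappa>\<^sup>2 * norm (f s)"
      unfolding power2_eq_square mult.assoc using kappa by (intro mult_left_mono norm_lower_le) auto
    finally have 1: "norm (?G *v lower (f s)) \<le> \<kappa>\<^sup>2 * norm (f s)" .
    have "norm (b s) \<le> \<kappa> * norm (lower (f s))" unfolding b_def norm_minus_cancel by (rule At_le)
    also have "\<dots> \<le> \<kappa>\<^sup>2 * norm (f s)" using kappa k2 by (intro mult_mono norm_lower_le) auto
    finally have 2: "norm (b s) \<le> \<kappa>\<^sup>2 * norm (f s)" .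
    have "norm (upper (f s)) \<le> 1 * norm (f s)" using norm_upper_le by simp
    also have "\<dots> \<le> \<kappa>\<^sup>2 * norm (f s)" using k2 by (intro mult_right_mono) auto
    finally have "norm (upper (f s)) \<le> \<kappa>\<^sup>2 * norm (f s)" .
    then show ?thesis using 1 2 norm_triangle_ineq4[of "upper (f s)" "?G *v lower (f s)"]
      unfolding a_def by linarith
  qed
  have "norm (h t) = sqrt ((norm (upper (h t)))\<^sup>2 + (norm (lower (h t)))\<^sup>2)"
    unfolding norm_upper_lower[symmetric] by simp
  also have "\<dots> \<le> 2000 * \<kappa>^9 * (?\<alpha> + ?\<beta> + (\<Sum>s<T. ?w s * (norm (a s) + norm (b s))))"
    by (rule green_estimate[OF T _ _ _ _ _ t, where x = "\<lambda>t. upper (h t)" and p = "\<lambda>t. lower (h t)"])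
      (use lq_step[OF inv h] green_rate[OF kappa] in \<open>simp_all add: a_def b_def \<gamma>_def\<close>)
  also have "\<dots> \<le> 2000 * \<kappa>^9 * (3 * \<kappa>\<^sup>2 * (?\<alpha> + ?\<beta> + (\<Sum>s<T. ?w s * norm (f s))))"
  proof (rule mult_left_mono)
    have "(\<Sum>s<T. ?w s * (norm (a s) + norm (b s))) \<le> (\<Sum>s<T. ?w s * (3 * \<kappa>\<^sup>2 * norm (f s)))"
      by (intro sum_mono mult_left_mono ab) simp
    also have "\<dots> = 3 * \<kappa>\<^sup>2 * (\<Sum>s<T. ?w s * norm (f s))"
      by (simp add: sum_distrib_left mult_ac)
    finally have 1: "(\<Sum>s<T. ?w s * (norm (a s) + norm (b s))) \<le> 3 * \<kappa>\<^sup>2 * (\<Sum>s<T. ?w s * norm (f s))" .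
    have "1 * (?\<alpha> + ?\<beta>) \<le> 3 * \<kappa>\<^sup>2 * (?\<alpha> + ?\<beta>)" using k2 by (intro mult_right_mono) auto
    then show "?\<alpha> + ?\<beta> + (\<Sum>s<T. ?w s * (norm (a s) + norm (b s)))
        \<le> 3 * \<kappa>\<^sup>2 * (?\<alpha> + ?\<beta> + (\<Sum>s<T. ?w s * norm (f s)))"
      using add_mono[OF _ 1, of "1 * (?\<alpha> + ?\<beta>)" "3 * \<kappa>\<^sup>2 * (?\<alpha> + ?\<beta>)"]
      unfolding distrib_left[of _ "?\<alpha> + ?\<beta>"] mult_1 by blast
    show "0 \<le> 2000 * \<kappa>^9" using kappa by simp
  qed
  also have "\<dots> = 6000 * \<kappa>^11 * (?\<alpha> + ?\<beta> + (\<Sum>s<T. ?w s * norm (f s)))"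
    by (simp add: eval_nat_numeral)
  finally show ?thesis .
qed

lemma lq_boundary:
  "block_matrix (mat 1) 0 0 0 *v h0 + block_matrix 0 0 (- S) (mat 1) *v hT
    = block_col (upper h0) (lower hT - S *v upper hT)"
  for S :: "real^'d^'d"
proof -
  have "(- S) *v x = - (S *v x)" for x by (simp add: vec_eq_iff matrix_vector_mult_def sum_negf)
  then show ?thesis
    unfolding block_matrix_mult_vec
    by (simp add: vec_eq_iff block_col_def split: sum.split)
qed

text \<open>Shooting: \<open>\<phi>\<close> sends an initial value to the boundary datum of its
  homogeneous orbit. Uniqueness makes it injective, hence onto in finite dimension. The particular
  solution \<open>y\<close> starts at 0, so it shifts the boundary datum only through its value at
  \<open>T\<close>.\<close>

lemma bvp_exists:
  fixes M B0 BT :: "real^'n^'n"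
  assumes uniq: "\<And>h. (\<And>t. t < T \<Longrightarrow> h (Suc t) = M *v h t) \<Longrightarrow> B0 *v h 0 + BT *v h T = 0 \<Longrightarrow> h 0 = 0"
  shows "\<exists>h. (\<forall>t<T. h (Suc t) = M *v h t + f t) \<and> B0 *v h 0 + BT *v h T = b"
proof -
  define \<phi> where "\<phi> v = B0 *v v + BT *v (((*v) M ^^ T) v)" for v
  have lin: "linear \<phi>"
    unfolding \<phi>_def by (intro linearI)
      (simp_all add: matrix_vector_right_distrib funpow_matrix_linear scalar_mult_eq_scaleR[symmetric]
        vector_scalar_commute vec.scale_right_distrib)
  have "v = 0" if "\<phi> v = 0" for v
    using uniq[of "\<lambda>t. ((*v) M ^^ t) v"] that by (simp add: \<phi>_def)
  then have "inj \<phi>" using linear_injective_0[OF lin] by blast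
  then have "surj \<phi>" using lin linear_injective_imp_surjective by blast
  define y where "y = rec_nat 0 (\<lambda>t v. M *v v + f t)"
  obtain v where v: "\<phi> v = b - BT *v y T" using \<open>surj \<phi>\<close> by (metis surjD)
  define h where "h t = ((*v) M ^^ t) v + y t" for t
  have "h (Suc t) = M *v h t + f t" for t
    by (simp add: h_def y_def matrix_vector_right_distrib)
  moreover have "B0 *v h 0 + BT *v h T = b"
    using v by (simp add: h_def \<phi>_def y_def matrix_vector_right_distrib algebra_simps)
  ultimately show ?thesis by blast
qed

lemma is_norm_equivalent:
  fixes \<nu> :: "'a::euclidean_space \<Rightarrow> real"
  assumes "is_norm \<nu>"
  obtains m where "m \<ge> 1" "\<And>x. \<nu> x \<le> m * norm x" "\<And>x. norm x \<le> m * \<nu> x"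
proof -
  from assms have nn: "\<And>x. \<nu> x \<ge> 0" and z: "\<And>x. \<nu> x = 0 \<longleftrightarrow> x = 0"
    and sc: "\<And>c x. \<nu> (c *\<^sub>R x) = \<bar>c\<bar> * \<nu> x" and tri: "\<And>x y. \<nu> (x + y) \<le> \<nu> x + \<nu> y"
    unfolding is_norm_def by blast+
  have \<nu>0: "\<nu> 0 = 0" using z by blast
  define L where "L = (\<Sum>i\<in>Basis. \<nu> i)"
  have L0: "L \<ge> 0" unfolding L_def by (intro sum_nonneg nn)
  have sum_le: "\<nu> (\<Sum>i\<in>I. g i) \<le> (\<Sum>i\<in>I. \<nu> (g i))" if "finite I" for I :: "'a set" and g :: "'a \<Rightarrow> 'a"
    using that
  proof (induction I rule: finite_induct)
    case (insert i I)
    then show ?case using tri[of "g i" "\<Sum>i\<in>I. g i"] by simp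
  qed (simp add: \<nu>0)
  have up: "\<nu> x \<le> L * norm x" for x
  proof -
    have "\<nu> x = \<nu> (\<Sum>i\<in>Basis. (x \<bullet> i) *\<^sub>R i)" by (simp add: euclidean_representation)
    also have "\<dots> \<le> (\<Sum>i\<in>Basis. \<nu> ((x \<bullet> i) *\<^sub>R i))" by (rule sum_le) simp
    also have "\<dots> \<le> (\<Sum>i\<in>Basis. norm x * \<nu> i)"
      unfolding sc by (intro sum_mono mult_right_mono nn) (simp add: Basis_le_norm)
    finally show ?thesis by (simp add: L_def sum_distrib_left mult.commute)
  qed
  have lip: "\<bar>\<nu> x - \<nu> y\<bar> \<le> L * norm (x - y)" for x y
    using tri[of y "x - y"] tri[of x "y - x"] up[of "x - y"] up[of "y - x"]
    by (simp add: norm_minus_commute abs_le_iff)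
  have cont: "continuous_on (sphere 0 1) \<nu>"
    unfolding continuous_on_iff
  proof (intro ballI allI impI)
    fix x :: 'a and e :: real assume e: "e > 0"
    have "dist (\<nu> y) (\<nu> x) < e" if "dist y x < e / (L + 1)" for y
    proof -
      have "\<bar>\<nu> y - \<nu> x\<bar> \<le> L * norm (y - x)" by (rule lip)
      also have "\<dots> \<le> (L + 1) * norm (y - x)" by (intro mult_right_mono) auto
      also have "\<dots> < e" using that L0 by (simp add: dist_norm field_simps)
      finally show ?thesis by (simp add: dist_real_def)
    qed
    then show "\<exists>d>0. \<forall>y\<in>sphere 0 1. dist y x < d \<longrightarrow> dist (\<nu> y) (\<nu> x) < e"
      using e L0 by (intro exI[of _ "e / (L + 1)"]) auto
  qed
  have ne: "sphere 0 1 \<noteq> ({} :: 'a set)"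
  proof -
    obtain v :: 'a where "norm v = 1" using vector_choose_size[of 1] by auto
    then show ?thesis by auto
  qed
  obtain v where v: "norm v = 1" "\<And>y. norm y = 1 \<Longrightarrow> \<nu> v \<le> \<nu> y"
    using continuous_attains_inf[OF compact_sphere ne cont] by auto
  have vpos: "\<nu> v > 0" using v(1) z[of v] nn[of v] by (auto simp: less_le)
  have low: "\<nu> v * norm x \<le> \<nu> x" for x
  proof (cases "x = 0")
    case False
    then have "\<nu> v \<le> \<nu> (x /\<^sub>R norm x)" by (intro v) simp
    then show ?thesis using False by (simp add: sc field_simps)
  qed (simp add: nn)
  define m where "m = max 1 (max L (1 / \<nu> v))"
  show thesis
  proof (rule that[of m])
    show "m \<ge> 1" by (simp add: m_def)
    show "\<nu> x \<le> m * norm x" for x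
      by (rule order_trans[OF up]) (auto simp: m_def intro!: mult_right_mono)
    show "norm x \<le> m * \<nu> x" for x
    proof -
      have "norm x \<le> (1 / \<nu> v) * \<nu> x" using low[of x] vpos by (simp add: field_simps)
      also have "\<dots> \<le> m * \<nu> x" by (intro mult_right_mono nn) (simp add: m_def)
      finally show ?thesis .
    qed
  qed
qed

text \<open>The constants are fixed before the data and depend on \<open>\<nu>\<close> and
  \<open>\<kappa>\<close> alone; this order of quantifiers is what gives uniformity on compact
  sets.\<close>

theorem lq_green_of_bounds:
  fixes \<nu> :: "real^('d::finite + 'd) \<Rightarrow> real"
  assumes \<nu>: "is_norm \<nu>" and k: "\<kappa> \<ge> 1"
  obtains C \<gamma> where "\<And>(A :: real^'d^'d) (B :: real^'m^'d) Q R S P. invertible A \<Longrightarrow>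
      lq_bounds \<kappa> A B (B ** matrix_inv R ** transpose B) Q S P \<Longrightarrow> lq_green \<nu> A B Q R S C \<gamma> 1"
proof -
  obtain m where m: "m \<ge> 1" "\<And>x. \<nu> x \<le> m * norm x" "\<And>x. norm x \<le> m * \<nu> x"
    using is_norm_equivalent[OF \<nu>] by metis
  define \<gamma> where "\<gamma> = green_rate \<kappa>"
  define C where "C = 6000 * \<kappa>^11 * m\<^sup>2"
  have \<nu>0: "\<nu> x \<ge> 0" for x using \<nu> by (simp add: is_norm_def)
  have "lq_green \<nu> A B Q R S C \<gamma> 1"
    if inv: "invertible A" and bounds: "lq_bounds \<kappa> A B (B ** matrix_inv R ** transpose B) Q S P"
    for A :: "real^'d^'d" and B :: "real^'m^'d" and Q R S P
  proof -
    let ?M = "lq_matrix A B Q R"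
    let ?B0 = "block_matrix (mat 1) 0 0 0 :: real^('d+'d)^('d+'d)"
    let ?BT = "block_matrix 0 0 (- S) (mat 1)"
    let ?L = "\<lambda>(h, h'). h' - ?M *v h"
    have sol: "bvp_solution ?L ?B0 ?BT T f b h \<longleftrightarrow>
        (\<forall>t<T. h (Suc t) = ?M *v h t + f t) \<and> block_col (upper (h 0)) (lower (h T) - S *v upper (h T)) = b"
      for T f b h
      unfolding bvp_solution_def lq_boundary by (simp add: diff_eq_eq add.commute)
    have est: "norm (h t) \<le> 6000 * \<kappa>^11 * ((exp (- \<gamma> * real t) + exp (- \<gamma> * (real T - real t))) * norm b
       + (\<Sum>s<T. exp (- \<gamma> * \<bar>real t - real s\<bar>) * norm (f s)))"
      if s: "bvp_solution ?L ?B0 ?BT T f b h" and T: "T \<ge> 1" and t: "t \<le> T" for T f b h t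
    proof -
      have b: "upper (h 0) = upper b" "lower (h T) - S *v upper (h T) = lower b"
        using s unfolding sol block_col_eq_iff by auto
      have "norm (h t) \<le> 6000 * \<kappa>^11 * (exp (- \<gamma> * real t) * norm (upper b)
         + exp (- \<gamma> * (real T - real t)) * norm (lower b)
         + (\<Sum>s<T. exp (- \<gamma> * \<bar>real t - real s\<bar>) * norm (f s)))"
        using lq_green_euclidean[OF inv bounds T _ t, of h f] s unfolding sol b \<gamma>_def by blast
      also have "\<dots> \<le> 6000 * \<kappa>^11 * (exp (- \<gamma> * real t) * norm b
         + exp (- \<gamma> * (real T - real t)) * norm b
         + (\<Sum>s<T. exp (- \<gamma> * \<bar>real t - real s\<bar>) * norm (f s)))"
        using k by (intro mult_left_mono add_mono norm_upper_le norm_lower_le) auto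
      finally show ?thesis by (simp only: distrib_right)
    qed
    \<comment> \<open>The a priori estimate with zero data does double duty: applied to differences
      it gives uniqueness, and through shooting it gives existence.\<close>
    have zero: "h t = 0" if "bvp_solution ?L ?B0 ?BT T (\<lambda>_. 0) 0 h" "T \<ge> 1" "t \<le> T" for T h t
      using est[OF that] by simp
    show ?thesis
      unfolding lq_green_def uniform_green_def
    proof (intro conjI allI impI)
      show "linear ?L"
        by (rule linearI) (auto simp: matrix_vector_right_distrib matrix_vector_mult_scaleR algebra_simps)
      have "1 * 1 \<le> (6000 * \<kappa>^11) * m\<^sup>2"
        using one_le_power[OF k, of 11] one_le_power[OF m(1), of 2] by (intro mult_mono) linarith+
      then show "C \<ge> 1" by (simp add: C_def)
      show "\<gamma> > 0" unfolding \<gamma>_def by (rule green_rate(1)[OF k])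
      show "(1::nat) \<le> 1" by simp
      fix T :: nat and f b assume T: "1 \<le> T"
      have "\<exists>h. (\<forall>t<T. h (Suc t) = ?M *v h t + f t) \<and> ?B0 *v h 0 + ?BT *v h T = b"
      proof (rule bvp_exists)
        fix h assume "\<And>t. t < T \<Longrightarrow> h (Suc t) = ?M *v h t" "?B0 *v h 0 + ?BT *v h T = 0"
        then have "bvp_solution ?L ?B0 ?BT T (\<lambda>_. 0) 0 h" by (simp add: bvp_solution_def)
        then show "h 0 = 0" using zero T by blast
      qed
      then obtain h where h: "bvp_solution ?L ?B0 ?BT T f b h"
        unfolding sol lq_boundary by blast
      show "\<exists>h. bvp_solution ?L ?B0 ?BT T f b h \<and>
          (\<forall>h'. bvp_solution ?L ?B0 ?BT T f b h' \<longrightarrow> (\<forall>t\<le>T. h' t = h t)) \<and>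
          (\<forall>t\<le>T. \<nu> (h t) \<le> C * ((exp (- \<gamma> * real t) + exp (- \<gamma> * (real T - real t))) * \<nu> b
              + (\<Sum>s<T. green_kernel \<gamma> T t s * \<nu> (f s))))"
      proof (intro exI[of _ h] conjI allI impI)
        show "bvp_solution ?L ?B0 ?BT T f b h" by (rule h)
        fix h' t assume h': "bvp_solution ?L ?B0 ?BT T f b h'" and t: "t \<le> T"
        have "bvp_solution ?L ?B0 ?BT T (\<lambda>_. 0) 0 (\<lambda>t. h' t - h t)"
          using h h' unfolding bvp_solution_def
          by (auto simp: matrix_vector_mult_diff_distrib algebra_simps)
        from zero[OF this T t] show "h' t = h t" by simp
      next
        fix t assume t: "t \<le> T"
        \<comment> \<open>One factor \<open>m\<close> passes from \<open>\<nu>\<close> to the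
          Euclidean norm of the solution, another one back on the data; together they are the
          \<open>m\<^sup>2\<close> in \<open>C\<close>.\<close>
        have "\<nu> (h t) \<le> m * norm (h t)" by (rule m(2))
        also have "\<dots> \<le> m * (6000 * \<kappa>^11 * ((exp (- \<gamma> * real t) + exp (- \<gamma> * (real T - real t))) * norm b
           + (\<Sum>s<T. exp (- \<gamma> * \<bar>real t - real s\<bar>) * norm (f s))))"
          using m(1) by (intro mult_left_mono est[OF h T t]) simp
        also have "\<dots> \<le> m * (6000 * \<kappa>^11 * ((exp (- \<gamma> * real t) + exp (- \<gamma> * (real T - real t))) * (m * \<nu> b)
           + (\<Sum>s<T. green_kernel \<gamma> T t s * (m * \<nu> (f s)))))"
          using m(1) k by (intro mult_left_mono add_mono sum_mono mult_mono m(3)) (auto simp: green_kernel_def)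
        also have "(\<Sum>s<T. green_kernel \<gamma> T t s * (m * \<nu> (f s))) = m * (\<Sum>s<T. green_kernel \<gamma> T t s * \<nu> (f s))"
          by (simp add: sum_distrib_left mult_ac)
        also have "m * (6000 * \<kappa>^11 * ((exp (- \<gamma> * real t) + exp (- \<gamma> * (real T - real t))) * (m * \<nu> b)
           + m * (\<Sum>s<T. green_kernel \<gamma> T t s * \<nu> (f s))))
          = C * ((exp (- \<gamma> * real t) + exp (- \<gamma> * (real T - real t))) * \<nu> b
              + (\<Sum>s<T. green_kernel \<gamma> T t s * \<nu> (f s)))"
          by (simp add: C_def power2_eq_square algebra_simps)
        finally show "\<nu> (h t) \<le> C * ((exp (- \<gamma> * real t) + exp (- \<gamma> * (real T - real t))) * \<nu> b
              + (\<Sum>s<T. green_kernel \<gamma> T t s * \<nu> (f s)))" .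
      qed
    qed
  qed
  then show thesis by (rule that)
qed

section \<open>Spectral consequences of the Green estimate\<close>

lemma columns_basis_kernel:
  assumes V: "columns_basis V E" and z: "V *v z = 0"
  shows "z = 0"
proof -
  have inj: "inj (\<lambda>j. column j V)" and ind: "independent (columns V)" using V by (auto simp: columns_basis_def)
  have cols: "columns V = range (\<lambda>j. column j V)" by (auto simp: columns_def)
  define c where "c v = z $ (inv (\<lambda>j. column j V) v)" for v
  have c: "c (column j V) = z $ j" for j using inj by (simp add: c_def inv_f_f[of "\<lambda>j. column j V"])
  have "(\<Sum>v\<in>columns V. c v *\<^sub>R v) = (\<Sum>j\<in>UNIV. z $ j *\<^sub>R column j V)"
    unfolding cols by (subst sum.reindex[OF inj]) (simp add: c)
  also have "\<dots> = V *v z"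
    by (simp add: vec_eq_iff matrix_vector_mult_def column_def mult.commute)
  finally have zero: "(\<Sum>v\<in>columns V. c v *\<^sub>R v) = 0" using z by simp
  have "z $ j = 0" for j
    using independentD[OF ind _ subset_refl zero, of "column j V"] c by (simp add: cols)
  then show ?thesis by (simp add: vec_eq_iff)
qed

lemma columns_basis_mult_in:
  assumes "columns_basis V E"
  shows "V *v z \<in> E"
proof -
  have "V *v z = (\<Sum>j\<in>UNIV. z $ j *\<^sub>R column j V)"
    by (simp add: vec_eq_iff matrix_vector_mult_def column_def mult.commute)
  also have "\<dots> \<in> span (columns V)"
    by (intro span_sum span_scale span_base) (auto simp: columns_def)
  finally show ?thesis using assms by (simp add: columns_basis_def)
qed

lemma invertible_of_kernel:
  fixes X :: "real^'d^'d"
  assumes "\<And>z. X *v z = 0 \<Longrightarrow> z = 0"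
  shows "invertible X"
  using assms matrix_left_invertible_ker[of X] invertible_left_inverse by blast

lemma norm_cvector_split: "(norm (cvector x + \<i> *s cvector y))\<^sup>2 = (norm x)\<^sup>2 + (norm y)\<^sup>2"
proof -
  have sq: "(norm v)\<^sup>2 = (\<Sum>i\<in>UNIV. (norm (v $ i))\<^sup>2)" for v :: "complex^'a"
    by (simp add: norm_vec_def L2_set_def sum_nonneg)
  have sqr: "(norm v)\<^sup>2 = (\<Sum>i\<in>UNIV. (v $ i)\<^sup>2)" for v :: "real^'a"
    by (simp add: norm_vec_def L2_set_def sum_nonneg)
  show ?thesis
    unfolding sq sqr sum.distrib[symmetric] by (intro sum.cong) (auto simp: cvector_def cmod_power2)
qed

lemma LIMSEQ_zero_upper_bound:
  fixes v :: "'a::real_normed_vector"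
  assumes "\<And>n. n \<ge> 1 \<Longrightarrow> norm v \<le> u n" and "u \<longlonglongrightarrow> 0"
  shows "v = 0"
proof -
  have "norm v \<le> 0"
    by (rule LIMSEQ_le_const[OF assms(2)]) (use assms(1) in blast)
  then show ?thesis by simp
qed

text \<open>
  The homogeneous Green estimate already determines the spectral picture: a trajectory that decays
  at one end and satisfies the boundary condition at the other has vanishing boundary data in the
  limit, and a trajectory on the unit circle stays bounded while the estimate makes its midpoint decay.
\<close>

locale homogeneous_green =
  fixes M :: "real^('d::finite + 'd)^('d + 'd)" and S :: "real^'d^'d" and C \<gamma> :: real and N
  assumes C: "C \<ge> 0" and \<gamma>: "\<gamma> > 0"
    and est: "\<And>T h t. T \<ge> 1 \<Longrightarrow> (\<And>s. s < T \<Longrightarrow> h (Suc s) = M *v h s) \<Longrightarrow> t \<le> T \<Longrightarrow>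
      norm (h t) \<le> C * (exp (- \<gamma> * real t) * norm (upper (h 0))
        + exp (- \<gamma> * (real T - real t)) * norm (lower (h T) - S *v upper (h T)))"
    and inv: "N ** M = mat 1" "M ** N = mat 1"
begin

text \<open>The estimate is read at time 0 over growing horizons: the initial row vanishes, and the
  terminal row tends to 0 because the orbit itself does.\<close>

lemma stable_upper_zero:
  assumes v: "v \<in> stable_subspace M" and u: "upper v = 0"
  shows "v = 0"
proof (rule LIMSEQ_zero_upper_bound)
  define h where "h t = ((*v) M ^^ t) v" for t
  have h0: "h \<longlonglongrightarrow> 0" unfolding h_def by (rule stable_subspace_tendsto_0[OF v])
  let ?g = "\<lambda>T. C * (norm (h T) + norm S * norm (h T))"
  show "?g \<longlonglongrightarrow> 0"
    by (rule tendsto_eq_intros tendsto_norm_zero[OF h0] refl | simp)+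
  fix T :: nat assume T: "T \<ge> 1"
  have "norm (h 0) \<le> C * (exp (- \<gamma> * real 0) * norm (upper (h 0))
        + exp (- \<gamma> * (real T - real 0)) * norm (lower (h T) - S *v upper (h T)))"
    by (rule est[OF T]) (simp_all add: h_def)
  also have "\<dots> = C * (exp (- \<gamma> * real T) * norm (lower (h T) - S *v upper (h T)))"
    by (simp add: h_def u)
  also have "\<dots> \<le> C * (1 * norm (lower (h T) - S *v upper (h T)))"
    using C \<gamma> by (intro mult_left_mono mult_right_mono) auto
  also have "\<dots> \<le> ?g T"
  proof -
    have "norm (S *v upper (h T)) \<le> norm S * norm (h T)"
      by (rule order_trans[OF norm_matrix_vector_mult_le]) (simp add: mult_left_mono norm_upper_le)
    then have "norm (lower (h T) - S *v upper (h T)) \<le> norm (h T) + norm S * norm (h T)"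
      using norm_triangle_ineq4[of "lower (h T)" "S *v upper (h T)"] norm_lower_le[of "h T"] by linarith
    then show ?thesis using C by (simp add: mult_left_mono)
  qed
  finally show "norm v \<le> ?g T" by (simp add: h_def)
qed

text \<open>The mirror image: the backward orbit of \<open>v\<close> is arranged to end in
  \<open>v\<close> at time \<open>T\<close>. The terminal row then vanishes, and the initial state
  is bounded by an iterate of the inverse, which tends to 0.\<close>

lemma unstable_boundary_zero:
  assumes v: "v \<in> unstable_subspace M" and u: "lower v = S *v upper v"
  shows "v = 0"
proof (rule LIMSEQ_zero_upper_bound)
  define y where "y t = ((*v) N ^^ t) v" for t
  have y0: "y \<longlonglongrightarrow> 0" unfolding y_def by (rule unstable_subspace_tendsto_0[OF v inv(1)])
  show "(\<lambda>T. C * norm (y T)) \<longlonglongrightarrow> 0"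
    by (rule tendsto_eq_intros tendsto_norm_zero[OF y0] refl | simp)+
  fix T :: nat assume T: "T \<ge> 1"
  define h where "h t = y (T - t)" for t
  have step: "h (Suc s) = M *v h s" if "s < T" for s
  proof -
    have "T - s = Suc (T - Suc s)" using that by simp
    then have "y (T - s) = N *v y (T - Suc s)" unfolding y_def by simp
    then show ?thesis by (simp add: h_def matrix_vector_mul_assoc inv(2))
  qed
  have "norm (h T) \<le> C * (exp (- \<gamma> * real T) * norm (upper (h 0))
        + exp (- \<gamma> * (real T - real T)) * norm (lower (h T) - S *v upper (h T)))"
    by (rule est[OF T, of h T, OF step]) auto
  also have "\<dots> = C * (exp (- \<gamma> * real T) * norm (upper (y T)))"
    by (simp add: h_def y_def u)
  also have "\<dots> \<le> C * (1 * norm (y T))"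
    using C \<gamma> by (intro mult_left_mono mult_mono norm_upper_le) auto
  finally show "norm v \<le> C * norm (y T)" by (simp add: h_def y_def)
qed

lemma hyperbolic_M: "hyperbolic M"
  unfolding hyperbolic_def
proof (rule notI, elim exE conjE)
  fix \<mu> assume "eigenvalue (cmatrix M) \<mu>" and \<mu>: "cmod \<mu> = 1"
  then obtain v where v: "v \<noteq> 0" "cmatrix M *v v = \<mu> *s v" by (auto simp: eigenvalue_def)
  define a where "a = (\<chi> i. Re (v $ i))"
  define b where "b = (\<chi> i. Im (v $ i))"
  have vab: "v = cvector a + \<i> *s cvector b" unfolding a_def b_def by (rule complex_vector_split)
  define h where "h t = ((*v) M ^^ t) a" for t
  define k where "k t = ((*v) M ^^ t) b" for t
  have "cvector (h t) + \<i> *s cvector (k t) = ((*v) (cmatrix M) ^^ t) v" for t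
    by (simp only: vab h_def k_def funpow_matrix_linear funpow_cmatrix_cvector)
  moreover have "((*v) (cmatrix M) ^^ t) v = \<mu> ^ t *s v" for t
    by (induction t) (simp_all add: v(2) vector_scalar_commute mult.commute)
  \<comment> \<open>The real and imaginary parts of the complex orbit are real trajectories, and as
    \<open>\<mu>\<close> has modulus 1 the sum of their squared norms is constant.\<close>
  ultimately have hk: "(norm (h t))\<^sup>2 + (norm (k t))\<^sup>2 = (norm v)\<^sup>2" for t
    by (metis norm_cvector_split norm_vector_smult norm_power \<mu> power_one mult_1)
  have le: "(norm (h t))\<^sup>2 \<le> (norm v)\<^sup>2" "(norm (k t))\<^sup>2 \<le> (norm v)\<^sup>2" for t
    using hk[of t] zero_le_power2[of "norm (h t)"] zero_le_power2[of "norm (k t)"] by linarith+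
  have hv: "norm (h t) \<le> norm v" and kv: "norm (k t) \<le> norm v" for t
    by (rule power2_le_imp_le[OF le(1) norm_ge_zero], rule power2_le_imp_le[OF le(2) norm_ge_zero])
  have bd: "norm (y n) \<le> C * (exp (- \<gamma> * real n) * ((2 + norm S) * norm v))"
    if n: "n \<ge> 1" and y: "y = h \<or> y = k" for n y
  proof -
    have yv: "norm (y t) \<le> norm v" for t using y hv[of t] kv[of t] by (elim disjE) simp_all
    \<comment> \<open>The horizon \<open>2 * n\<close> makes both exponentials equal to
      \<open>exp (- \<gamma> * real n)\<close>.\<close>
    have "norm (y n) \<le> C * (exp (- \<gamma> * real n) * norm (upper (y 0))
        + exp (- \<gamma> * (real (2 * n) - real n)) * norm (lower (y (2 * n)) - S *v upper (y (2 * n))))"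
      by (rule est) (use n y in \<open>auto simp: h_def k_def\<close>)
    also have "\<dots> = C * (exp (- \<gamma> * real n) * (norm (upper (y 0)) + norm (lower (y (2 * n)) - S *v upper (y (2 * n)))))"
      by (simp add: distrib_left)
    also have "\<dots> \<le> C * (exp (- \<gamma> * real n) * ((2 + norm S) * norm v))"
    proof (intro mult_left_mono)
      have "norm (S *v upper (y (2 * n))) \<le> norm S * norm v"
        by (rule order_trans[OF norm_matrix_vector_mult_le])
          (intro mult_left_mono order_trans[OF norm_upper_le yv], simp)
      moreover have "norm (upper (y 0)) \<le> norm v" "norm (lower (y (2 * n))) \<le> norm v"
        by (rule order_trans[OF norm_upper_le yv], rule order_trans[OF norm_lower_le yv])
      ultimately show "norm (upper (y 0)) + norm (lower (y (2 * n)) - S *v upper (y (2 * n))) \<le> (2 + norm S) * norm v"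
        using norm_triangle_ineq4[of "lower (y (2 * n))" "S *v upper (y (2 * n))"]
        by (simp add: distrib_right)
    qed (use C in auto)
    finally show ?thesis .
  qed
  have "v = 0"
  proof (rule LIMSEQ_zero_upper_bound)
    let ?e = "\<lambda>n. exp (- \<gamma> * real n)"
    have "filterlim (\<lambda>n. \<gamma> * real n) at_top sequentially"
      using \<gamma> by (intro filterlim_tendsto_pos_mult_at_top[OF tendsto_const] filterlim_real_sequentially)
    then have "?e \<longlonglongrightarrow> 0"
      by (intro filterlim_compose[OF exp_at_bot]) (simp add: filterlim_uminus_at_bot)
    then show "(\<lambda>n. 2 * (C * (?e n * ((2 + norm S) * norm v)))) \<longlonglongrightarrow> 0"
      by (intro tendsto_mult_right_zero tendsto_mult_left_zero)
    fix n :: nat assume n: "n \<ge> 1"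
    have "(norm v)\<^sup>2 \<le> (norm (h n) + norm (k n))\<^sup>2" unfolding hk[of n, symmetric] by (simp add: power2_sum)
    then have "norm v \<le> norm (h n) + norm (k n)" by (rule power2_le_imp_le) simp
    then show "norm v \<le> 2 * (C * (?e n * ((2 + norm S) * norm v)))"
      using bd[OF n, of h] bd[OF n, of k] by simp
  qed
  with v(1) show False by simp
qed

end

section \<open>Dimension count and assembly\<close>

lemma dim_le_of_inj_part:
  fixes f :: "real^'n \<Rightarrow> real^'d" and E :: "(real^'n) set"
  assumes f: "linear f" and E: "subspace E" and ker: "\<And>v. v \<in> E \<Longrightarrow> f v = 0 \<Longrightarrow> v = 0"
  shows "dim E \<le> CARD('d)"
proof -
  have "inj_on f E" using linear_inj_on_iff_eq_0[OF f E] ker by blast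
  then have "inj_on f (span E)" using E by (simp add: span_eq_iff[THEN iffD2])
  then have "dim (f ` E) = dim E" by (rule dim_image_eq[OF f])
  then show ?thesis using dim_subset_UNIV[of "f ` E"] by simp
qed

text \<open>Each subspace embeds into one half of the coordinates, so both dimensions are at most
  \<open>CARD('d)\<close>. Together the subspaces fill a space of twice that dimension, so both
  bounds are attained.\<close>

theorem hyperbolic_dims:
  fixes M :: "real^('d::finite + 'd)^('d + 'd)"
  assumes hyp: "hyperbolic M"
    and s: "\<And>v. v \<in> stable_subspace M \<Longrightarrow> upper v = 0 \<Longrightarrow> v = 0"
    and u: "\<And>v. v \<in> unstable_subspace M \<Longrightarrow> lower v = 0 \<Longrightarrow> v = 0"
  shows "dim (stable_subspace M) = CARD('d)" "dim (unstable_subspace M) = CARD('d)"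
proof -
  have sub: "subspace (stable_subspace M)" "subspace (unstable_subspace M)"
    unfolding stable_subspace_def unstable_subspace_def by (rule subspace_spectral_subspace)+
  have lin: "linear (upper :: real^('d + 'd) \<Rightarrow> _)" "linear (lower :: real^('d + 'd) \<Rightarrow> _)"
    by (auto intro!: linearI simp: upper_lower_linear)
  have le: "dim (stable_subspace M) \<le> CARD('d)" "dim (unstable_subspace M) \<le> CARD('d)"
    using dim_le_of_inj_part[OF lin(1) sub(1) s] dim_le_of_inj_part[OF lin(2) sub(2) u] by auto
  have "{x + y |x y. x \<in> stable_subspace M \<and> y \<in> unstable_subspace M} = UNIV"
    using hyperbolic_splitting[OF hyp] by blast
  then have "dim (stable_subspace M) + dim (unstable_subspace M) \<ge> dim (UNIV :: (real^('d + 'd)) set)"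
    using dim_sums_Int[OF sub] by simp
  then have "dim (stable_subspace M) + dim (unstable_subspace M) \<ge> CARD('d) + CARD('d)" by simp
  with le show "dim (stable_subspace M) = CARD('d)" "dim (unstable_subspace M) = CARD('d)" by auto
qed

lemma neg_semidef_0: "neg_semidef 0"
  by (simp add: neg_semidef_def transpose_def vec_eq_iff)

text \<open>A single datum is a compact set, so the uniform bounds specialize to it.\<close>

lemma lq_homogeneous_green:
  fixes A :: "real^'d^'d" and B :: "real^'m^'d"
  assumes data: "lq_data A B Q R" and S: "neg_semidef S"
  obtains C \<gamma> N where "homogeneous_green (lq_matrix A B Q R) S C \<gamma> N"
proof -
  have inv: "invertible A" using data by (simp add: lq_data_def)
  have K: "compact {(A, B, Q, R, S)}" "{(A, B, Q, R, S)} \<subseteq> data_class"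
    using data S by (simp_all add: data_class_def)
  obtain \<kappa> where k: "\<kappa> \<ge> 1" and "\<exists>P. lq_bounds \<kappa> A B (B ** matrix_inv R ** transpose B) Q S P"
    by (rule lq_bounds_compact[OF K]) blast
  then obtain P where bounds: "lq_bounds \<kappa> A B (B ** matrix_inv R ** transpose B) Q S P" by blast
  obtain N where N: "N ** lq_matrix A B Q R = mat 1" "lq_matrix A B Q R ** N = mat 1"
    using lq_matrix_invertible[OF inv] by blast
  have "homogeneous_green (lq_matrix A B Q R) S (6000 * \<kappa>^11) (green_rate \<kappa>) N"
  proof
    show "0 \<le> 6000 * \<kappa>^11" using k by simp
    show "0 < green_rate \<kappa>" by (rule green_rate(1)[OF k])
    fix T t :: nat and h assume "1 \<le> T" "\<And>s. s < T \<Longrightarrow> h (Suc s) = lq_matrix A B Q R *v h s" "t \<le> T"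
    then show "norm (h t) \<le> 6000 * \<kappa>^11 * (exp (- green_rate \<kappa> * real t) * norm (upper (h 0))
        + exp (- green_rate \<kappa> * (real T - real t)) * norm (lower (h T) - S *v upper (h T)))"
      using lq_green_euclidean[OF inv bounds, of T h "\<lambda>_. 0" t] by simp
  qed (rule N)+
  then show thesis by (rule that)
qed

theorem theorem6p2:
  fixes \<nu> :: "real^('d::finite + 'd) \<Rightarrow> real"
  assumes "is_norm \<nu>"
  shows
    "(\<forall>(A :: real^'d^'d) (B :: real^'m::finite^'d) (Q :: real^'d^'d) (R :: real^'m^'m).
        lq_data A B Q R \<longrightarrow>
          hyperbolic (lq_matrix A B Q R) \<and>
          dim (stable_subspace (lq_matrix A B Q R)) = CARD('d) \<and>
          dim (unstable_subspace (lq_matrix A B Q R)) = CARD('d) \<and>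
          (\<forall>(X\<^sub>s :: real^'d^'d) P\<^sub>s.
             columns_basis (block_col X\<^sub>s P\<^sub>s) (stable_subspace (lq_matrix A B Q R))
               \<longrightarrow> invertible X\<^sub>s) \<and>
          (\<forall>(X\<^sub>u :: real^'d^'d) P\<^sub>u S.
             columns_basis (block_col X\<^sub>u P\<^sub>u) (unstable_subspace (lq_matrix A B Q R)) \<and>
             neg_semidef S \<longrightarrow> invertible (P\<^sub>u - S ** X\<^sub>u)) \<and>
          (\<forall>S. neg_semidef S \<longrightarrow> (\<exists>C \<gamma>. lq_green \<nu> A B Q R S C \<gamma> 1))) \<and>
     (\<forall>K :: ((real^'d^'d) \<times> (real^'m^'d) \<times> (real^'d^'d) \<times> (real^'m^'m) \<times> (real^'d^'d)) set.
        compact K \<and> K \<subseteq> data_class \<longrightarrow>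
          (\<exists>C \<gamma>. \<forall>(A, B, Q, R, S) \<in> K. lq_green \<nu> A B Q R S C \<gamma> 1))"
proof -
  have compact_case: "\<exists>C \<gamma>. \<forall>(A, B, Q, R, S) \<in> K. lq_green \<nu> A B Q R S C \<gamma> 1"
    if K: "compact K" "K \<subseteq> data_class"
    for K :: "((real^'d^'d) \<times> (real^'m^'d) \<times> (real^'d^'d) \<times> (real^'m^'m) \<times> (real^'d^'d)) set"
  proof -
    obtain \<kappa> where k: "\<kappa> \<ge> 1" and bounds: "\<And>A B Q R S. (A, B, Q, R, S) \<in> K \<Longrightarrow>
        \<exists>P. lq_bounds \<kappa> A B (B ** matrix_inv R ** transpose B) Q S P"
      using lq_bounds_compact[OF K] by metis
    obtain C \<gamma> where green: "\<And>(A :: real^'d^'d) (B :: real^'m^'d) Q R S P. invertible A \<Longrightarrow>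
        lq_bounds \<kappa> A B (B ** matrix_inv R ** transpose B) Q S P \<Longrightarrow> lq_green \<nu> A B Q R S C \<gamma> 1"
      using lq_green_of_bounds[OF assms k] by metis
    have "lq_green \<nu> A B Q R S C \<gamma> 1" if "(A, B, Q, R, S) \<in> K" for A B Q R S
    proof -
      have "invertible A" using K(2) that by (auto simp: data_class_def lq_data_def)
      then show ?thesis using green bounds[OF that] by blast
    qed
    then show ?thesis by blast
  qed
  moreover have "hyperbolic (lq_matrix A B Q R) \<and>
          dim (stable_subspace (lq_matrix A B Q R)) = CARD('d) \<and>
          dim (unstable_subspace (lq_matrix A B Q R)) = CARD('d) \<and>
          (\<forall>(X\<^sub>s :: real^'d^'d) P\<^sub>s.
             columns_basis (block_col X\<^sub>s P\<^sub>s) (stable_subspace (lq_matrix A B Q R))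
               \<longrightarrow> invertible X\<^sub>s) \<and>
          (\<forall>(X\<^sub>u :: real^'d^'d) P\<^sub>u S.
             columns_basis (block_col X\<^sub>u P\<^sub>u) (unstable_subspace (lq_matrix A B Q R)) \<and>
             neg_semidef S \<longrightarrow> invertible (P\<^sub>u - S ** X\<^sub>u)) \<and>
          (\<forall>S. neg_semidef S \<longrightarrow> (\<exists>C \<gamma>. lq_green \<nu> A B Q R S C \<gamma> 1))"
    if data: "lq_data A B Q R"
    for A :: "real^'d^'d" and B :: "real^'m^'d" and Q :: "real^'d^'d" and R :: "real^'m^'m"
  proof -
    let ?M = "lq_matrix A B Q R"
    \<comment> \<open>\<open>S = 0\<close> is admissible, and its estimate serves the claims that
      involve \<open>M\<close> alone. For the block \<open>P - S ** X\<close> the estimate is taken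
      anew with the given \<open>S\<close>.\<close>
    obtain C \<gamma> N where hg: "homogeneous_green ?M 0 C \<gamma> N"
      using lq_homogeneous_green[OF data neg_semidef_0] by metis
    have hyp: "hyperbolic ?M" by (rule homogeneous_green.hyperbolic_M[OF hg])
    have s: "v = 0" if "v \<in> stable_subspace ?M" "upper v = 0" for v
      using homogeneous_green.stable_upper_zero[OF hg that] .
    have u: "v = 0" if v: "v \<in> unstable_subspace ?M" and S: "neg_semidef S" and b: "lower v = S *v upper v" for v S
    proof -
      obtain C \<gamma> N where "homogeneous_green ?M S C \<gamma> N"
        using lq_homogeneous_green[OF data S] by metis
      from homogeneous_green.unstable_boundary_zero[OF this v b] show ?thesis .
    qed
    have u0: "v = 0" if "v \<in> unstable_subspace ?M" "lower v = 0" for v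
      using u[OF that(1) neg_semidef_0] that(2) by simp
    have Xs: "invertible X" if V: "columns_basis (block_col X P) (stable_subspace ?M)" for X P :: "real^'d^'d"
    proof (rule invertible_of_kernel)
      fix z assume z: "X *v z = 0"
      \<comment> \<open>A kernel vector of \<open>X\<close> yields a vector of the stable subspace
        whose state half vanishes.\<close>
      have "block_col X P *v z = 0"
        using columns_basis_mult_in[OF V, of z] by (intro s) (simp_all add: block_col_mult_vec z)
      then show "z = 0" by (rule columns_basis_kernel[OF V])
    qed
    have Pu: "invertible (P - S ** X)"
      if V: "columns_basis (block_col X P) (unstable_subspace ?M)" and S: "neg_semidef S" for X P S :: "real^'d^'d"
    proof (rule invertible_of_kernel)
      fix z assume "(P - S ** X) *v z = 0"
      then have "P *v z = S *v (X *v z)"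
        by (simp add: matrix_vector_mult_diff_rdistrib matrix_vector_mul_assoc)
      then have "block_col X P *v z = 0"
        using columns_basis_mult_in[OF V, of z] by (intro u[OF _ S]) (simp_all add: block_col_mult_vec)
      then show "z = 0" by (rule columns_basis_kernel[OF V])
    qed
    have "\<exists>C \<gamma>. lq_green \<nu> A B Q R S C \<gamma> 1" if "neg_semidef S" for S
      using compact_case[of "{(A, B, Q, R, S)}"] data that by (simp add: data_class_def)
    then show ?thesis using hyp hyperbolic_dims[OF hyp s u0] Xs Pu by blast
  qed
  ultimately show ?thesis by blast
qed

end
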